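(* There exists a flat manifold $M$ whose holonomy representation is of quaternionic type, i.e. such that, if $G$ is the holonomy group of $M$ and $\varphi\colon G\to \mathrm{GL}_n(\mathbb{Z})$ ($n=\dim M\ge 1$) is its holonomy representation, then every irreducible $\mathbb{R}[G]$-submodule $V$ of $\mathbb{R}\otimes_{\mathbb{Z}}\mathbb{Z}^n$ (with $G$ acting through $\varphi$) satisfies $\mathrm{End}_{\mathbb{R}[G]}(V)\cong\mathbb{H}$, the real quaternion division algebra.
   Context: A flat manifold of dimension $n\ge 1$ is a compact connected Riemannian manifold $M$ of dimension $n$ without boundary and with sectional curvature equal to zero. By Bieberbach's theorem its fundamental group $\Gamma=\pi_1(M)$ is torsion-free and fits into a short exact sequence $0\to\mathbb{Z}^n\to\Gamma\xrightarrow{p} G\to 1$, where $G$ is finite and $\mathbb{Z}^n$ is the unique maximal abelian subgroup of finite index in $\Gamma$. The finite group $G$ is the holonomy group of $M$. The holonomy representation is the (faithful) homomorphism $\varphi\colon G\to\mathrm{GL}_n(\mathbb{Z})$ given by $\varphi(g)(z)=\gamma z\gamma^{-1}$ for $z\in\mathbb{Z}^n$, where $\gamma\in\Gamma$ is any element with $p(\gamma)=g$. An irreducible $\mathbb{R}[G]$-module $V$ is of quaternionic type if $\mathrm{End}_{\mathbb{R}[G]}(V)\cong\mathbb{H}$. The holonomy representation is said to be of quaternionic type if all irreducible components of the $\mathbb{R}[G]$-module $\mathbb{R}\otimes_{\mathbb{Z}}\mathbb{Z}^n$ are of quaternionic type. *)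

theory Defs
  imports
    "HOL-Analysis.Analysis"
    "HOL-Algebra.Coset"
    "Jordan_Normal_Form.Gauss_Jordan_Elimination"
begin

section \<open>Riemannian manifolds\<close>

text \<open>
  Points of $\mathbf{R}^n$ in which charts take their values are those of
  \<^const>\<open>Euclidean_space\<close>, i.e. functions \<^typ>\<open>nat \<Rightarrow> real\<close> vanishing at all indices \<open>i \<ge> n\<close>.
  Coordinates, and therefore all tensor indices, run over \<open>0, \<dots>, n - 1\<close>.
\<close>

definition partial_deriv :: "nat \<Rightarrow> ((nat \<Rightarrow> real) \<Rightarrow> real) \<Rightarrow> (nat \<Rightarrow> real) \<Rightarrow> real" where
  "partial_deriv i f x = deriv (\<lambda>t. f (x(i := t))) (x i)"

text \<open>
  Smoothness of \<open>f\<close> on an open subset \<open>S\<close> of $\mathbf{R}^n$: all iterated partial derivatives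
  (including \<open>f\<close> itself, for the empty list) exist and are continuous on \<open>S\<close>.
\<close>

definition smooth_on :: "nat \<Rightarrow> (nat \<Rightarrow> real) set \<Rightarrow> ((nat \<Rightarrow> real) \<Rightarrow> real) \<Rightarrow> bool" where
  "smooth_on n S f \<longleftrightarrow>
     (\<forall>is. set is \<subseteq> {..<n} \<longrightarrow>
        continuous_map (subtopology (Euclidean_space n) S) euclideanreal (foldr partial_deriv is f) \<and>
        (\<forall>x\<in>S. \<forall>i<n. (\<lambda>t. foldr partial_deriv is f (x(i := t))) differentiable (at (x i))))"

text \<open>A chart is a pair of its domain and the coordinate map.\<close>

type_synonym 'a chart = "'a set \<times> ('a \<Rightarrow> nat \<Rightarrow> real)"

definition transition :: "'a chart \<Rightarrow> 'a chart \<Rightarrow> (nat \<Rightarrow> real) \<Rightarrow> nat \<Rightarrow> real" where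
  "transition c d x = snd d (inv_into (fst c) (snd c) x)"

text \<open>
  Smooth manifolds without boundary; \<open>A\<close> is a smooth atlas, not required to be maximal.
\<close>

locale smooth_manifold =
  fixes n :: nat and M :: "'a topology" and A :: "'a chart set"
  assumes hausdorff: "Hausdorff_space M"
    and second_countable: "second_countable M"
    and charts_cover: "(\<Union>(U, \<phi>)\<in>A. U) = topspace M"
    and chart_domain_open: "(U, \<phi>) \<in> A \<Longrightarrow> openin M U"
    and chart_range_open: "(U, \<phi>) \<in> A \<Longrightarrow> openin (Euclidean_space n) (\<phi> ` U)"
    and chart_homeomorphic: "(U, \<phi>) \<in> A \<Longrightarrow>
           homeomorphic_map (subtopology M U) (subtopology (Euclidean_space n) (\<phi> ` U)) \<phi>"
    and transition_smooth: "(U, \<phi>) \<in> A \<Longrightarrow> (V, \<psi>) \<in> A \<Longrightarrow> k < n \<Longrightarrow>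
           smooth_on n (\<phi> ` (U \<inter> V)) (\<lambda>x. transition (U, \<phi>) (V, \<psi>) x k)"

text \<open>
  The metric is given in each chart \<open>c\<close> by its Gram matrix \<open>g c x\<close> with respect to the coordinate
  vector fields, as a function of the coordinates \<open>x\<close>; the last assumption is the
  transformation law of a covariant 2-tensor.
\<close>

locale riemannian_manifold = smooth_manifold n M A
  for n :: nat and M :: "'a topology" and A :: "'a chart set" +
  fixes g :: "'a chart \<Rightarrow> (nat \<Rightarrow> real) \<Rightarrow> real mat"
  assumes metric_dim: "(U, \<phi>) \<in> A \<Longrightarrow> x \<in> \<phi> ` U \<Longrightarrow> g (U, \<phi>) x \<in> carrier_mat n n"
    and metric_smooth: "(U, \<phi>) \<in> A \<Longrightarrow> i < n \<Longrightarrow> j < n \<Longrightarrow>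
           smooth_on n (\<phi> ` U) (\<lambda>x. g (U, \<phi>) x $$ (i, j))"
    and metric_symmetric: "(U, \<phi>) \<in> A \<Longrightarrow> x \<in> \<phi> ` U \<Longrightarrow>
           transpose_mat (g (U, \<phi>) x) = g (U, \<phi>) x"
    and metric_positive: "(U, \<phi>) \<in> A \<Longrightarrow> x \<in> \<phi> ` U \<Longrightarrow> v \<in> carrier_vec n \<Longrightarrow> v \<noteq> 0\<^sub>v n \<Longrightarrow>
           scalar_prod v (g (U, \<phi>) x *\<^sub>v v) > 0"
    and metric_transform: "(U, \<phi>) \<in> A \<Longrightarrow> (V, \<psi>) \<in> A \<Longrightarrow> p \<in> U \<inter> V \<Longrightarrow> i < n \<Longrightarrow> j < n \<Longrightarrow>
           g (U, \<phi>) (\<phi> p) $$ (i, j) =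
             (\<Sum>k<n. \<Sum>l<n.
                partial_deriv i (\<lambda>x. transition (U, \<phi>) (V, \<psi>) x k) (\<phi> p) *
                partial_deriv j (\<lambda>x. transition (U, \<phi>) (V, \<psi>) x l) (\<phi> p) *
                g (V, \<psi>) (\<psi> p) $$ (k, l))"

text \<open>
  Curvature of a metric \<open>h\<close> in local coordinates.
  \<open>christoffel n h k i j\<close> is $\Gamma^k_{ij}$, the coefficient of $\partial_k$ in
  $\nabla_{\partial_i}\partial_j$ for the Levi-Civita connection, and \<open>riemann n h l i j k\<close> is the
  coefficient of $\partial_l$ in $R(\partial_i,\partial_j)\partial_k$, where
  $R(X,Y) = [\nabla_X,\nabla_Y] - \nabla_{[X,Y]}$.
\<close>

definition christoffel ::
  "nat \<Rightarrow> ((nat \<Rightarrow> real) \<Rightarrow> real mat) \<Rightarrow> nat \<Rightarrow> nat \<Rightarrow> nat \<Rightarrow> (nat \<Rightarrow> real) \<Rightarrow> real" where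
  "christoffel n h k i j x =
     1/2 * (\<Sum>l<n. the (mat_inverse (h x)) $$ (k, l) *
              (partial_deriv i (\<lambda>y. h y $$ (j, l)) x
             + partial_deriv j (\<lambda>y. h y $$ (i, l)) x
             - partial_deriv l (\<lambda>y. h y $$ (i, j)) x))"

definition riemann ::
  "nat \<Rightarrow> ((nat \<Rightarrow> real) \<Rightarrow> real mat) \<Rightarrow> nat \<Rightarrow> nat \<Rightarrow> nat \<Rightarrow> nat \<Rightarrow> (nat \<Rightarrow> real) \<Rightarrow> real" where
  "riemann n h l i j k x =
     partial_deriv i (christoffel n h l j k) x - partial_deriv j (christoffel n h l i k) x
     + (\<Sum>m<n. christoffel n h m j k x * christoffel n h l i m x
             - christoffel n h m i k x * christoffel n h l j m x)"

text \<open>$\langle R(u,v)v,u\rangle / (|u|^2|v|^2 - \langle u,v\rangle^2)$\<close>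

definition sectional_curvature ::
  "nat \<Rightarrow> ((nat \<Rightarrow> real) \<Rightarrow> real mat) \<Rightarrow> (nat \<Rightarrow> real) \<Rightarrow> real vec \<Rightarrow> real vec \<Rightarrow> real" where
  "sectional_curvature n h x u v =
     (\<Sum>i<n. \<Sum>j<n. \<Sum>k<n. \<Sum>l<n. \<Sum>m<n.
        h x $$ (l, m) * riemann n h l i j k x *
        vec_index u i * vec_index v j * vec_index v k * vec_index u m)
     / (scalar_prod u (h x *\<^sub>v u) * scalar_prod v (h x *\<^sub>v v) - (scalar_prod u (h x *\<^sub>v v))\<^sup>2)"

locale flat_manifold = riemannian_manifold n M A g
  for n :: nat and M :: "'a topology" and A :: "'a chart set"
    and g :: "'a chart \<Rightarrow> (nat \<Rightarrow> real) \<Rightarrow> real mat" +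
  assumes dim_pos: "n \<ge> 1"
    and nonempty: "topspace M \<noteq> {}"
    and compact: "compact_space M"
    and connected: "connected_space M"
    and flat: "(U, \<phi>) \<in> A \<Longrightarrow> x \<in> \<phi> ` U \<Longrightarrow> u \<in> carrier_vec n \<Longrightarrow> v \<in> carrier_vec n \<Longrightarrow>
           (\<And>a b. a \<cdot>\<^sub>v u + b \<cdot>\<^sub>v v = 0\<^sub>v n \<Longrightarrow> a = 0 \<and> b = 0) \<Longrightarrow>
           sectional_curvature n (g (U, \<phi>)) x u v = 0"

section \<open>The fundamental group\<close>

definition loops :: "'a topology \<Rightarrow> 'a \<Rightarrow> (real \<Rightarrow> 'a) set" where
  "loops X p = {f. pathin X f \<and> f 0 = p \<and> f 1 = p}"

definition loop_class :: "'a topology \<Rightarrow> 'a \<Rightarrow> (real \<Rightarrow> 'a) \<Rightarrow> (real \<Rightarrow> 'a) set" where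
  "loop_class X p f =
     {h \<in> loops X p. homotopic_with (\<lambda>k. k 0 = p \<and> k 1 = p) (top_of_set {0..1}) X f h}"

text \<open>
  The library's \<^const>\<open>joinpaths\<close> needs the points to be in a topological type class, whereas \<open>X\<close> is an
  abstract topology.
\<close>

definition concat_loops :: "(real \<Rightarrow> 'a) \<Rightarrow> (real \<Rightarrow> 'a) \<Rightarrow> real \<Rightarrow> 'a" where
  "concat_loops f h = (\<lambda>t. if t \<le> 1/2 then f (2 * t) else h (2 * t - 1))"

definition fundamental_group :: "'a topology \<Rightarrow> 'a \<Rightarrow> (real \<Rightarrow> 'a) set monoid" where
  "fundamental_group X p =
     \<lparr>carrier = loop_class X p ` loops X p,
      mult = (\<lambda>\<alpha> \<beta>. \<Union>f\<in>\<alpha>. \<Union>h\<in>\<beta>. loop_class X p (concat_loops f h)),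
      one = loop_class X p (\<lambda>_. p)\<rparr>"

section \<open>The holonomy representation\<close>

definition maximal_abelian_subgroup :: "'g set \<Rightarrow> ('g, 'b) monoid_scheme \<Rightarrow> bool" where
  "maximal_abelian_subgroup L \<Gamma> \<longleftrightarrow>
     subgroup L \<Gamma> \<and> comm_group (\<Gamma>\<lparr>carrier := L\<rparr>) \<and>
     (\<forall>H. subgroup H \<Gamma> \<and> comm_group (\<Gamma>\<lparr>carrier := H\<rparr>) \<and> L \<subseteq> H \<longrightarrow> H = L)"

text \<open>Existence and uniqueness for fundamental groups of flat manifolds is Bieberbach's theorem.\<close>

definition translation_lattice :: "('g, 'b) monoid_scheme \<Rightarrow> 'g set" where
  "translation_lattice \<Gamma> = (THE L. maximal_abelian_subgroup L \<Gamma> \<and> finite (rcosets\<^bsub>\<Gamma>\<^esub> L))"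

definition holonomy_group :: "('g, 'b) monoid_scheme \<Rightarrow> 'g set monoid" where
  "holonomy_group \<Gamma> = \<Gamma> Mod (translation_lattice \<Gamma>)"

text \<open>
  \<open>\<iota>\<close> is the embedding of $\mathbf{Z}^n$ into \<open>\<Gamma>\<close> with image the translation lattice. The elements
  \<open>a\<close> of the holonomy group are cosets, and \<open>\<gamma> \<in> a\<close> says that \<open>\<gamma>\<close> is a preimage of \<open>a\<close>.
\<close>

definition holonomy_rep ::
  "('g, 'b) monoid_scheme \<Rightarrow> nat \<Rightarrow> (int vec \<Rightarrow> 'g) \<Rightarrow> 'g set \<Rightarrow> int mat" where
  "holonomy_rep \<Gamma> n \<iota> a =
     (THE B. B \<in> carrier_mat n n \<and>
        (\<forall>\<gamma>\<in>a. \<forall>z\<in>carrier_vec n. \<iota> (B *\<^sub>v z) = \<gamma> \<otimes>\<^bsub>\<Gamma>\<^esub> \<iota> z \<otimes>\<^bsub>\<Gamma>\<^esub> inv\<^bsub>\<Gamma>\<^esub> \<gamma>))"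

section \<open>Real representations of quaternionic type\<close>

text \<open>
  \<open>\<rho>\<close> makes $\mathbf{R}^n$ (\<^term>\<open>carrier_vec n\<close>) an $\mathbf{R}[G]$-module.
\<close>

definition rep_submodule ::
  "('g, 'b) monoid_scheme \<Rightarrow> nat \<Rightarrow> ('g \<Rightarrow> real mat) \<Rightarrow> real vec set \<Rightarrow> bool" where
  "rep_submodule G n \<rho> V \<longleftrightarrow>
     V \<subseteq> carrier_vec n \<and> 0\<^sub>v n \<in> V \<and>
     (\<forall>x\<in>V. \<forall>y\<in>V. x + y \<in> V) \<and>
     (\<forall>c. \<forall>x\<in>V. c \<cdot>\<^sub>v x \<in> V) \<and>
     (\<forall>a\<in>carrier G. \<forall>x\<in>V. \<rho> a *\<^sub>v x \<in> V)"

definition irreducible_rep_submodule ::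
  "('g, 'b) monoid_scheme \<Rightarrow> nat \<Rightarrow> ('g \<Rightarrow> real mat) \<Rightarrow> real vec set \<Rightarrow> bool" where
  "irreducible_rep_submodule G n \<rho> V \<longleftrightarrow>
     rep_submodule G n \<rho> V \<and> V \<noteq> {0\<^sub>v n} \<and>
     (\<forall>W. rep_submodule G n \<rho> W \<and> W \<subseteq> V \<longrightarrow> W = {0\<^sub>v n} \<or> W = V)"

definition rep_endomorphisms ::
  "('g, 'b) monoid_scheme \<Rightarrow> ('g \<Rightarrow> real mat) \<Rightarrow> real vec set \<Rightarrow> (real vec \<Rightarrow> real vec) set" where
  "rep_endomorphisms G \<rho> V =
     {f \<in> V \<rightarrow>\<^sub>E V.
        (\<forall>x\<in>V. \<forall>y\<in>V. f (x + y) = f x + f y) \<and>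
        (\<forall>c. \<forall>x\<in>V. f (c \<cdot>\<^sub>v x) = c \<cdot>\<^sub>v f x) \<and>
        (\<forall>a\<in>carrier G. \<forall>x\<in>V. f (\<rho> a *\<^sub>v x) = \<rho> a *\<^sub>v f x)}"

text \<open>
  The quaternion \<open>a + b i + c j + d k\<close> is the tuple \<open>(a, b, c, d)\<close>; the real vector space structure is
  the library's one on products.
\<close>

type_synonym quaternion = "real \<times> real \<times> real \<times> real"

fun quat_mult :: "quaternion \<Rightarrow> quaternion \<Rightarrow> quaternion" where
  "quat_mult (a, b, c, d) (a', b', c', d') =
     (a * a' - b * b' - c * c' - d * d',
      a * b' + b * a' + c * d' - d * c',
      a * c' - b * d' + c * a' + d * b',
      a * d' + b * c' - c * b' + d * a')"

text \<open>\<open>\<Phi>\<close> is an isomorphism of $\mathbf{R}$-algebras from the quaternions to the endomorphism algebra.\<close>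

definition quaternionic_type ::
  "('g, 'b) monoid_scheme \<Rightarrow> ('g \<Rightarrow> real mat) \<Rightarrow> real vec set \<Rightarrow> bool" where
  "quaternionic_type G \<rho> V \<longleftrightarrow>
     (\<exists>\<Phi> :: quaternion \<Rightarrow> real vec \<Rightarrow> real vec.
        bij_betw \<Phi> UNIV (rep_endomorphisms G \<rho> V) \<and>
        (\<forall>p q. \<Phi> (p + q) = (\<lambda>x\<in>V. \<Phi> p x + \<Phi> q x)) \<and>
        (\<forall>r p. \<Phi> (r *\<^sub>R p) = (\<lambda>x\<in>V. r \<cdot>\<^sub>v \<Phi> p x)) \<and>
        (\<forall>p q. \<Phi> (quat_mult p q) = compose V (\<Phi> p) (\<Phi> q)) \<and>
        \<Phi> (1, 0, 0, 0) = (\<lambda>x\<in>V. x))"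

text \<open>
  The choice of \<open>\<iota>\<close> only affects the representation by conjugation in $\mathrm{GL}_n(\mathbf{Z})$.
\<close>

definition holonomy_of_quaternionic_type :: "nat \<Rightarrow> ('g, 'b) monoid_scheme \<Rightarrow> bool" where
  "holonomy_of_quaternionic_type n \<Gamma> \<longleftrightarrow>
     (\<exists>\<iota> \<in> iso (monoid_vec TYPE(int) n) (\<Gamma>\<lparr>carrier := translation_lattice \<Gamma>\<rparr>).
        let G = holonomy_group \<Gamma>;
            \<rho> = (\<lambda>a. map_mat real_of_int (holonomy_rep \<Gamma> n \<iota> a))
        in \<forall>V. irreducible_rep_submodule G n \<rho> V \<longrightarrow> quaternionic_type G \<rho> V)"

end

theory Submission
  imports Defs
begin

unbundle no vec_syntax
unbundle bit_operations_syntax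

text \<open>
  Let \<open>G\<close> be a group of order 64 whose centre is a Klein four-group \<open>Z\<close> containing all involutions
  of \<open>G\<close>, and whose quotient by any of the three subgroups of \<open>Z\<close> of order 2 is the extraspecial
  group \<open>Q\<^sub>8 \<circ> D\<^sub>8\<close>. Every irreducible real representation of \<open>G\<close> on which \<open>Z\<close> acts nontrivially factors
  through one of these quotients and is then of quaternionic type.

  The group \<open>Z\<close> acts freely on a flat 3-torus, with the Hantzsche--Wendt manifold as quotient, and each
  circle of the torus carries a nontrivial character of \<open>Z\<close>. Coinduction to \<open>G\<close> gives an affine action of
  \<open>G\<close> on a torus of dimension \<open>3 \<cdot> 16 = 48\<close>. It is free, because the central involutions act
  freely and every nontrivial element has one of them as a power. As \<open>Z\<close> acts nontrivially on each
  circle, all irreducible constituents of the holonomy representation are quaternionic.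

  In suitable coordinates the lifts to \<open>R\<^sup>4\<^sup>8\<close> are signed permutations followed by half-integral
  translations. They are isometries of the sup norm and nontrivial ones move every point by at least
  \<open>1/4\<close>; this uniform bound makes the covering theory elementary.
\<close>

section \<open>Boxes in Euclidean space\<close>

text \<open>Freeness and quaternionic type compete. With holonomy Q_8, whose only quaternionic
  irreducible sends the central involution to -1, a lift of that involution would be x \<mapsto> b -
  x and fix b/2. So no central involution may act as -1, hence the choice of a noncyclic centre:
  each of the three involutions of Z is +1 on exactly one of the three blocks and shifts it by 1/2.
  Squaring induces a pair (q1, q2) of quadratic forms on G/Z = F_2^(2m). All involutions are central
  iff the pair has no nontrivial zero, and then each nonzero vector is a zero of exactly one of q1,
  q2, q1 + q2. If all three are nondegenerate of Arf invariant 1, each has 2^(2m-1) - 2^(m-1) - 1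
  nontrivial zeros, and 3 (2^(2m-1) - 2^(m-1) - 1) = 2^(2m) - 1 holds only for m = 2. Hence the
  order 64 and the blocks of size 16. On one block the group spans the algebra H \<otimes> M_2(R) =
  M_2(H); its simple module is H^2, with commutant H acting by right multiplication.\<close>

definition sup_box :: "nat \<Rightarrow> (nat \<Rightarrow> real) \<Rightarrow> real \<Rightarrow> (nat \<Rightarrow> real) set" where
  "sup_box n x r = {y. (\<forall>i<n. \<bar>y i - x i\<bar> < r) \<and> (\<forall>i\<ge>n. y i = 0)}"

lemma box_subset_topspace: "sup_box n x r \<subseteq> topspace (Euclidean_space n)"
  by (auto simp: sup_box_def topspace_Euclidean_space)

lemma mem_box_self: "x \<in> topspace (Euclidean_space n) \<Longrightarrow> r > 0 \<Longrightarrow> x \<in> sup_box n x r"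
  by (auto simp: sup_box_def topspace_Euclidean_space)

lemma box_mono: "r \<le> s \<Longrightarrow> sup_box n x r \<subseteq> sup_box n x s"
  unfolding sup_box_def by fastforce

lemma continuous_map_coordinate:
  "continuous_map (Euclidean_space n) euclideanreal (\<lambda>x. x i)"
  unfolding Euclidean_space_def
  by (intro continuous_map_from_subtopology continuous_map_product_projection) auto

lemma continuous_map_Euclidean_space_coordinates:
  "continuous_map X (Euclidean_space n) f \<longleftrightarrow>
     f \<in> topspace X \<rightarrow> topspace (Euclidean_space n) \<and>
     (\<forall>i<n. continuous_map X euclideanreal (\<lambda>t. f t i))"
proof
  assume f: "continuous_map X (Euclidean_space n) f"
  then show "f \<in> topspace X \<rightarrow> topspace (Euclidean_space n) \<and>
     (\<forall>i<n. continuous_map X euclideanreal (\<lambda>t. f t i))"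
    using continuous_map_compose[OF f continuous_map_coordinate] continuous_map_funspace[OF f]
    by (auto simp: o_def)
next
  assume r: "f \<in> topspace X \<rightarrow> topspace (Euclidean_space n) \<and>
     (\<forall>i<n. continuous_map X euclideanreal (\<lambda>t. f t i))"
  then have "continuous_map X (Euclidean_space n) (\<lambda>t i. if i < n then f t i else 0)"
    by (simp add: continuous_map_componentwise_Euclidean_space)
  then show "continuous_map X (Euclidean_space n) f"
    using r by (elim continuous_map_eq) (force simp: topspace_Euclidean_space)
qed

lemma openin_box: "openin (Euclidean_space n) (sup_box n x r)"
proof -
  have *: "openin (Euclidean_space n) {y \<in> topspace (Euclidean_space n). y i \<in> {x i - r<..<x i + r}}" for i
    by (rule openin_continuous_map_preimage[OF continuous_map_coordinate]) simp
  have "openin (Euclidean_space n)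
     (topspace (Euclidean_space n) \<inter> \<Inter> ((\<lambda>i. {y \<in> topspace (Euclidean_space n). y i \<in> {x i - r<..<x i + r}}) ` {..<n}))"
    using * by (intro openin_Int_Inter) auto
  also have "topspace (Euclidean_space n) \<inter> \<Inter> ((\<lambda>i. {y \<in> topspace (Euclidean_space n). y i \<in> {x i - r<..<x i + r}}) ` {..<n}) = sup_box n x r"
    by (force simp: sup_box_def topspace_Euclidean_space abs_less_iff)
  finally show ?thesis .
qed

text \<open>Only the first \<open>n\<close> coordinates vary inside the space, so the least of their
  radii serves.\<close>

lemma openin_Euclidean_space_imp_box:
  assumes U: "openin (Euclidean_space n) U" and x: "x \<in> U"
  shows "\<exists>r>0. sup_box n x r \<subseteq> U"
proof -
  obtain T where T: "openin (powertop_real UNIV) T" and UT: "U = T \<inter> {x. \<forall>i\<ge>n. x i = 0}"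
    using U unfolding Euclidean_space_def openin_subtopology by blast
  obtain V where V: "finite {i. V i \<noteq> (UNIV :: real set)}" "\<And>i. open (V i)" "x \<in> Pi\<^sub>E UNIV V" "Pi\<^sub>E UNIV V \<subseteq> T"
    using T x UT unfolding openin_product_topology_alt by force
  have "\<forall>i. \<exists>e>0. ball (x i) e \<subseteq> V i"
    using V(2,3) open_contains_ball by (metis PiE_E UNIV_I)
  then obtain e where e: "\<And>i. e i > 0" "\<And>i. ball (x i) (e i) \<subseteq> V i" by metis
  \<comment> \<open>The element 1 keeps the minimum defined for \<open>n = 0\<close>.\<close>
  define r where "r = Min (insert 1 (e ` {..<n}))"
  have r0: "r > 0" unfolding r_def using e by (subst Min_gr_iff) auto
  have re: "r \<le> e i" if "i < n" for i unfolding r_def using that by (intro Min_le) auto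
  have "sup_box n x r \<subseteq> U"
  proof
    fix y assume y: "y \<in> sup_box n x r"
    have "y i \<in> V i" for i
    proof (cases "i < n")
      case True
      then have "y i \<in> ball (x i) (e i)"
        using y re[OF True] by (auto simp: sup_box_def dist_real_def abs_minus_commute intro: less_le_trans)
      then show ?thesis using e by blast
    next
      case False
      then have "y i = x i" using y x UT by (auto simp: sup_box_def)
      then show ?thesis using V(3) by auto
    qed
    then have "y \<in> T" using V(4) by auto
    then show "y \<in> U" using y UT by (auto simp: sup_box_def)
  qed
  then show ?thesis using r0 by blast
qed

lemma openin_Euclidean_space_box:
  "openin (Euclidean_space n) U \<longleftrightarrow>
     U \<subseteq> topspace (Euclidean_space n) \<and> (\<forall>x\<in>U. \<exists>r>0. sup_box n x r \<subseteq> U)"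
proof
  assume "openin (Euclidean_space n) U"
  then show "U \<subseteq> topspace (Euclidean_space n) \<and> (\<forall>x\<in>U. \<exists>r>0. sup_box n x r \<subseteq> U)"
    using openin_Euclidean_space_imp_box openin_subset by blast
next
  assume U: "U \<subseteq> topspace (Euclidean_space n) \<and> (\<forall>x\<in>U. \<exists>r>0. sup_box n x r \<subseteq> U)"
  then have "\<exists>T. openin (Euclidean_space n) T \<and> x \<in> T \<and> T \<subseteq> U" if "x \<in> U" for x
    using that openin_box mem_box_self by (metis subsetD)
  then show "openin (Euclidean_space n) U" by (subst openin_subopen) blast
qed

lemma box_line:
  assumes "x \<in> sup_box n x0 r"
  shows "eventually (\<lambda>t. i < n \<longrightarrow> x(i := t) \<in> sup_box n x0 r) (nhds (x i))"
proof (cases "i < n")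
  case True
  then have "eventually (\<lambda>t. t \<in> {x0 i - r<..<x0 i + r}) (nhds (x i))"
    using assms by (intro eventually_nhds_in_open) (auto simp: sup_box_def abs_less_iff)
  then show ?thesis
    by eventually_elim (use assms True in \<open>auto simp: sup_box_def abs_less_iff\<close>)
qed simp

lemma openin_Euclidean_space_line:
  assumes U: "openin (Euclidean_space n) U" "x \<in> U" "i < n"
  shows "eventually (\<lambda>t. x(i := t) \<in> U) (nhds (x i))"
proof -
  obtain r where r: "r > 0" "sup_box n x r \<subseteq> U" using openin_Euclidean_space_imp_box U by blast
  have "x \<in> sup_box n x r" using mem_box_self r U openin_subset by blast
  from box_line[OF this, of i] show ?thesis
    by eventually_elim (use U r in auto)
qed

section \<open>Affine functions\<close>

definition affine_fun :: "nat \<Rightarrow> ((nat \<Rightarrow> real) \<Rightarrow> real) \<Rightarrow> bool" where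
  "affine_fun n f \<longleftrightarrow> (\<exists>a c. \<forall>x. f x = (\<Sum>j<n. a j * x j) + c)"

lemma affine_fun_const: "affine_fun n (\<lambda>x. c)"
  unfolding affine_fun_def by (rule exI[of _ "\<lambda>_. 0"]) auto

lemma partial_deriv_cong:
  assumes U: "openin (Euclidean_space n) U" "x \<in> U" "i < n" and "\<And>y. y \<in> U \<Longrightarrow> f y = g y"
  shows "partial_deriv i f x = partial_deriv i g x"
  unfolding partial_deriv_def
  by (rule deriv_cong_ev[OF eventually_mono[OF openin_Euclidean_space_line[OF U]]]) (use assms in auto)

lemma affine_line_has_derivative:
  fixes a :: "nat \<Rightarrow> real"
  assumes "i < n"
  shows "((\<lambda>t. (\<Sum>j<n. a j * (x(i := t)) j) + c) has_real_derivative a i) (at s)"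
proof -
  have "(\<Sum>j<n. a j * (x(i := t)) j) = a i * t + (\<Sum>j\<in>{..<n}-{i}. a j * x j)" for t
    using assms by (subst sum.remove[of _ i]) (auto intro!: sum.cong)
  then show ?thesis by (auto intro!: derivative_eq_intros)
qed

lemma partial_deriv_affine:
  "i < n \<Longrightarrow> partial_deriv i (\<lambda>x. (\<Sum>j<n. a j * x j) + c) x = a i"
  unfolding partial_deriv_def by (rule DERIV_imp_deriv) (rule affine_line_has_derivative)

text \<open>Agreement with an affine function on an open set passes to partial derivatives, because
  coordinate lines stay in \<open>U\<close> for a short time. Off \<open>U\<close> the function
  \<open>f\<close> may be arbitrary, as transition maps are off the overlap of two charts.\<close>

lemma iterated_partial_deriv_affine:
  assumes U: "openin (Euclidean_space n) U" and f: "\<And>x. x \<in> U \<Longrightarrow> f x = g x" and g: "affine_fun n g"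
    and "set is \<subseteq> {..<n}"
  shows "\<exists>g'. affine_fun n g' \<and> (\<forall>x\<in>U. foldr partial_deriv is f x = g' x)"
  using \<open>set is \<subseteq> {..<n}\<close>
proof (induction "is")
  case Nil
  then show ?case using f g by auto
next
  case (Cons i "is")
  then obtain g' where g': "affine_fun n g'" "\<And>x. x \<in> U \<Longrightarrow> foldr partial_deriv is f x = g' x" by auto
  then obtain a c where ac: "g' = (\<lambda>x. (\<Sum>j<n. a j * x j) + c)" unfolding affine_fun_def by blast
  have "partial_deriv i (foldr partial_deriv is f) x = a i" if "x \<in> U" for x
  proof -
    have "partial_deriv i (foldr partial_deriv is f) x = partial_deriv i g' x"
      by (rule partial_deriv_cong[OF U that]) (use Cons.prems g' in auto)
    then show ?thesis using Cons.prems partial_deriv_affine unfolding ac by simp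
  qed
  then show ?case using affine_fun_const[of n "a i"] by (intro exI[of _ "\<lambda>_. a i"]) auto
qed

lemma continuous_map_affine_fun:
  assumes "affine_fun n g"
  shows "continuous_map (Euclidean_space n) euclideanreal g"
proof -
  obtain a c where ac: "g = (\<lambda>x. (\<Sum>j<n. a j * x j) + c)" using assms unfolding affine_fun_def by blast
  show ?thesis unfolding ac
    by (intro continuous_intros continuous_map_coordinate) auto
qed

lemma smooth_on_affine:
  assumes U: "openin (Euclidean_space n) U" and f: "\<And>x. x \<in> U \<Longrightarrow> f x = g x" and g: "affine_fun n g"
  shows "smooth_on n U f"
  unfolding smooth_on_def
proof (intro allI impI conjI ballI)
  fix "is" assume "is": "set is \<subseteq> {..<n}"
  then obtain g' where g': "affine_fun n g'" "\<And>x. x \<in> U \<Longrightarrow> foldr partial_deriv is f x = g' x"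
    using iterated_partial_deriv_affine[OF U f g] by blast
  have "continuous_map (subtopology (Euclidean_space n) U) euclideanreal g'"
    using continuous_map_affine_fun[OF g'(1)] by (rule continuous_map_from_subtopology)
  then show "continuous_map (subtopology (Euclidean_space n) U) euclideanreal (foldr partial_deriv is f)"
    by (rule continuous_map_eq) (use g' in auto)
  fix x i assume x: "x \<in> U" and i: "i < n"
  obtain a c where ac: "g' = (\<lambda>x. (\<Sum>j<n. a j * x j) + c)" using g'(1) unfolding affine_fun_def by blast
  have "((\<lambda>t. g' (x(i := t))) has_real_derivative a i) (at (x i))"
    unfolding ac by (rule affine_line_has_derivative[OF i])
  moreover have "eventually (\<lambda>t. g' (x(i := t)) = foldr partial_deriv is f (x(i := t))) (nhds (x i))"
    using openin_Euclidean_space_line[OF U x i] by eventually_elim (use g' in auto)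
  ultimately have "((\<lambda>t. foldr partial_deriv is f (x(i := t))) has_real_derivative a i) (at (x i))"
    by (subst DERIV_cong_ev[OF refl _ refl, where g = "\<lambda>t. g' (x(i := t))"]) (auto elim: eventually_mono)
  then show "(\<lambda>t. foldr partial_deriv is f (x(i := t))) differentiable at (x i)"
    using real_differentiable_def by blast
qed

section \<open>Quotients by free discrete groups of monomial isometries\<close>

text \<open>Coordinates from \<open>n\<close> on are left alone, so that \<open>id\<close> is
  monomial and two such maps that agree on the Euclidean space are equal as functions.\<close>

definition monomial_map :: "nat \<Rightarrow> ((nat \<Rightarrow> real) \<Rightarrow> nat \<Rightarrow> real) \<Rightarrow> bool" where
  "monomial_map n \<gamma> \<longleftrightarrow>
     (\<exists>\<pi> \<epsilon> b. bij_betw \<pi> {..<n} {..<n} \<and> (\<forall>i. \<epsilon> i \<in> {1, -1}) \<and>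
        \<gamma> = (\<lambda>x i. if i < n then \<epsilon> i * x (\<pi> i) + b i else x i))"

lemma affine_fun_monomial:
  assumes "j < n"
  shows "affine_fun n (\<lambda>x. e * x j + c)"
    and "(\<lambda>x. e * x j + c) = (\<lambda>x. (\<Sum>i<n. (if i = j then e else 0) * x i) + c)"
proof -
  have "(\<Sum>i<n. (if i = j then e else 0) * x i) = e * x j" for x :: "nat \<Rightarrow> real"
    using assms by (subst sum.remove[of _ j]) auto
  then show 2: "(\<lambda>x. e * x j + c) = (\<lambda>x. (\<Sum>i<n. (if i = j then e else 0) * x i) + c)" by simp
  then show "affine_fun n (\<lambda>x. e * x j + c)" unfolding affine_fun_def by metis
qed

lemma monomial_map_box:
  assumes "monomial_map n \<gamma>" "y \<in> sup_box n x r"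
  shows "\<gamma> y \<in> sup_box n (\<gamma> x) r"
proof -
  obtain \<pi> \<epsilon> b where \<pi>: "bij_betw \<pi> {..<n} {..<n}" and \<epsilon>: "\<And>i. \<epsilon> i \<in> {1, -1}"
    and \<gamma>: "\<gamma> = (\<lambda>x i. if i < n then \<epsilon> i * x (\<pi> i) + b i else x i)"
    using assms(1) unfolding monomial_map_def by blast
  have "\<bar>\<epsilon> i * y (\<pi> i) + b i - (\<epsilon> i * x (\<pi> i) + b i)\<bar> < r" if "i < n" for i
  proof -
    have "\<pi> i < n" using \<pi> that bij_betwE by blast
    then have "\<bar>y (\<pi> i) - x (\<pi> i)\<bar> < r" using assms(2) by (auto simp: sup_box_def)
    moreover have "\<bar>\<epsilon> i * y (\<pi> i) + b i - (\<epsilon> i * x (\<pi> i) + b i)\<bar> = \<bar>y (\<pi> i) - x (\<pi> i)\<bar>"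
      using \<epsilon>[of i] by auto
    ultimately show ?thesis by simp
  qed
  then show ?thesis using assms(2) unfolding \<gamma> sup_box_def by auto
qed

lemma continuous_map_monomial_map:
  assumes "monomial_map n \<gamma>"
  shows "continuous_map (Euclidean_space n) (Euclidean_space n) \<gamma>"
proof -
  obtain \<pi> \<epsilon> b where \<pi>: "bij_betw \<pi> {..<n} {..<n}"
    and \<gamma>: "\<gamma> = (\<lambda>x i. if i < n then \<epsilon> i * x (\<pi> i) + b i else x i)"
    using assms(1) unfolding monomial_map_def by blast
  have "continuous_map (Euclidean_space n) euclideanreal (\<lambda>x. \<epsilon> i * x (\<pi> i) + b i)" if "i < n" for i
    using bij_betwE[OF \<pi>] that by (intro continuous_map_affine_fun affine_fun_monomial(1)) auto
  then show ?thesis unfolding \<gamma> continuous_map_Euclidean_space_coordinates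
    by (simp add: topspace_Euclidean_space)
qed

lemma box_triangle: "y \<in> sup_box n x r \<Longrightarrow> z \<in> sup_box n y s \<Longrightarrow> z \<in> sup_box n x (r + s)"
  unfolding sup_box_def mem_Collect_eq
proof (elim conjE, intro conjI allI impI)
  fix i assume "\<forall>i<n. \<bar>y i - x i\<bar> < r" "\<forall>i<n. \<bar>z i - y i\<bar> < s" "i < n"
  then have "\<bar>y i - x i\<bar> < r" "\<bar>z i - y i\<bar> < s" by auto
  then show "\<bar>z i - x i\<bar> < r + s" by linarith
qed auto

lemma box_diameter: "y \<in> sup_box n x r \<Longrightarrow> z \<in> sup_box n x s \<Longrightarrow> z \<in> sup_box n y (r + s)"
  unfolding sup_box_def mem_Collect_eq
proof (elim conjE, intro conjI allI impI)
  fix i assume "\<forall>i<n. \<bar>y i - x i\<bar> < r" "\<forall>i<n. \<bar>z i - x i\<bar> < s" "i < n"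
  then have "\<bar>y i - x i\<bar> < r" "\<bar>z i - x i\<bar> < s" by auto
  then show "\<bar>z i - y i\<bar> < r + s" by linarith
qed auto

lemma box_sym: "x \<in> topspace (Euclidean_space n) \<Longrightarrow> y \<in> sup_box n x r \<Longrightarrow> x \<in> sup_box n y r"
  unfolding sup_box_def topspace_Euclidean_space by (simp add: abs_minus_commute)

lemma second_countable_Euclidean_space: "second_countable (Euclidean_space n)"
proof -
  obtain B :: "(nat \<Rightarrow> real) set set" where B: "countable B" "topological_basis B"
    using ex_countable_basis by blast
  have "second_countable (euclidean :: (nat \<Rightarrow> real) topology)"
    unfolding second_countable_def
    using B topological_basis_open[OF B(2)] topological_basisE[OF B(2)]
    by (intro exI[of _ B]) (simp, metis)
  then show ?thesis
    unfolding Euclidean_space_def euclidean_product_topology[symmetric]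
    by (rule second_countable_subtopology)
qed

text \<open>In the product topology the cube is a product of compact factors, the factor being {0}
  from index \<open>n\<close> on, so Tychonoff's theorem applies.\<close>

lemma compactin_unit_cube:
  "compactin (Euclidean_space n) {x \<in> topspace (Euclidean_space n). \<forall>i<n. x i \<in> {0..1}}"
proof -
  have "compactin (powertop_real UNIV) (Pi\<^sub>E UNIV (\<lambda>i. if i < n then {0..1} else {0}))"
    by (subst compactin_PiE) auto
  moreover have "Pi\<^sub>E UNIV (\<lambda>i. if i < n then {0..1} else {0}) =
      {x \<in> topspace (Euclidean_space n). \<forall>i<n. x i \<in> {0..1::real}}"
    by (auto simp: topspace_Euclidean_space PiE_iff split: if_splits)
  ultimately show ?thesis
    unfolding Euclidean_space_def compactin_subtopology
    by auto
qed

text \<open>The assumption \<open>displacement\<close> encodes freeness and proper discontinuity at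
  once; \<open>translation_mem\<close> makes the quotient compact.\<close>

locale free_monomial_action =
  fixes n :: nat and \<Gamma> :: "((nat \<Rightarrow> real) \<Rightarrow> nat \<Rightarrow> real) set" and \<delta> :: real
  assumes delta_pos: "\<delta> > 0"
    and id_mem: "id \<in> \<Gamma>"
    and comp_mem: "\<gamma> \<in> \<Gamma> \<Longrightarrow> \<gamma>' \<in> \<Gamma> \<Longrightarrow> \<gamma> \<circ> \<gamma>' \<in> \<Gamma>"
    and inv_mem: "\<gamma> \<in> \<Gamma> \<Longrightarrow> \<exists>\<gamma>'\<in>\<Gamma>. \<gamma>' \<circ> \<gamma> = id \<and> \<gamma> \<circ> \<gamma>' = id"
    and monomial: "\<gamma> \<in> \<Gamma> \<Longrightarrow> monomial_map n \<gamma>"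
    and displacement: "\<gamma> \<in> \<Gamma> \<Longrightarrow> \<gamma> \<noteq> id \<Longrightarrow> \<exists>i<n. \<bar>\<gamma> x i - x i\<bar> \<ge> \<delta>"
    and translation_mem: "(\<lambda>x i. if i < n then x i + of_int (m i) else x i) \<in> \<Gamma>"
begin

section \<open>Topology of the orbit space\<close>

abbreviation "E \<equiv> topspace (Euclidean_space n)"

definition orbit :: "(nat \<Rightarrow> real) \<Rightarrow> (nat \<Rightarrow> real) set" where
  "orbit x = (\<lambda>\<gamma>. \<gamma> x) ` \<Gamma>"

definition M :: "(nat \<Rightarrow> real) set topology" where
  "M = topology (\<lambda>U. U \<subseteq> orbit ` E \<and> openin (Euclidean_space n) {x \<in> E. orbit x \<in> U})"

lemma mem_orbit_self: "x \<in> orbit x"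
  unfolding orbit_def by (rule image_eqI[OF _ id_mem]) simp

lemma orbit_action: "\<gamma> \<in> \<Gamma> \<Longrightarrow> orbit (\<gamma> x) = orbit x"
proof
  assume \<gamma>: "\<gamma> \<in> \<Gamma>"
  show "orbit (\<gamma> x) \<subseteq> orbit x"
    unfolding orbit_def
  proof clarify
    fix \<gamma>' assume "\<gamma>' \<in> \<Gamma>"
    then show "\<gamma>' (\<gamma> x) \<in> (\<lambda>\<gamma>. \<gamma> x) ` \<Gamma>"
      using comp_mem[OF _ \<gamma>] by (intro image_eqI[of _ _ "\<gamma>' \<circ> \<gamma>"]) auto
  qed
  obtain \<gamma>' where \<gamma>': "\<gamma>' \<in> \<Gamma>" "\<gamma>' \<circ> \<gamma> = id" using inv_mem[OF \<gamma>] by blast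
  have "\<gamma>' (\<gamma> x) = x" using fun_cong[OF \<gamma>'(2), of x] by simp
  then show "orbit x \<subseteq> orbit (\<gamma> x)"
    unfolding orbit_def
  proof clarify
    fix \<kappa> assume x: "\<gamma>' (\<gamma> x) = x" and "\<kappa> \<in> \<Gamma>"
    then show "\<kappa> x \<in> (\<lambda>\<kappa>. \<kappa> (\<gamma> x)) ` \<Gamma>"
      using comp_mem[OF _ \<gamma>'(1)] by (intro image_eqI[of _ _ "\<kappa> \<circ> \<gamma>'"]) auto
  qed
qed

lemma orbit_eq_iff: "orbit x = orbit y \<longleftrightarrow> (\<exists>\<gamma>\<in>\<Gamma>. y = \<gamma> x)"
proof
  assume "orbit x = orbit y"
  then have "y \<in> orbit x" using mem_orbit_self by simp
  then show "\<exists>\<gamma>\<in>\<Gamma>. y = \<gamma> x" unfolding orbit_def by blast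
next
  assume "\<exists>\<gamma>\<in>\<Gamma>. y = \<gamma> x"
  then show "orbit x = orbit y" using orbit_action by auto
qed

lemma action_in_E: "\<gamma> \<in> \<Gamma> \<Longrightarrow> x \<in> E \<Longrightarrow> \<gamma> x \<in> E"
  using funcset_mem[OF continuous_map_funspace[OF continuous_map_monomial_map[OF monomial]]] .

lemma action_box: "\<gamma> \<in> \<Gamma> \<Longrightarrow> y \<in> sup_box n x r \<Longrightarrow> \<gamma> y \<in> sup_box n (\<gamma> x) r"
  using monomial_map_box[OF monomial] .

lemma separation: "\<gamma> \<in> \<Gamma> \<Longrightarrow> \<gamma> x \<in> sup_box n x \<delta> \<Longrightarrow> \<gamma> = id"
proof (rule ccontr)
  assume \<gamma>: "\<gamma> \<in> \<Gamma>" "\<gamma> x \<in> sup_box n x \<delta>" "\<gamma> \<noteq> id"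
  obtain i where "i < n" "\<bar>\<gamma> x i - x i\<bar> \<ge> \<delta>" using displacement[OF \<gamma>(1,3)] by blast
  then show False using \<gamma>(2) by (simp add: sup_box_def not_less[symmetric])
qed

text \<open>Apply \<open>separation\<close> to \<gamma>' \<gamma>^-1 at the point
  \<open>\<gamma> x\<close>. This is proper discontinuity in metric form: distinct translates of a
  point are at least \<delta> apart.\<close>

lemma separation2:
  assumes "\<gamma> \<in> \<Gamma>" "\<gamma>' \<in> \<Gamma>" "\<gamma>' x \<in> sup_box n (\<gamma> x) \<delta>"
  shows "\<gamma>' = \<gamma>"
proof -
  obtain \<kappa> where \<kappa>: "\<kappa> \<in> \<Gamma>" "\<kappa> \<circ> \<gamma> = id" "\<gamma> \<circ> \<kappa> = id" using inv_mem assms by blast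
  have "(\<gamma>' \<circ> \<kappa>) (\<gamma> x) = \<gamma>' x" using fun_cong[OF \<kappa>(2), of x] by simp
  then have "\<gamma>' \<circ> \<kappa> = id" using separation[of "\<gamma>' \<circ> \<kappa>" "\<gamma> x"] assms \<kappa> comp_mem by metis
  then show ?thesis using \<kappa> by (metis comp_assoc comp_id id_comp)
qed

lemma openin_M:
  "openin M U \<longleftrightarrow> U \<subseteq> orbit ` E \<and> openin (Euclidean_space n) {x \<in> E. orbit x \<in> U}"
proof -
  have "istopology (\<lambda>U. U \<subseteq> orbit ` E \<and> openin (Euclidean_space n) {x \<in> E. orbit x \<in> U})"
    unfolding istopology_def
  proof (intro conjI allI impI)
    fix S T
    assume "S \<subseteq> orbit ` E \<and> openin (Euclidean_space n) {x \<in> E. orbit x \<in> S}"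
      and "T \<subseteq> orbit ` E \<and> openin (Euclidean_space n) {x \<in> E. orbit x \<in> T}"
    moreover have "{x \<in> E. orbit x \<in> S \<inter> T} = {x \<in> E. orbit x \<in> S} \<inter> {x \<in> E. orbit x \<in> T}" by auto
    ultimately show "S \<inter> T \<subseteq> orbit ` E" "openin (Euclidean_space n) {x \<in> E. orbit x \<in> S \<inter> T}"
      by (auto simp: openin_Int)
  next
    fix K assume K: "\<forall>U\<in>K. U \<subseteq> orbit ` E \<and> openin (Euclidean_space n) {x \<in> E. orbit x \<in> U}"
    then show "\<Union> K \<subseteq> orbit ` E" by blast
    have "{x \<in> E. orbit x \<in> \<Union> K} = \<Union> ((\<lambda>U. {x \<in> E. orbit x \<in> U}) ` K)" by auto
    then show "openin (Euclidean_space n) {x \<in> E. orbit x \<in> \<Union> K}" using K by auto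
  qed
  then show ?thesis unfolding M_def by simp
qed

lemma topspace_M: "topspace M = orbit ` E"
proof
  show "topspace M \<subseteq> orbit ` E" using openin_M[of "topspace M"] by auto
  have "{x \<in> E. orbit x \<in> orbit ` E} = E" by auto
  then have "openin M (orbit ` E)" by (simp add: openin_M)
  then show "orbit ` E \<subseteq> topspace M" by (rule openin_subset)
qed

lemma continuous_map_orbit: "continuous_map (Euclidean_space n) M orbit"
  unfolding continuous_map_def openin_M topspace_M by blast

text \<open>An element of \<Gamma> that takes \<open>x\<close> into \<open>U\<close> takes a whole
  box around \<open>x\<close> into \<open>U\<close>; being an isometry, it preserves the
  radius.\<close>

lemma open_map_orbit: "open_map (Euclidean_space n) M orbit"
  unfolding open_map_def
proof (intro allI impI)
  fix U assume U: "openin (Euclidean_space n) U"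
  have "\<exists>r>0. sup_box n x r \<subseteq> {x \<in> E. orbit x \<in> orbit ` U}" if x: "x \<in> E" "orbit x \<in> orbit ` U" for x
  proof -
    obtain u where u: "u \<in> U" "orbit x = orbit u" using x by auto
    then obtain \<gamma> where \<gamma>: "\<gamma> \<in> \<Gamma>" "u = \<gamma> x" using orbit_eq_iff by blast
    obtain r where r: "r > 0" "sup_box n u r \<subseteq> U" using U u openin_Euclidean_space_imp_box by blast
    have "orbit y \<in> orbit ` U" if "y \<in> sup_box n x r" for y
      using action_box[OF \<gamma>(1) that] r \<gamma> orbit_action[OF \<gamma>(1), of y] by blast
    then show ?thesis using r box_subset_topspace by blast
  qed
  then have "openin (Euclidean_space n) {x \<in> E. orbit x \<in> orbit ` U}"
    by (subst openin_Euclidean_space_box) auto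
  then show "openin M (orbit ` U)"
    using openin_subset[OF U] by (auto simp: openin_M)
qed

lemma second_countable_M: "second_countable M"
  by (rule second_countable_open_map_image[OF continuous_map_orbit open_map_orbit topspace_M[symmetric] second_countable_Euclidean_space])

lemma connected_M: "connected_space M"
  by (rule connected_space_quotient_map_image[OF
      continuous_open_imp_quotient_map[OF continuous_map_orbit open_map_orbit topspace_M[symmetric]]
      connected_Euclidean_space])

lemma compact_M: "compact_space M"
proof -
  let ?Q = "{x \<in> E. \<forall>i<n. x i \<in> {0..1}}"
  have "orbit ` ?Q = orbit ` E"
  proof (intro equalityI subsetI)
    fix p assume "p \<in> orbit ` E"
    then obtain x where x: "x \<in> E" "p = orbit x" by auto
    define \<gamma> where "\<gamma> = (\<lambda>y i. if i < n then y i + real_of_int (- \<lfloor>x i\<rfloor>) else y i)"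
    have \<gamma>: "\<gamma> \<in> \<Gamma>" unfolding \<gamma>_def by (rule translation_mem)
    have "\<gamma> x i \<in> {0..1}" if "i < n" for i
      using that of_int_floor_le[of "x i"] floor_le_iff[of "x i" "\<lfloor>x i\<rfloor>"] unfolding \<gamma>_def by (auto, linarith)
    then have "\<gamma> x \<in> ?Q" using action_in_E[OF \<gamma>] x by blast
    then show "p \<in> orbit ` ?Q" using orbit_action[OF \<gamma>, of x] x by blast
  qed auto
  then show ?thesis
    using image_compactin[OF compactin_unit_cube continuous_map_orbit] topspace_M
    by (simp add: compact_space_def)
qed

text \<open>If the orbit of \<open>y\<close> avoids the box of radius r around \<open>x\<close>,
  then boxes of radius r/2 around \<open>x\<close> and \<open>y\<close> have disjoint images, since
  the action is isometric. Such an r exists because at most one translate of \<open>y\<close> is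
  within \<delta>/2 of \<open>x\<close>.\<close>

lemma Hausdorff_M: "Hausdorff_space M"
  unfolding Hausdorff_space_def
proof (intro allI impI)
  fix p q assume pq: "p \<in> topspace M \<and> q \<in> topspace M \<and> p \<noteq> q"
  then obtain x y where x: "x \<in> E" "p = orbit x" and y: "y \<in> E" "q = orbit y"
    unfolding topspace_M by auto
  have ne: "\<gamma> y \<noteq> x" if "\<gamma> \<in> \<Gamma>" for \<gamma>
    using pq x y orbit_action[OF that, of y] by auto
  have "\<exists>r>0. \<forall>\<gamma>\<in>\<Gamma>. \<gamma> y \<notin> sup_box n x r"
  proof (cases "\<exists>\<gamma>\<in>\<Gamma>. \<gamma> y \<in> sup_box n x (\<delta>/2)")
    case False
    then show ?thesis using delta_pos by (intro exI[of _ "\<delta>/2"]) auto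
  next
    case True
    then obtain \<gamma> where \<gamma>: "\<gamma> \<in> \<Gamma>" "\<gamma> y \<in> sup_box n x (\<delta>/2)" by blast
    obtain i where i: "\<gamma> y i \<noteq> x i" using ne[OF \<gamma>(1)] by blast
    moreover have "\<gamma> y i = x i" if "i \<ge> n"
      using that action_in_E[OF \<gamma>(1) y(1)] x(1) by (simp add: topspace_Euclidean_space)
    ultimately have i: "i < n" "\<gamma> y i \<noteq> x i" by (auto simp: not_le[symmetric])
    \<comment> \<open>One coordinate in which the close translate differs from \<open>x\<close>
      suffices to exclude it; the bound \<delta>/2 excludes all other translates.\<close>
    let ?r = "min (\<delta>/2) \<bar>\<gamma> y i - x i\<bar>"
    have "\<gamma>' y \<notin> sup_box n x ?r" if \<gamma>': "\<gamma>' \<in> \<Gamma>" for \<gamma>'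
    proof
      assume a: "\<gamma>' y \<in> sup_box n x ?r"
      then have "\<gamma>' y \<in> sup_box n x (\<delta>/2)" using box_mono[of ?r "\<delta>/2" n x] by (meson min.cobounded1 subsetD)
      then have "\<gamma>' y \<in> sup_box n (\<gamma> y) \<delta>"
        using box_triangle[of x n "\<gamma> y" "\<delta>/2" "\<gamma>' y" "\<delta>/2"] box_sym[OF x(1) \<gamma>(2)] by simp
      then have "\<gamma>' = \<gamma>" using separation2 \<gamma> \<gamma>' by blast
      then show False using a i by (auto simp: sup_box_def)
    qed
    then show ?thesis using i delta_pos by (intro exI[of _ ?r]) auto
  qed
  then obtain r where r: "r > 0" "\<And>\<gamma>. \<gamma> \<in> \<Gamma> \<Longrightarrow> \<gamma> y \<notin> sup_box n x r" by blast
  show "\<exists>U V. openin M U \<and> openin M V \<and> p \<in> U \<and> q \<in> V \<and> disjnt U V"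
  proof (intro exI conjI)
    show "openin M (orbit ` sup_box n x (r/2))" "openin M (orbit ` sup_box n y (r/2))"
      using open_map_orbit openin_box unfolding open_map_def by auto
    show "p \<in> orbit ` sup_box n x (r/2)" "q \<in> orbit ` sup_box n y (r/2)"
      using x y r by (auto intro!: imageI mem_box_self)
    have False if u: "u \<in> sup_box n x (r/2)" "v \<in> sup_box n y (r/2)" "orbit u = orbit v" for u v
    proof -
      obtain \<gamma> where \<gamma>: "\<gamma> \<in> \<Gamma>" "u = \<gamma> v" using u(3) orbit_eq_iff by metis
      have "\<gamma> y \<in> sup_box n u (r/2)" using action_box[OF \<gamma>(1) box_sym[OF y(1) u(2)]] \<gamma> by simp
      then have "\<gamma> y \<in> sup_box n x r" using box_triangle[OF u(1)] by fastforce
      then show False using r \<gamma> by blast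
    qed
    then show "disjnt (orbit ` sup_box n x (r/2)) (orbit ` sup_box n y (r/2))"
      by (fastforce simp: disjnt_def)
  qed
qed

section \<open>Charts as local inverses of the orbit map\<close>

definition R :: real where "R = \<delta>/4"

definition chart_at :: "(nat \<Rightarrow> real) \<Rightarrow> (nat \<Rightarrow> real) set chart" where
  "chart_at x = (orbit ` sup_box n x R, inv_into (sup_box n x R) orbit)"

definition atlas :: "(nat \<Rightarrow> real) set chart set" where
  "atlas = chart_at ` E"

definition flat_metric :: "(nat \<Rightarrow> real) set chart \<Rightarrow> (nat \<Rightarrow> real) \<Rightarrow> real mat" where
  "flat_metric c x = 1\<^sub>m n"

lemma R_pos: "R > 0" unfolding R_def using delta_pos by simp

lemma inj_on_orbit_box: "inj_on orbit (sup_box n x R)"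
proof (rule inj_onI)
  fix u v assume u: "u \<in> sup_box n x R" and v: "v \<in> sup_box n x R" and "orbit u = orbit v"
  then obtain \<gamma> where \<gamma>: "\<gamma> \<in> \<Gamma>" "v = \<gamma> u" using orbit_eq_iff by blast
  have "v \<in> sup_box n u (R + R)" using box_diameter[OF u v] .
  then have "\<gamma> u \<in> sup_box n u \<delta>" using box_mono[of "R + R" \<delta> n u] \<gamma> delta_pos unfolding R_def by auto
  then show "u = v" using separation \<gamma> by force
qed

lemma chart_image: "snd (chart_at x) ` fst (chart_at x) = sup_box n x R"
  unfolding chart_at_def fst_conv snd_conv by (rule inv_into_image_cancel[OF inj_on_orbit_box subset_refl])

lemma chart_inverse: "u \<in> sup_box n x R \<Longrightarrow> inv_into (fst (chart_at x)) (snd (chart_at x)) u = orbit u"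
proof -
  assume u: "u \<in> sup_box n x R"
  have "snd (chart_at x) (orbit u) = u"
    unfolding chart_at_def snd_conv by (rule inv_into_f_f[OF inj_on_orbit_box u])
  moreover have "orbit u \<in> fst (chart_at x)"
    unfolding chart_at_def fst_conv using u by (rule imageI)
  moreover have "inj_on (snd (chart_at x)) (fst (chart_at x))"
    unfolding chart_at_def fst_conv snd_conv by (rule inj_on_inv_into) simp
  ultimately show ?thesis by (metis inv_into_f_f)
qed

lemma chart_orbit: "u \<in> sup_box n x R \<Longrightarrow> snd (chart_at x) (orbit u) = u"
  unfolding chart_at_def snd_conv by (rule inv_into_f_f[OF inj_on_orbit_box])

lemma topspace_box: "topspace (subtopology (Euclidean_space n) (sup_box n x r)) = sup_box n x r"
  by (rule topspace_subtopology_subset[OF box_subset_topspace])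

lemma topspace_orbit_box: "topspace (subtopology M (orbit ` sup_box n x r)) = orbit ` sup_box n x r"
  by (rule topspace_subtopology_subset) (simp only: topspace_M image_mono[OF box_subset_topspace])

lemma chart_homeomorphism:
  "homeomorphic_map (subtopology M (orbit ` sup_box n x R)) (subtopology (Euclidean_space n) (sup_box n x R))
     (inv_into (sup_box n x R) orbit)"
proof -
  have "homeomorphic_map (subtopology (Euclidean_space n) (sup_box n x R)) (subtopology M (orbit ` sup_box n x R)) orbit"
  proof (rule bijective_open_imp_homeomorphic_map)
    show "continuous_map (subtopology (Euclidean_space n) (sup_box n x R)) (subtopology M (orbit ` sup_box n x R)) orbit"
      unfolding continuous_map_in_subtopology topspace_box
      using continuous_map_from_subtopology[OF continuous_map_orbit] by blast
    show "open_map (subtopology (Euclidean_space n) (sup_box n x R)) (subtopology M (orbit ` sup_box n x R)) orbit"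
      unfolding open_map_def
    proof (intro allI impI)
      fix U assume "openin (subtopology (Euclidean_space n) (sup_box n x R)) U"
      then have U: "openin (Euclidean_space n) U" "U \<subseteq> sup_box n x R"
        unfolding openin_open_subtopology[OF openin_box] by blast+
      then have "openin M (orbit ` U)" using open_map_orbit unfolding open_map_def by blast
      then show "openin (subtopology M (orbit ` sup_box n x R)) (orbit ` U)"
        using image_mono[OF U(2)] by (rule subset_openin_subtopology)
    qed
    show "orbit ` topspace (subtopology (Euclidean_space n) (sup_box n x R)) = topspace (subtopology M (orbit ` sup_box n x R))"
      unfolding topspace_box topspace_orbit_box ..
    show "inj_on orbit (topspace (subtopology (Euclidean_space n) (sup_box n x R)))"
      unfolding topspace_box by (rule inj_on_orbit_box)
  qed
  then obtain g where g: "homeomorphic_maps (subtopology (Euclidean_space n) (sup_box n x R)) (subtopology M (orbit ` sup_box n x R)) orbit g"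
    unfolding homeomorphic_map_maps by blast
  \<comment> \<open>The inverse \<open>g\<close> supplied by the homeomorphism is anonymous;
    injectivity on the box identifies it with \<open>inv_into\<close> on the chart domain.\<close>
  have "g p = inv_into (sup_box n x R) orbit p" if p: "p \<in> topspace (subtopology M (orbit ` sup_box n x R))" for p
  proof -
    have "g \<in> orbit ` sup_box n x R \<rightarrow> sup_box n x R"
      using g continuous_map_funspace[of _ _ g] unfolding homeomorphic_maps_def topspace_box topspace_orbit_box
      by (metis topspace_box topspace_orbit_box)
    then have "g p \<in> sup_box n x R" using p unfolding topspace_orbit_box by blast
    moreover have "orbit (g p) = p"
      using g p unfolding homeomorphic_maps_def by blast
    ultimately show ?thesis using inv_into_f_f[OF inj_on_orbit_box] by metis
  qed
  moreover have "homeomorphic_map (subtopology M (orbit ` sup_box n x R)) (subtopology (Euclidean_space n) (sup_box n x R)) g"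
    using g unfolding homeomorphic_maps_map by blast
  ultimately show ?thesis using homeomorphic_map_eq by blast
qed

lemma overlap_image:
  "snd (chart_at x) ` (fst (chart_at x) \<inter> fst (chart_at y)) = {u \<in> sup_box n x R. orbit u \<in> orbit ` sup_box n y R}"
proof -
  have "snd (chart_at x) ` (fst (chart_at x) \<inter> fst (chart_at y)) =
      (\<lambda>u. snd (chart_at x) (orbit u)) ` {u \<in> sup_box n x R. orbit u \<in> orbit ` sup_box n y R}"
    unfolding chart_at_def by auto
  also have "\<dots> = {u \<in> sup_box n x R. orbit u \<in> orbit ` sup_box n y R}"
    using chart_orbit by (auto simp: image_iff)
  finally show ?thesis .
qed

lemma open_overlap: "openin (Euclidean_space n) {u \<in> sup_box n x R. orbit u \<in> orbit ` sup_box n y R}"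
proof -
  have "{u \<in> sup_box n x R. orbit u \<in> orbit ` sup_box n y R} = sup_box n x R \<inter> {u \<in> E. orbit u \<in> orbit ` sup_box n y R}"
    using box_subset_topspace by auto
  moreover have "openin M (orbit ` sup_box n y R)"
    using open_map_orbit openin_box unfolding open_map_def by auto
  ultimately show ?thesis
    using openin_box openin_continuous_map_preimage[OF continuous_map_orbit] by (simp add: openin_Int)
qed

text \<open>The transition map is a single element of the group because charts have radius \<open>\<delta>/4\<close>.\<close>

lemma transition_action:
  "\<exists>\<gamma>\<in>\<Gamma>. \<forall>u\<in>{u \<in> sup_box n x R. orbit u \<in> orbit ` sup_box n y R}. transition (chart_at x) (chart_at y) u = \<gamma> u"
proof -
  let ?S = "{u \<in> sup_box n x R. orbit u \<in> orbit ` sup_box n y R}"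
  have *: "\<exists>\<gamma>\<in>\<Gamma>. transition (chart_at x) (chart_at y) u = \<gamma> u \<and> \<gamma> u \<in> sup_box n y R" if u: "u \<in> ?S" for u
  proof -
    obtain v where v: "v \<in> sup_box n y R" "orbit u = orbit v" using u by blast
    then obtain \<gamma> where \<gamma>: "\<gamma> \<in> \<Gamma>" "v = \<gamma> u" using orbit_eq_iff by blast
    have "transition (chart_at x) (chart_at y) u = v"
      unfolding transition_def using chart_inverse[of u x] chart_orbit[OF v(1)] u v(2) by auto
    then show ?thesis using \<gamma> v by auto
  qed
  show ?thesis
  proof (cases "?S = {}")
    case True
    then show ?thesis using id_mem by blast
  next
    case False
    then obtain u where u: "u \<in> ?S" by blast
    obtain \<gamma> where \<gamma>: "\<gamma> \<in> \<Gamma>" "\<gamma> u \<in> sup_box n y R" using *[OF u] by blast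
    have "transition (chart_at x) (chart_at y) v = \<gamma> v" if v: "v \<in> ?S" for v
    proof -
      obtain \<gamma>' where \<gamma>': "\<gamma>' \<in> \<Gamma>" "transition (chart_at x) (chart_at y) v = \<gamma>' v" "\<gamma>' v \<in> sup_box n y R"
        using *[OF v] by blast
      have "v \<in> sup_box n u (R + R)" using u v box_diameter[of u n x R v R] by blast
      then have 1: "\<gamma> v \<in> sup_box n (\<gamma> u) (R + R)" using action_box \<gamma> by blast
      have "\<gamma>' v \<in> sup_box n (\<gamma> u) (R + R)"
        by (rule box_diameter[OF \<gamma>(2) \<gamma>'(3)])
      \<comment> \<open>Both images lie within 2 R of \<open>\<gamma> u\<close>, so they are less
        than 4 R = \<delta> apart.\<close>
      then have "\<gamma>' v \<in> sup_box n (\<gamma> v) ((R + R) + (R + R))"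
        by (rule box_diameter[OF 1])
      then have "\<gamma>' = \<gamma>" using separation2 \<gamma> \<gamma>' unfolding R_def by simp
      then show ?thesis using \<gamma>' by simp
    qed
    then show ?thesis using \<gamma> by blast
  qed
qed

lemma transition_monomial:
  obtains \<pi> \<epsilon> b where "bij_betw \<pi> {..<n} {..<n}" "\<And>i. \<epsilon> i \<in> {1, - 1 :: real}"
    "\<And>u k. u \<in> {u \<in> sup_box n x R. orbit u \<in> orbit ` sup_box n y R} \<Longrightarrow> k < n \<Longrightarrow>
       transition (chart_at x) (chart_at y) u k = \<epsilon> k * u (\<pi> k) + b k"
proof -
  obtain \<gamma> where \<gamma>: "\<gamma> \<in> \<Gamma>"
    "\<forall>u\<in>{u \<in> sup_box n x R. orbit u \<in> orbit ` sup_box n y R}. transition (chart_at x) (chart_at y) u = \<gamma> u"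
    using transition_action by blast
  obtain \<pi> \<epsilon> b where "bij_betw \<pi> {..<n} {..<n}" "\<And>i. \<epsilon> i \<in> {1, -1}"
    "\<gamma> = (\<lambda>x i. if i < n then \<epsilon> i * x (\<pi> i) + b i else x i)"
    using monomial[OF \<gamma>(1)] unfolding monomial_map_def by blast
  with \<gamma>(2) show ?thesis by (intro that[of \<pi> \<epsilon> b]) auto
qed

section \<open>The smooth atlas and the flat metric\<close>

lemma smooth_manifold_M: "smooth_manifold n M atlas"
proof
  show "Hausdorff_space M" by (rule Hausdorff_M)
  show "second_countable M" by (rule second_countable_M)
  have "(\<Union>x\<in>E. orbit ` sup_box n x R) = orbit ` E"
  proof
    show "(\<Union>x\<in>E. orbit ` sup_box n x R) \<subseteq> orbit ` E"
      using image_mono[OF box_subset_topspace] by (intro UN_least)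
    show "orbit ` E \<subseteq> (\<Union>x\<in>E. orbit ` sup_box n x R)"
      using mem_box_self[OF _ R_pos] by (intro subsetI) blast
  qed
  then show "(\<Union>(U, \<phi>)\<in>atlas. U) = topspace M"
    unfolding atlas_def chart_at_def topspace_M by simp
next
  fix U \<phi> assume "(U, \<phi>) \<in> atlas"
  then obtain x where x: "x \<in> E" "(U, \<phi>) = chart_at x" unfolding atlas_def by auto
  have im: "\<phi> ` U = sup_box n x R" using chart_image[of x] unfolding x(2)[symmetric] fst_conv snd_conv .
  show "openin M U"
    using x open_map_orbit openin_box unfolding chart_at_def open_map_def by auto
  show "openin (Euclidean_space n) (\<phi> ` U)" using im openin_box by simp
  show "homeomorphic_map (subtopology M U) (subtopology (Euclidean_space n) (\<phi> ` U)) \<phi>"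
    using chart_homeomorphism[of x] x(2) unfolding im by (simp add: chart_at_def)
  fix V \<psi> k assume "(V, \<psi>) \<in> atlas" and k: "k < n"
  then obtain y where y: "y \<in> E" "(V, \<psi>) = chart_at y" unfolding atlas_def by auto
  have ov: "\<phi> ` (U \<inter> V) = {u \<in> sup_box n x R. orbit u \<in> orbit ` sup_box n y R}"
    using overlap_image[of x y] unfolding x(2)[symmetric] y(2)[symmetric] fst_conv snd_conv .
  obtain \<pi> \<epsilon> b where \<pi>: "bij_betw \<pi> {..<n} {..<n}" and "\<And>i. \<epsilon> i \<in> {1, - 1 :: real}"
    and t: "\<And>u k. u \<in> {u \<in> sup_box n x R. orbit u \<in> orbit ` sup_box n y R} \<Longrightarrow> k < n \<Longrightarrow>
       transition (chart_at x) (chart_at y) u k = \<epsilon> k * u (\<pi> k) + b k"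
    using transition_monomial[of x y] by blast
  have "\<pi> k < n" using \<pi> k bij_betwE by blast
  then show "smooth_on n (\<phi> ` (U \<inter> V)) (\<lambda>x. transition (U, \<phi>) (V, \<psi>) x k)"
    unfolding ov x(2) y(2) using t k
    by (intro smooth_on_affine[where g = "\<lambda>u. \<epsilon> k * u (\<pi> k) + b k", OF open_overlap _ affine_fun_monomial(1)]) blast+
qed

lemma partial_deriv_transition:
  obtains \<pi> \<epsilon> where "bij_betw \<pi> {..<n} {..<n}" "\<And>i. \<epsilon> i \<in> {1, - 1 :: real}"
    "\<And>u i k. u \<in> {u \<in> sup_box n x R. orbit u \<in> orbit ` sup_box n y R} \<Longrightarrow> i < n \<Longrightarrow> k < n \<Longrightarrow>
       partial_deriv i (\<lambda>u. transition (chart_at x) (chart_at y) u k) u = (if i = \<pi> k then \<epsilon> k else 0)"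
proof -
  obtain \<pi> \<epsilon> b where \<pi>: "bij_betw \<pi> {..<n} {..<n}" and \<epsilon>: "\<And>i. \<epsilon> i \<in> {1, - 1 :: real}"
    and t: "\<And>u k. u \<in> {u \<in> sup_box n x R. orbit u \<in> orbit ` sup_box n y R} \<Longrightarrow> k < n \<Longrightarrow>
       transition (chart_at x) (chart_at y) u k = \<epsilon> k * u (\<pi> k) + b k"
    using transition_monomial[of x y] by blast
  show ?thesis
  proof (rule that[OF \<pi> \<epsilon>])
    fix u i k assume u: "u \<in> {u \<in> sup_box n x R. orbit u \<in> orbit ` sup_box n y R}" and i: "i < n" and k: "k < n"
    have k': "\<pi> k < n" using \<pi> k bij_betwE by blast
    have "partial_deriv i (\<lambda>u. transition (chart_at x) (chart_at y) u k) u =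
        partial_deriv i (\<lambda>u. \<epsilon> k * u (\<pi> k) + b k) u"
      by (rule partial_deriv_cong[OF open_overlap u i]) (use t k in auto)
    also have "\<dots> = (if i = \<pi> k then \<epsilon> k else 0)"
      unfolding affine_fun_monomial(2)[OF k'] by (rule partial_deriv_affine[OF i])
    finally show "partial_deriv i (\<lambda>u. transition (chart_at x) (chart_at y) u k) u = (if i = \<pi> k then \<epsilon> k else 0)" .
  qed
qed

text \<open>The Jacobians of the transition maps are signed permutation matrices, hence orthogonal,
  so the identity Gram matrix obeys the transformation law.\<close>

lemma riemannian_manifold_M: "riemannian_manifold n M atlas flat_metric"
proof -
  interpret smooth_manifold n M atlas by (rule smooth_manifold_M)
  show ?thesis
  proof
    fix U \<phi> assume c: "(U, \<phi>) \<in> atlas"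
    show "flat_metric (U, \<phi>) x \<in> carrier_mat n n" for x by (simp add: flat_metric_def)
    show "smooth_on n (\<phi> ` U) (\<lambda>x. flat_metric (U, \<phi>) x $$ (i, j))" if "i < n" "j < n" for i j
      unfolding flat_metric_def using chart_range_open[OF c] affine_fun_const by (intro smooth_on_affine) auto
    show "transpose_mat (flat_metric (U, \<phi>) x) = flat_metric (U, \<phi>) x" for x
      by (simp add: flat_metric_def)
    show "v \<bullet> (flat_metric (U, \<phi>) x *\<^sub>v v) > 0" if "v \<in> carrier_vec n" "v \<noteq> 0\<^sub>v n" for x v
    proof -
      have "\<exists>i<n. v $ i \<noteq> 0" using that by (metis carrier_vecD eq_vecI index_zero_vec)
      then obtain i where i: "i < n" "v $ i \<noteq> 0" by blast
      have "v \<bullet> v = (\<Sum>i<n. (v $ i)\<^sup>2)" using that by (simp add: scalar_prod_def power2_eq_square atLeast0LessThan)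
      moreover have "(\<Sum>i<n. (v $ i)\<^sup>2) > 0" using i by (intro sum_pos2[of _ i]) auto
      ultimately show ?thesis using that by (simp add: flat_metric_def)
    qed
    fix V \<psi> p i j assume d: "(V, \<psi>) \<in> atlas" and p: "p \<in> U \<inter> V" and ij: "i < n" "j < n"
    obtain x y where x: "(U, \<phi>) = chart_at x" and y: "(V, \<psi>) = chart_at y"
      using c d unfolding atlas_def by auto
    have u: "\<phi> p \<in> {u \<in> sup_box n x R. orbit u \<in> orbit ` sup_box n y R}"
      using overlap_image[of x y] imageI[OF p, of \<phi>] unfolding x[symmetric] y[symmetric] fst_conv snd_conv by simp
    obtain \<pi> \<epsilon> where \<pi>: "bij_betw \<pi> {..<n} {..<n}" and \<epsilon>: "\<And>i. \<epsilon> i \<in> {1, - 1 :: real}"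
      and pd: "\<And>u i k. u \<in> {u \<in> sup_box n x R. orbit u \<in> orbit ` sup_box n y R} \<Longrightarrow> i < n \<Longrightarrow> k < n \<Longrightarrow>
         partial_deriv i (\<lambda>u. transition (chart_at x) (chart_at y) u k) u = (if i = \<pi> k then \<epsilon> k else 0)"
      using partial_deriv_transition[of x y] by blast
    have "(\<Sum>k<n. \<Sum>l<n.
                partial_deriv i (\<lambda>x. transition (U, \<phi>) (V, \<psi>) x k) (\<phi> p) *
                partial_deriv j (\<lambda>x. transition (U, \<phi>) (V, \<psi>) x l) (\<phi> p) *
                flat_metric (V, \<psi>) (\<psi> p) $$ (k, l)) =
          (\<Sum>k<n. \<Sum>l<n. if l = k then (if i = \<pi> k then \<epsilon> k else 0) * (if j = \<pi> k then \<epsilon> k else 0) else 0)"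
      unfolding x y using pd[OF u] ij by (intro sum.cong refl) (auto simp: flat_metric_def)
    also have "\<dots> = (\<Sum>k<n. if i = \<pi> k then (if j = \<pi> k then 1 else 0) else 0)"
    proof (rule sum.cong[OF refl])
      fix k assume "k \<in> {..<n}"
      then show "(\<Sum>l<n. if l = k then (if i = \<pi> k then \<epsilon> k else 0) * (if j = \<pi> k then \<epsilon> k else 0) else 0)
        = (if i = \<pi> k then (if j = \<pi> k then 1 else 0) else 0)"
        using \<epsilon>[of k] by (subst sum.delta) auto
    qed
    also have "\<dots> = (\<Sum>m<n. if i = m then (if j = m then 1 else 0) else 0)"
      using sum.reindex_bij_betw[OF \<pi>, of "\<lambda>m. if i = m then (if j = m then 1 else (0::real)) else 0"] by simp
    also have "\<dots> = (if i = j then 1 else 0)" using ij by (subst sum.delta') auto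
    finally show "flat_metric (U, \<phi>) (\<phi> p) $$ (i, j) = (\<Sum>k<n. \<Sum>l<n.
                partial_deriv i (\<lambda>x. transition (U, \<phi>) (V, \<psi>) x k) (\<phi> p) *
                partial_deriv j (\<lambda>x. transition (U, \<phi>) (V, \<psi>) x l) (\<phi> p) *
                flat_metric (V, \<psi>) (\<psi> p) $$ (k, l))"
      using ij by (simp add: flat_metric_def)
  qed
qed

lemma flat_manifold_M: "n \<ge> 1 \<Longrightarrow> flat_manifold n M atlas flat_metric"
proof -
  assume n: "n \<ge> 1"
  interpret riemannian_manifold n M atlas flat_metric by (rule riemannian_manifold_M)
  have pd: "partial_deriv i (\<lambda>_. c) x = 0" for i c x
    by (simp add: partial_deriv_def)
  \<comment> \<open>The Gram matrix is constant on all of R^n and not only on the chart image, so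
    the Christoffel symbols vanish as functions and may be differentiated.\<close>
  have chr: "christoffel n (flat_metric c) k i j = (\<lambda>_. 0)" for c k i j
    unfolding christoffel_def flat_metric_def by (simp add: pd)
  have "riemann n (flat_metric c) l i j k x = 0" for c l i j k x
    unfolding riemann_def chr by (simp add: pd)
  then have "sectional_curvature n (flat_metric c) x u v = 0" for c x u v
    unfolding sectional_curvature_def by simp
  then show ?thesis
    using n compact_M connected_M nontrivial_Euclidean_space
    by unfold_locales (auto simp: topspace_M topspace_Euclidean_space)
qed

end

section \<open>Lifting along the orbit map\<close>

text \<open>The bound \<open>r0\<close> allows continuity of a lift to be tested only at radii so
  small that points of one orbit can be identified.\<close>

lemma continuous_map_boxI:
  assumes E: "\<And>t. t \<in> topspace X \<Longrightarrow> f t \<in> topspace (Euclidean_space n)" and "r0 > 0"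
    and V: "\<And>t r. t \<in> topspace X \<Longrightarrow> 0 < r \<Longrightarrow> r \<le> r0 \<Longrightarrow>
              \<exists>V. openin X V \<and> t \<in> V \<and> f ` V \<subseteq> sup_box n (f t) r"
  shows "continuous_map X (Euclidean_space n) f"
  unfolding continuous_map_def
proof (intro conjI allI impI)
  show "f \<in> topspace X \<rightarrow> topspace (Euclidean_space n)" using E by blast
  fix U assume U: "openin (Euclidean_space n) U"
  have "\<exists>V. openin X V \<and> t \<in> V \<and> V \<subseteq> {x \<in> topspace X. f x \<in> U}" if t: "t \<in> topspace X" "f t \<in> U" for t
  proof -
    obtain r where r: "r > 0" "sup_box n (f t) r \<subseteq> U" using openin_Euclidean_space_imp_box[OF U t(2)] by blast
    obtain V where "openin X V" "t \<in> V" "f ` V \<subseteq> sup_box n (f t) (min r r0)"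
      using V[OF t(1), of "min r r0"] r \<open>r0 > 0\<close> by auto
    moreover have "sup_box n (f t) (min r r0) \<subseteq> U" using box_mono[of "min r r0" r n "f t"] r by simp
    moreover have "V \<subseteq> topspace X" using \<open>openin X V\<close> by (rule openin_subset)
    ultimately show ?thesis by (intro exI[of _ V]) blast
  qed
  then show "openin X {x \<in> topspace X. f x \<in> U}" by (subst openin_subopen) blast
qed

context free_monomial_action
begin

text \<open>Points of one orbit at distance less than \<delta> coincide. The set of agreement is
  therefore the preimage of an open box under h2 - h1, hence open as well as closed.\<close>

lemma lift_unique:
  assumes X: "connected_space X" and h1: "continuous_map X (Euclidean_space n) h1"
    and h2: "continuous_map X (Euclidean_space n) h2"
    and orb: "\<And>t. t \<in> topspace X \<Longrightarrow> orbit (h1 t) = orbit (h2 t)"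
    and t0: "t0 \<in> topspace X" "h1 t0 = h2 t0" and t: "t \<in> topspace X"
  shows "h1 t = h2 t"
proof -
  let ?A = "{t \<in> topspace X. h1 t = h2 t}"
  have "h1 t = h2 t" if t: "t \<in> topspace X" and d: "(\<lambda>i. h2 t i - h1 t i) \<in> sup_box n (\<lambda>_. 0) \<delta>" for t
  proof -
    obtain \<gamma> where \<gamma>: "\<gamma> \<in> \<Gamma>" "h2 t = \<gamma> (h1 t)" using orb[OF t] orbit_eq_iff by blast
    have "h2 t \<in> E" using h2 t continuous_map_funspace by blast
    then have "h2 t \<in> sup_box n (h1 t) \<delta>" using d by (simp add: sup_box_def topspace_Euclidean_space)
    then show ?thesis using separation \<gamma> by force
  qed
  moreover have "(\<lambda>i. h2 t i - h1 t i) \<in> sup_box n (\<lambda>_. 0) \<delta>" if "h1 t = h2 t" for t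
    using that delta_pos by (simp add: sup_box_def)
  ultimately have A: "?A = {t \<in> topspace X. (\<lambda>i. h2 t i - h1 t i) \<in> sup_box n (\<lambda>_. 0) \<delta>}" by blast
  have "openin X ?A" unfolding A
    by (rule openin_continuous_map_preimage[OF continuous_map_Euclidean_space_diff[OF h2 h1] openin_box])
  moreover have "closedin X ?A"
    by (rule closedin_continuous_maps_eq[OF Hausdorff_Euclidean_space h1 h2])
  ultimately have "?A = {} \<or> ?A = topspace X" using X connected_space_clopen_in by blast
  then show ?thesis using t0 t by blast
qed

section \<open>Existence of lifts\<close>

definition near :: "(nat \<Rightarrow> real) set \<Rightarrow> (nat \<Rightarrow> real) set \<Rightarrow> bool" where
  "near p q \<longleftrightarrow> (\<exists>u v. u \<in> E \<and> orbit u = p \<and> orbit v = q \<and> v \<in> sup_box n u R)"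

text \<open>The action is isometric, so a pair of close representatives can be moved until the first
  of them is any prescribed point of its orbit.\<close>

lemma near_lift:
  assumes "near (orbit x) q"
  shows "\<exists>y. y \<in> sup_box n x R \<and> orbit y = q"
proof -
  obtain u v where u: "orbit u = orbit x" "orbit v = q" "v \<in> sup_box n u R" using assms unfolding near_def by blast
  then obtain \<gamma> where \<gamma>: "\<gamma> \<in> \<Gamma>" "x = \<gamma> u" using orbit_eq_iff by blast
  then have "\<gamma> v \<in> sup_box n x R" "orbit (\<gamma> v) = q" using action_box u orbit_action by auto
  then show ?thesis by blast
qed

text \<open>A map into the quotient that stays close to a map already lifted is lifted by picking
  pointwise the representative within R of the old lift. The box of radius R meets each orbit at
  most once, and this makes the choice continuous.\<close>

lemma lift_step:
  assumes h: "continuous_map X (Euclidean_space n) h"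
    and H: "continuous_map X M H"
    and near: "\<And>t. t \<in> topspace X \<Longrightarrow> near (orbit (h t)) (H t)"
  obtains h' where "continuous_map X (Euclidean_space n) h'"
    "\<And>t. t \<in> topspace X \<Longrightarrow> orbit (h' t) = H t" "\<And>t. t \<in> topspace X \<Longrightarrow> h' t \<in> sup_box n (h t) R"
proof -
  define h' where "h' t = (SOME y. y \<in> sup_box n (h t) R \<and> orbit y = H t)" for t
  have h': "h' t \<in> sup_box n (h t) R \<and> orbit (h' t) = H t" if "t \<in> topspace X" for t
    unfolding h'_def using near_lift[OF near[OF that]] by (rule someI_ex)
  have hE: "h t \<in> E" if "t \<in> topspace X" for t using h that continuous_map_funspace by blast
  have "continuous_map X (Euclidean_space n) h'"
  proof (rule continuous_map_boxI[OF _ R_pos])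
    show "h' t \<in> E" if "t \<in> topspace X" for t using h'[OF that] box_subset_topspace by blast
    fix t r assume t: "t \<in> topspace X" and r: "0 < r" "r \<le> R"
    let ?V = "{s \<in> topspace X. H s \<in> orbit ` sup_box n (h' t) r} \<inter> {s \<in> topspace X. h s \<in> sup_box n (h t) R}"
    have "openin M (orbit ` sup_box n (h' t) r)" using open_map_orbit openin_box unfolding open_map_def by auto
    then have "openin X ?V"
      using openin_continuous_map_preimage[OF H] openin_continuous_map_preimage[OF h openin_box] by auto
    moreover have "t \<in> ?V"
      using t h'[OF t] mem_box_self[OF hE[OF t] R_pos] mem_box_self[of "h' t" n r] r box_subset_topspace[of n "h t" R]
      by (auto intro!: image_eqI[of _ _ "h' t"])
    moreover have "h' s \<in> sup_box n (h' t) r" if s: "s \<in> ?V" for s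
    proof -
      obtain z where z: "z \<in> sup_box n (h' t) r" "H s = orbit z" using s by blast
      have s': "s \<in> topspace X" "h s \<in> sup_box n (h t) R" using s by auto
      have "orbit z = orbit (h' s)" using h'[OF s'(1)] z by simp
      then obtain \<gamma> where \<gamma>: "\<gamma> \<in> \<Gamma>" "h' s = \<gamma> z" using orbit_eq_iff by blast
      have "h' s \<in> sup_box n (h t) (R + R)" using box_triangle[OF s'(2)] h'[OF s'(1)] by blast
      moreover have "z \<in> sup_box n (h t) (R + R)"
        using box_triangle h'[OF t] box_mono[OF r(2)] z(1) by blast
      \<comment> \<open>The chosen lift at \<open>s\<close> and the point \<open>z\<close> of its
        orbit are less than 4 R = \<delta> apart, so they coincide and \<open>h' s\<close> inherits
        the small radius of \<open>z\<close>.\<close>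
      ultimately have "h' s \<in> sup_box n z (R + R + (R + R))" by (blast intro: box_diameter)
      then have "\<gamma> = id" using separation \<gamma> unfolding R_def by simp
      then show ?thesis using \<gamma> z by simp
    qed
    ultimately show "\<exists>V. openin X V \<and> t \<in> V \<and> h' ` V \<subseteq> sup_box n (h' t) r" by (intro exI[of _ ?V]) blast
  qed
  then show ?thesis using that h' by blast
qed

text \<open>\<open>e\<close> is a Lebesgue number for the cover of \<open>K\<close> by preimages of
  images of boxes of radius R/2; two points over one such box have representatives less than R
  apart.\<close>

lemma uniformly_near:
  fixes H :: "'t::metric_space \<Rightarrow> (nat \<Rightarrow> real) set"
  assumes K: "compact K" and H: "continuous_map (top_of_set K) M H"
  obtains e where "e > 0" "\<And>s t. s \<in> K \<Longrightarrow> t \<in> K \<Longrightarrow> dist s t < e \<Longrightarrow> near (H s) (H t)"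
proof -
  define \<G> where "\<G> = {T. open T \<and> (\<exists>x\<in>E. \<forall>t\<in>K \<inter> T. H t \<in> orbit ` sup_box n x (R/2))}"
  have "K \<subseteq> \<Union> \<G>"
  proof
    fix t assume t: "t \<in> K"
    then have "H t \<in> topspace M" using H continuous_map_funspace by fastforce
    then obtain x where x: "x \<in> E" "H t = orbit x" unfolding topspace_M by blast
    have "openin M (orbit ` sup_box n x (R/2))" using open_map_orbit openin_box unfolding open_map_def by auto
    then have "openin (top_of_set K) {s \<in> K. H s \<in> orbit ` sup_box n x (R/2)}"
      using openin_continuous_map_preimage[OF H] by fastforce
    then obtain T where T: "open T" "{s \<in> K. H s \<in> orbit ` sup_box n x (R/2)} = K \<inter> T"
      unfolding openin_open by blast
    have "x \<in> sup_box n x (R/2)" using x R_pos by (intro mem_box_self) auto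
    then have "t \<in> T" using T(2) t x by blast
    moreover have "T \<in> \<G>" unfolding \<G>_def using T x(1) by blast
    ultimately show "t \<in> \<Union> \<G>" by blast
  qed
  then obtain e where e: "e > 0" "\<And>t. t \<in> K \<Longrightarrow> \<exists>G\<in>\<G>. ball t e \<subseteq> G"
    using Heine_Borel_lemma[OF K] unfolding \<G>_def by (metis (no_types, lifting) mem_Collect_eq)
  show ?thesis
  proof (rule that[OF e(1)])
    fix s t assume st: "s \<in> K" "t \<in> K" "dist s t < e"
    obtain G where G: "G \<in> \<G>" "ball s e \<subseteq> G" using e(2)[OF st(1)] by blast
    then have "s \<in> K \<inter> G" "t \<in> K \<inter> G" using st e(1) by (auto simp: subset_eq)
    then obtain x where "H s \<in> orbit ` sup_box n x (R/2)" "H t \<in> orbit ` sup_box n x (R/2)"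
      using G(1) unfolding \<G>_def by blast
    then obtain u v where u: "u \<in> sup_box n x (R/2)" "H s = orbit u" and v: "v \<in> sup_box n x (R/2)" "H t = orbit v" by blast
    have "v \<in> sup_box n u R" using box_diameter[OF u(1) v(1)] by simp
    then show "near (H s) (H t)" unfolding near_def using u v box_subset_topspace by blast
  qed
qed

text \<open>Contract the domain to \<open>0\<close> and lift the maps \<open>t \<mapsto> H (s t)\<close> successively for \<open>s = 0, 1/N, \<dots>, 1\<close>.\<close>

lemma lift_exists:
  fixes H :: "'t::real_normed_vector \<Rightarrow> (nat \<Rightarrow> real) set"
  assumes K: "compact K" "0 \<in> K" and star: "\<And>t s. t \<in> K \<Longrightarrow> 0 \<le> s \<Longrightarrow> s \<le> 1 \<Longrightarrow> s *\<^sub>R t \<in> K"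
    and H: "continuous_map (top_of_set K) M H" and x0: "x0 \<in> E" "orbit x0 = H 0"
  obtains h where "continuous_map (top_of_set K) (Euclidean_space n) h" "h 0 = x0"
    "\<And>t. t \<in> K \<Longrightarrow> orbit (h t) = H t"
proof -
  obtain e where e: "e > 0" "\<And>s t. s \<in> K \<Longrightarrow> t \<in> K \<Longrightarrow> dist s t < e \<Longrightarrow> near (H s) (H t)"
    using uniformly_near[OF K(1) H] by blast
  obtain B where B: "\<And>t. t \<in> K \<Longrightarrow> norm t \<le> B" using compact_imp_bounded[OF K(1)] bounded_iff by blast
  obtain N :: nat where N: "B / e < real N" using reals_Archimedean2 by blast
  have "B \<ge> 0" using B[OF K(2)] by simp
  then have N0: "N > 0" using N e(1) by (metis divide_nonneg_pos not_less of_nat_0 gr0I)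
  have scale: "continuous_map (top_of_set K) M (\<lambda>t. H (s *\<^sub>R t))" if "0 \<le> s" "s \<le> 1" for s
  proof -
    have "continuous_map (top_of_set K) (top_of_set K) (\<lambda>t. s *\<^sub>R t)"
      using star that by (auto intro!: continuous_intros)
    from continuous_map_compose[OF this H] show ?thesis by (simp add: o_def)
  qed
  have "\<exists>h. continuous_map (top_of_set K) (Euclidean_space n) h \<and> h 0 = x0 \<and>
          (\<forall>t\<in>K. orbit (h t) = H ((real k / real N) *\<^sub>R t))" if "k \<le> N" for k
    using that
  proof (induction k)
    case 0
    then show ?case using x0 by (intro exI[of _ "\<lambda>_. x0"]) auto
  next
    case (Suc k)
    then obtain h where h: "continuous_map (top_of_set K) (Euclidean_space n) h" "h 0 = x0"
      "\<And>t. t \<in> K \<Longrightarrow> orbit (h t) = H ((real k / real N) *\<^sub>R t)" by auto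
    have k: "0 \<le> real k / real N" "real k / real N \<le> 1" "0 \<le> real (Suc k) / real N" "real (Suc k) / real N \<le> 1"
      using Suc.prems N0 by auto
    have near: "near (orbit (h t)) (H ((real (Suc k) / real N) *\<^sub>R t))" if t: "t \<in> K" for t
    proof -
      have "(real k / real N) *\<^sub>R t - (real (Suc k) / real N) *\<^sub>R t = - ((1 / real N) *\<^sub>R t)"
        by (simp add: scaleR_left_diff_distrib[symmetric] diff_divide_distrib[symmetric])
      then have "dist ((real k / real N) *\<^sub>R t) ((real (Suc k) / real N) *\<^sub>R t) = norm t / real N"
        by (simp add: dist_norm)
      also have "\<dots> \<le> B / real N" using B[OF t] N0 by (simp add: divide_right_mono)
      also have "\<dots> < e" using N e(1) N0 by (simp add: field_simps)
      finally show ?thesis using e(2) star k t h(3)[OF t] by metis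
    qed
    obtain h' where h': "continuous_map (top_of_set K) (Euclidean_space n) h'"
      "\<And>t. t \<in> K \<Longrightarrow> orbit (h' t) = H ((real (Suc k) / real N) *\<^sub>R t)" "\<And>t. t \<in> K \<Longrightarrow> h' t \<in> sup_box n (h t) R"
      using lift_step[OF h(1) scale[OF k(3,4)]] near by (metis topspace_euclidean_subtopology)
    \<comment> \<open>The value over 0 moves by less than R within a single orbit, so it stays at
      \<open>x0\<close>.\<close>
    have "orbit x0 = orbit (h' 0)" using h'(2)[OF K(2)] x0 by simp
    then obtain \<gamma> where \<gamma>: "\<gamma> \<in> \<Gamma>" "h' 0 = \<gamma> x0" using orbit_eq_iff by blast
    have "h' 0 \<in> sup_box n x0 \<delta>"
      using h'(3)[OF K(2)] h(2) box_mono[of R \<delta> n x0] delta_pos unfolding R_def by auto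
    then have "h' 0 = x0" using separation \<gamma> by force
    then show ?case using h' by blast
  qed
  from this[of N] obtain h where "continuous_map (top_of_set K) (Euclidean_space n) h" "h 0 = x0"
    "\<And>t. t \<in> K \<Longrightarrow> orbit (h t) = H ((real N / real N) *\<^sub>R t)" by blast
  then show ?thesis using that N0 by simp
qed

section \<open>The fundamental group of the quotient\<close>

definition lifts_to :: "(nat \<Rightarrow> real) \<Rightarrow> (real \<Rightarrow> (nat \<Rightarrow> real) set) \<Rightarrow> ((nat \<Rightarrow> real) \<Rightarrow> nat \<Rightarrow> real) \<Rightarrow> bool" where
  "lifts_to x0 f \<gamma> \<longleftrightarrow> \<gamma> \<in> \<Gamma> \<and>
     (\<exists>h. continuous_map (top_of_set {0..1}) (Euclidean_space n) h \<and> h 0 = x0 \<and> h 1 = \<gamma> x0 \<and>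
        (\<forall>t\<in>{0..1}. orbit (h t) = f t))"

lemma action_inj: "\<gamma> \<in> \<Gamma> \<Longrightarrow> \<gamma>' \<in> \<Gamma> \<Longrightarrow> x \<in> E \<Longrightarrow> \<gamma> x = \<gamma>' x \<Longrightarrow> \<gamma> = \<gamma>'"
  using separation2[of \<gamma>' \<gamma> x] mem_box_self[OF action_in_E delta_pos] by metis

lemma connected_unit: "connected_space (top_of_set {0..1::real})"
  using connectedin_iff_connected[of "{0..1::real}"] unfolding connectedin_def by simp

lemma lift_unique_unit:
  assumes "continuous_map (top_of_set {0..1}) (Euclidean_space n) h1"
    "continuous_map (top_of_set {0..1}) (Euclidean_space n) h2"
    "\<And>t. t \<in> {0..1} \<Longrightarrow> orbit (h1 t) = orbit (h2 t)" "h1 0 = h2 0" "t \<in> {0..1::real}"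
  shows "h1 t = h2 t"
  using lift_unique[OF connected_unit assms(1,2), of 0 t] assms(3-) by simp

lemma lifts_to_exists:
  assumes "x0 \<in> E" "f \<in> loops M (orbit x0)"
  shows "\<exists>\<gamma>. lifts_to x0 f \<gamma>"
proof -
  have f: "continuous_map (top_of_set {0..1}) M f" "f 0 = orbit x0" "f 1 = orbit x0"
    using assms unfolding loops_def pathin_def by auto
  obtain h where h: "continuous_map (top_of_set {0..1}) (Euclidean_space n) h" "h 0 = x0"
    "\<And>t. t \<in> {0..1} \<Longrightarrow> orbit (h t) = f t"
    using lift_exists[OF _ _ _ f(1) assms(1)] f by (auto simp: mult_le_one)
  have "orbit x0 = orbit (h 1)" using h f by simp
  then obtain \<gamma> where "\<gamma> \<in> \<Gamma>" "h 1 = \<gamma> x0" using orbit_eq_iff by blast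
  then show ?thesis unfolding lifts_to_def using h by blast
qed

lemma lifts_to_unique:
  assumes "x0 \<in> E" "lifts_to x0 f \<gamma>" "lifts_to x0 f \<gamma>'"
  shows "\<gamma> = \<gamma>'"
proof -
  obtain h where h: "continuous_map (top_of_set {0..1}) (Euclidean_space n) h" "h 0 = x0" "h 1 = \<gamma> x0"
    "\<forall>t\<in>{0..1}. orbit (h t) = f t" using assms(2) unfolding lifts_to_def by blast
  obtain h' where h': "continuous_map (top_of_set {0..1}) (Euclidean_space n) h'" "h' 0 = x0" "h' 1 = \<gamma>' x0"
    "\<forall>t\<in>{0..1}. orbit (h' t) = f t" using assms(3) unfolding lifts_to_def by blast
  have "h 1 = h' 1" by (rule lift_unique_unit) (use h h' in auto)
  then show ?thesis using action_inj assms h h' unfolding lifts_to_def by metis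
qed

lemma loops_of_lift:
  assumes "continuous_map (top_of_set {0..1}) (Euclidean_space n) h" "h 0 = x0" "h 1 = \<gamma> x0" "\<gamma> \<in> \<Gamma>"
    "\<And>t. t \<in> {0..1} \<Longrightarrow> orbit (h t) = f t"
  shows "f \<in> loops M (orbit x0)" "lifts_to x0 f \<gamma>"
proof -
  have "continuous_map (top_of_set {0..1}) M f"
    by (rule continuous_map_eq[OF continuous_map_compose[OF assms(1) continuous_map_orbit]])
       (use assms in auto)
  moreover have "f 0 = orbit x0" "f 1 = orbit x0" 
    using assms(2-4) assms(5)[of 0] assms(5)[of 1] orbit_action by auto
  ultimately show "f \<in> loops M (orbit x0)" unfolding loops_def pathin_def by blast
  show "lifts_to x0 f \<gamma>" unfolding lifts_to_def using assms by blast
qed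

lemma continuous_map_segment:
  assumes "continuous_map X (Euclidean_space n) f" "continuous_map X (Euclidean_space n) g"
    "continuous_map X euclideanreal s"
  shows "continuous_map X (Euclidean_space n) (\<lambda>t i. (1 - s t) * f t i + s t * g t i)"
  using assms unfolding continuous_map_Euclidean_space_coordinates
  by (auto simp: topspace_Euclidean_space Pi_iff
      intro!: continuous_map_add continuous_map_diff continuous_map_real_mult)

lemma lifts_to_surj:
  assumes "x0 \<in> E" "\<gamma> \<in> \<Gamma>"
  shows "\<exists>f\<in>loops M (orbit x0). lifts_to x0 f \<gamma>"
proof -
  let ?h = "\<lambda>t i. (1 - t) * x0 i + t * \<gamma> x0 i"
  have "continuous_map (top_of_set {0..1}) (Euclidean_space n) ?h"
    using assms action_in_E by (intro continuous_map_segment) auto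
  then show ?thesis using loops_of_lift[of ?h x0 \<gamma> "\<lambda>t. orbit (?h t)"] assms by auto
qed

text \<open>Euclidean space is convex: the straight-line homotopy between lifts with common end
  points keeps them fixed and projects to the quotient.\<close>

lemma homotopic_of_lifts:
  assumes "lifts_to x0 f \<gamma>" "lifts_to x0 k \<gamma>"
  shows "homotopic_with (\<lambda>j. j 0 = orbit x0 \<and> j 1 = orbit x0) (top_of_set {0..1}) M f k"
proof -
  obtain h where h: "continuous_map (top_of_set {0..1}) (Euclidean_space n) h" "h 0 = x0" "h 1 = \<gamma> x0"
    "\<forall>t\<in>{0..1}. orbit (h t) = f t" using assms(1) unfolding lifts_to_def by blast
  obtain h' where h': "continuous_map (top_of_set {0..1}) (Euclidean_space n) h'" "h' 0 = x0" "h' 1 = \<gamma> x0"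
    "\<forall>t\<in>{0..1}. orbit (h' t) = k t" using assms(2) unfolding lifts_to_def by blast
  have \<gamma>: "\<gamma> \<in> \<Gamma>" using assms unfolding lifts_to_def by blast
  let ?X = "prod_topology (top_of_set {0..1::real}) (top_of_set {0..1::real})"
  let ?H = "\<lambda>z i. (1 - fst z) * h (snd z) i + fst z * h' (snd z) i"
  have "continuous_map ?X (Euclidean_space n) (\<lambda>z. h (snd z))" "continuous_map ?X (Euclidean_space n) (\<lambda>z. h' (snd z))"
    using continuous_map_compose[OF continuous_map_snd h(1)] continuous_map_compose[OF continuous_map_snd h'(1)]
    unfolding o_def by blast+
  moreover have "continuous_map ?X euclideanreal fst"
    using continuous_map_fst[of "top_of_set {0..1::real}" "top_of_set {0..1::real}"]
    unfolding continuous_map_in_subtopology by blast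
  ultimately have "continuous_map ?X (Euclidean_space n) ?H"
    by (rule continuous_map_segment)
  from continuous_map_compose[OF this continuous_map_orbit]
  have 1: "continuous_map ?X M (\<lambda>z. orbit (?H z))" unfolding o_def .
  have eq: "(\<lambda>i. (1 - s) * x i + s * x i) = x" for s and x :: "nat \<Rightarrow> real" by (simp add: algebra_simps)
  show ?thesis
  proof (rule iffD2[OF homotopic_with])
    \<comment> \<open>The characterisation of homotopy requires a side condition that depends only
      on the values on the unit interval; the end points belong to it.\<close>
    show "(u 0 = orbit x0 \<and> u 1 = orbit x0) = (v 0 = orbit x0 \<and> v 1 = orbit x0)"
      if "\<And>t. t \<in> topspace (top_of_set {0..1::real}) \<Longrightarrow> u t = v t" for u v
      using that[of 0] that[of 1] by simp
    show "\<exists>H. continuous_map ?X M H \<and> (\<forall>t\<in>topspace (top_of_set {0..1}). H (0, t) = f t) \<and>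
        (\<forall>t\<in>topspace (top_of_set {0..1}). H (1, t) = k t) \<and>
        (\<forall>s\<in>{0..1}. H (s, 0) = orbit x0 \<and> H (s, 1) = orbit x0)"
    proof (intro exI[of _ "\<lambda>z. orbit (?H z)"] conjI 1)
      show "\<forall>s\<in>{0..1}. orbit (?H (s, 0)) = orbit x0 \<and> orbit (?H (s, 1)) = orbit x0"
        using h(2,3) h'(2,3) orbit_action[OF \<gamma>] by (simp add: eq)
    qed (use h(4) h'(4) in auto)
  qed
qed

text \<open>The unit square is star-shaped about 0, so the homotopy lifts. On the two edges where it
  is constant the lift is constant by uniqueness, which carries the end point
  \<open>\<gamma> x0\<close> from the lift of \<open>f\<close> to that of \<open>k\<close>.\<close>

lemma lifts_to_homotopic:
  assumes x0: "x0 \<in> E" and f: "lifts_to x0 f \<gamma>"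
    and hom: "homotopic_with (\<lambda>j. j 0 = orbit x0 \<and> j 1 = orbit x0) (top_of_set {0..1}) M f k"
  shows "lifts_to x0 k \<gamma>"
proof -
  let ?K = "{0..1::real} \<times> {0..1::real}"
  obtain H :: "real \<times> real \<Rightarrow> (nat \<Rightarrow> real) set" where H': "continuous_map (prod_topology (top_of_set {0..1}) (top_of_set {0..1})) M H \<and>
      (\<forall>t. H (0, t) = f t) \<and> (\<forall>t. H (1, t) = k t) \<and>
      (\<forall>s\<in>{0..1}. H (s, 0) = orbit x0 \<and> H (s, 1) = orbit x0)"
    using hom unfolding homotopic_with_def by blast
  then have H: "\<And>t. H (0, t) = f t" "\<And>t. H (1, t) = k t"
    "\<And>s. s \<in> {0..1} \<Longrightarrow> H (s, 0) = orbit x0 \<and> H (s, 1) = orbit x0" by simp_all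
  have "continuous_map (prod_topology (top_of_set {0..1}) (top_of_set {0..1})) M H" using H' by (rule conjunct1)
  then have HK: "continuous_map (top_of_set ?K) M H" unfolding prod_topology_subtopology_eu .
  have K: "compact ?K" "0 \<in> ?K" by (auto simp: zero_prod_def intro: compact_Times)
  have star: "s *\<^sub>R t \<in> ?K" if "t \<in> ?K" "0 \<le> s" "s \<le> 1" for t s
    using that by (cases t) (auto simp: mult_le_one)
  have "orbit x0 = H 0" using H(3)[of 0] by (simp add: zero_prod_def)
  then obtain h where h: "continuous_map (top_of_set ?K) (Euclidean_space n) h" "h 0 = x0"
    "\<And>t. t \<in> ?K \<Longrightarrow> orbit (h t) = H t"
    using lift_exists[OF K star HK x0] by blast
  have cont: "continuous_map (top_of_set {0..1}) (Euclidean_space n) (\<lambda>t. h (g t))"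
    if "continuous_on {0..1} g" "g ` {0..1} \<subseteq> ?K" for g :: "real \<Rightarrow> real \<times> real"
  proof -
    have "continuous_map (top_of_set {0..1}) (top_of_set ?K) g" using that by auto
    from continuous_map_compose[OF this h(1)] show ?thesis by (simp add: o_def)
  qed
  obtain h0 where h0: "continuous_map (top_of_set {0..1}) (Euclidean_space n) h0" "h0 0 = x0" "h0 1 = \<gamma> x0"
    "\<forall>t\<in>{0..1}. orbit (h0 t) = f t" using f unfolding lifts_to_def by blast
  have c1: "continuous_map (top_of_set {0..1}) (Euclidean_space n) (\<lambda>t. h (0, t))"
    and c2: "continuous_map (top_of_set {0..1}) (Euclidean_space n) (\<lambda>t. h (1, t))"
    and c3: "continuous_map (top_of_set {0..1}) (Euclidean_space n) (\<lambda>t. h (t, 0))"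
    and c4: "continuous_map (top_of_set {0..1}) (Euclidean_space n) (\<lambda>t. h (t, 1))"
    by (intro cont continuous_intros, force)+
  have "h (0, 1) = h0 1"
    by (rule lift_unique_unit[OF c1 h0(1)]) (use h h0 H in \<open>auto simp: zero_prod_def\<close>)
  then have e: "h (0, 1) = \<gamma> x0" using h0 by simp
  have \<gamma>: "\<gamma> \<in> \<Gamma>" using f unfolding lifts_to_def by blast
  have "h (1, 0) = x0"
    by (rule lift_unique_unit[OF c3, of "\<lambda>_. x0"]) (use h H x0 in \<open>auto simp: zero_prod_def\<close>)
  moreover have "h (1, 1) = \<gamma> x0"
    by (rule lift_unique_unit[OF c4, of "\<lambda>_. \<gamma> x0"])
       (use h H e action_in_E[OF \<gamma> x0] orbit_action[OF \<gamma>] in auto)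
  ultimately show ?thesis
    using loops_of_lift(2)[OF c2 _ _ \<gamma>] h(3) H(2) by auto
qed

text \<open>The second half of the lift must start at \<open>\<gamma> x0\<close>, so it is \<gamma>
  applied to the lift of \<open>k\<close> and ends at \<open>\<gamma> (\<gamma>' x0)\<close>.
  Concatenation thus matches composition without reversing the order.\<close>

lemma lifts_to_concat:
  assumes "x0 \<in> E" "lifts_to x0 f \<gamma>" "lifts_to x0 k \<gamma>'"
  shows "concat_loops f k \<in> loops M (orbit x0)" "lifts_to x0 (concat_loops f k) (\<gamma> \<circ> \<gamma>')"
proof -
  obtain h where h: "continuous_map (top_of_set {0..1}) (Euclidean_space n) h" "h 0 = x0" "h 1 = \<gamma> x0"
    "\<forall>t\<in>{0..1}. orbit (h t) = f t" using assms(2) unfolding lifts_to_def by blast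
  obtain h' where h': "continuous_map (top_of_set {0..1}) (Euclidean_space n) h'" "h' 0 = x0" "h' 1 = \<gamma>' x0"
    "\<forall>t\<in>{0..1}. orbit (h' t) = k t" using assms(3) unfolding lifts_to_def by blast
  have \<gamma>: "\<gamma> \<in> \<Gamma>" "\<gamma>' \<in> \<Gamma>" using assms unfolding lifts_to_def by auto
  let ?j = "\<lambda>t. if t \<le> 1/2 then h (2 * t) else \<gamma> (h' (2 * t - 1))"
  have 1: "continuous_map (top_of_set ({0..1} \<inter> {t. t \<in> {0..1} \<and> t \<le> 1/2})) (top_of_set {0..1}) (\<lambda>t::real. 2 * t)"
    and 2: "continuous_map (top_of_set ({0..1} \<inter> {t. t \<in> {0..1} \<and> 1/2 \<le> t})) (top_of_set {0..1}) (\<lambda>t::real. 2 * t - 1)"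
    by (auto intro!: continuous_intros)
  have c: "continuous_map (top_of_set {0..1}) (Euclidean_space n) ?j"
  proof (rule continuous_map_cases_le)
    show "continuous_map (subtopology (top_of_set {0..1}) {x \<in> topspace (top_of_set {0..1}). x \<le> 1/2})
       (Euclidean_space n) (\<lambda>t. h (2 * t))"
      using continuous_map_compose[OF 1 h(1)] by (simp add: o_def subtopology_subtopology)
    show "continuous_map (subtopology (top_of_set {0..1}) {x \<in> topspace (top_of_set {0..1}). 1/2 \<le> x})
       (Euclidean_space n) (\<lambda>t. \<gamma> (h' (2 * t - 1)))"
      using continuous_map_compose[OF continuous_map_compose[OF 2 h'(1)] continuous_map_monomial_map[OF monomial[OF \<gamma>(1)]]]
      by (simp add: o_def subtopology_subtopology)
    show "h (2 * t) = \<gamma> (h' (2 * t - 1))" if "t = 1/2" for t :: real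
      unfolding that using h(3) h'(2) by simp
  qed auto
  have "orbit (?j t) = concat_loops f k t" if "t \<in> {0..1}" for t
    using that h(4) h'(4) orbit_action[OF \<gamma>(1)] by (auto simp: concat_loops_def)
  then show "concat_loops f k \<in> loops M (orbit x0)" "lifts_to x0 (concat_loops f k) (\<gamma> \<circ> \<gamma>')"
    using loops_of_lift[OF c _ _ comp_mem[OF \<gamma>]] h h' by auto
qed

text \<open>The loops whose lift ends at \<open>\<gamma> x0\<close>. Homotopy classes turn out to be
  exactly these sets, after which homotopies no longer need to be handled.\<close>

definition deck_class :: "(nat \<Rightarrow> real) \<Rightarrow> ((nat \<Rightarrow> real) \<Rightarrow> nat \<Rightarrow> real) \<Rightarrow> (real \<Rightarrow> (nat \<Rightarrow> real) set) set" where
  "deck_class x0 \<gamma> = {f \<in> loops M (orbit x0). lifts_to x0 f \<gamma>}"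

lemma loop_class_eq:
  assumes "x0 \<in> E" "lifts_to x0 f \<gamma>"
  shows "loop_class M (orbit x0) f = deck_class x0 \<gamma>"
  unfolding loop_class_def deck_class_def
  using lifts_to_homotopic[OF assms] homotopic_of_lifts[OF assms(2)] by blast

definition deck_group :: "((nat \<Rightarrow> real) \<Rightarrow> nat \<Rightarrow> real) monoid" where
  "deck_group = \<lparr>carrier = \<Gamma>, mult = (\<circ>), one = id\<rparr>"

lemma group_deck_group: "group deck_group"
proof (rule groupI)
  fix \<gamma> assume "\<gamma> \<in> carrier deck_group"
  then show "\<exists>\<gamma>'\<in>carrier deck_group. \<gamma>' \<otimes>\<^bsub>deck_group\<^esub> \<gamma> = \<one>\<^bsub>deck_group\<^esub>"
    using inv_mem unfolding deck_group_def by fastforce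
qed (auto simp: deck_group_def comp_mem id_mem o_assoc)

lemma deck_class_iso:
  assumes x0: "x0 \<in> E"
  shows "deck_class x0 \<in> iso deck_group (fundamental_group M (orbit x0))"
    and "group (fundamental_group M (orbit x0))"
proof -
  let ?P = "fundamental_group M (orbit x0)"
  have ne: "\<exists>f. f \<in> deck_class x0 \<gamma>" if "\<gamma> \<in> \<Gamma>" for \<gamma>
    using lifts_to_surj[OF x0 that] unfolding deck_class_def by blast
  have mem: "f \<in> deck_class x0 \<gamma> \<Longrightarrow> f \<in> loops M (orbit x0) \<and> lifts_to x0 f \<gamma>" for f \<gamma>
    unfolding deck_class_def by blast
  have car: "carrier ?P = deck_class x0 ` \<Gamma>"
  proof
    show "carrier ?P \<subseteq> deck_class x0 ` \<Gamma>"
    proof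
      fix p assume "p \<in> carrier ?P"
      then obtain f where f: "f \<in> loops M (orbit x0)" "p = loop_class M (orbit x0) f"
        unfolding fundamental_group_def by auto
      then obtain \<gamma> where \<gamma>: "lifts_to x0 f \<gamma>" using lifts_to_exists[OF x0] by blast
      then have "\<gamma> \<in> \<Gamma>" unfolding lifts_to_def by blast
      then show "p \<in> deck_class x0 ` \<Gamma>" using loop_class_eq[OF x0 \<gamma>] f by blast
    qed
    show "deck_class x0 ` \<Gamma> \<subseteq> carrier ?P"
    proof
      fix p assume "p \<in> deck_class x0 ` \<Gamma>"
      then obtain \<gamma> where \<gamma>: "\<gamma> \<in> \<Gamma>" "p = deck_class x0 \<gamma>" by blast
      then obtain f where f: "f \<in> loops M (orbit x0)" "lifts_to x0 f \<gamma>" using lifts_to_surj[OF x0] by blast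
      then have "p = loop_class M (orbit x0) f" using loop_class_eq[OF x0] \<gamma> by blast
      then show "p \<in> carrier ?P" unfolding fundamental_group_def using f by simp
    qed
  qed
  have inj: "inj_on (deck_class x0) \<Gamma>"
  proof (rule inj_onI)
    fix \<gamma> \<gamma>' assume "\<gamma> \<in> \<Gamma>" "deck_class x0 \<gamma> = deck_class x0 \<gamma>'"
    then obtain f where "f \<in> deck_class x0 \<gamma>" "f \<in> deck_class x0 \<gamma>'" using ne by blast
    then show "\<gamma> = \<gamma>'" using lifts_to_unique[OF x0] mem by blast
  qed
  have mult: "deck_class x0 (\<gamma> \<circ> \<gamma>') = deck_class x0 \<gamma> \<otimes>\<^bsub>?P\<^esub> deck_class x0 \<gamma>'"
    if "\<gamma> \<in> \<Gamma>" "\<gamma>' \<in> \<Gamma>" for \<gamma> \<gamma>'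
  proof -
    \<comment> \<open>The product of classes is a union over all representatives; it collapses
      because every member of the union is this one class.\<close>
    have "loop_class M (orbit x0) (concat_loops f k) = deck_class x0 (\<gamma> \<circ> \<gamma>')"
      if "f \<in> deck_class x0 \<gamma>" "k \<in> deck_class x0 \<gamma>'" for f k
      using loop_class_eq[OF x0 lifts_to_concat(2)[OF x0]] mem that by blast
    then have "(\<Union>f\<in>deck_class x0 \<gamma>. \<Union>k\<in>deck_class x0 \<gamma>'. loop_class M (orbit x0) (concat_loops f k))
       = (\<Union>f\<in>deck_class x0 \<gamma>. \<Union>k\<in>deck_class x0 \<gamma>'. deck_class x0 (\<gamma> \<circ> \<gamma>'))" by simp
    also have "\<dots> = deck_class x0 (\<gamma> \<circ> \<gamma>')" using ne that by auto
    finally show ?thesis unfolding fundamental_group_def by simp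
  qed
  have one: "deck_class x0 id = \<one>\<^bsub>?P\<^esub>"
  proof -
    have "lifts_to x0 (\<lambda>_. orbit x0) id"
      by (rule loops_of_lift(2)[of "\<lambda>_. x0"]) (use x0 id_mem in auto)
    then show ?thesis unfolding fundamental_group_def using loop_class_eq[OF x0] by simp
  qed
  have hom: "deck_class x0 \<in> hom deck_group ?P"
    using mult car unfolding hom_def deck_group_def by auto
  then show "deck_class x0 \<in> iso deck_group ?P"
    using inj car unfolding iso_def bij_betw_def deck_group_def by simp
  \<comment> \<open>The group axioms for loop classes are inherited along the bijective homomorphism
    from the deck group.\<close>
  have "group (?P \<lparr>carrier := deck_class x0 ` carrier deck_group, one := deck_class x0 \<one>\<^bsub>deck_group\<^esub>\<rparr>)"
    by (rule group.hom_imp_img_group[OF group_deck_group hom])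
  moreover have "?P \<lparr>carrier := deck_class x0 ` carrier deck_group, one := deck_class x0 \<one>\<^bsub>deck_group\<^esub>\<rparr> = ?P"
    using car one by (simp add: deck_group_def)
  ultimately show "group ?P" by simp
qed

end

section \<open>Groups with a faithful integral holonomy representation\<close>

lemma mat_eq_if_mult_vec_eq:
  fixes A B :: "'a :: comm_ring_1 mat"
  assumes A: "A \<in> carrier_mat n n" and B: "B \<in> carrier_mat n n"
    and eq: "\<And>z. z \<in> carrier_vec n \<Longrightarrow> A *\<^sub>v z = B *\<^sub>v z"
  shows "A = B"
proof (rule eq_matI)
  fix i j assume "i < dim_row B" "j < dim_col B"
  then have ij: "i < n" "j < n" using B by auto
  have entry: "(C *\<^sub>v unit_vec n j) $ i = C $$ (i, j)" if "C \<in> carrier_mat n n" for C :: "'a mat"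
    using that ij by (simp add: scalar_prod_right_unit)
  show "A $$ (i, j) = B $$ (i, j)"
    using eq[of "unit_vec n j"] entry[OF A] entry[OF B] by simp
qed (use A B in auto)

text \<open>An extension of a finite group by Z^n, the conjugation action being recorded on the
  whole group and without inverses. By \<open>rho_kernel\<close> the lattice is its own centraliser,
  the source of both its maximality and its uniqueness.\<close>

locale holonomy_data = group P for P (structure) +
  fixes n :: nat and \<iota> :: "int vec \<Rightarrow> 'a" and \<rho> :: "'a \<Rightarrow> int mat"
  assumes iota_hom: "\<iota> \<in> hom (monoid_vec TYPE(int) n) P"
    and iota_inj: "inj_on \<iota> (carrier_vec n)"
    and rho_carrier: "\<gamma> \<in> carrier P \<Longrightarrow> \<rho> \<gamma> \<in> carrier_mat n n"
    and rho_conj: "\<gamma> \<in> carrier P \<Longrightarrow> z \<in> carrier_vec n \<Longrightarrow> \<gamma> \<otimes> \<iota> z = \<iota> (\<rho> \<gamma> *\<^sub>v z) \<otimes> \<gamma>"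
    and rho_kernel: "\<gamma> \<in> carrier P \<Longrightarrow> \<rho> \<gamma> = 1\<^sub>m n \<Longrightarrow> \<gamma> \<in> \<iota> ` carrier_vec n"
    and rho_finite: "finite (\<rho> ` carrier P)"
begin

section \<open>The lattice as unique maximal abelian subgroup of finite index\<close>

definition L where "L = \<iota> ` carrier_vec n"

lemma iota_closed: "z \<in> carrier_vec n \<Longrightarrow> \<iota> z \<in> carrier P"
  using iota_hom by (auto simp: hom_def monoid_vec_simps)

lemma iota_add: "w \<in> carrier_vec n \<Longrightarrow> z \<in> carrier_vec n \<Longrightarrow> \<iota> (w + z) = \<iota> w \<otimes> \<iota> z"
  using iota_hom by (auto simp: hom_def monoid_vec_simps)

lemma iota_zero: "\<iota> (0\<^sub>v n) = \<one>"
proof -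
  have "\<iota> (0\<^sub>v n) \<otimes> \<iota> (0\<^sub>v n) = \<iota> (0\<^sub>v n)" using iota_add[of "0\<^sub>v n" "0\<^sub>v n"] by simp
  then show ?thesis using iota_closed[of "0\<^sub>v n"] r_cancel_one by simp
qed

lemma iota_uminus: "z \<in> carrier_vec n \<Longrightarrow> inv (\<iota> z) = \<iota> (- z)"
  using iota_add[of "- z" z] iota_zero iota_closed[of z] iota_closed[of "- z"]
  by (intro inv_equality) auto

lemma iota_commute: "w \<in> carrier_vec n \<Longrightarrow> z \<in> carrier_vec n \<Longrightarrow> \<iota> w \<otimes> \<iota> z = \<iota> z \<otimes> \<iota> w"
  using iota_add[of w z] iota_add[of z w] comm_add_vec[of w n z] by simp

lemma subgroup_L: "subgroup L P"
proof (rule subgroupI)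
  show "L \<subseteq> carrier P" unfolding L_def using iota_closed by blast
  show "L \<noteq> {}" unfolding L_def using zero_carrier_vec by blast
  show "inv a \<in> L" if "a \<in> L" for a using that iota_uminus uminus_carrier_vec unfolding L_def by auto
  show "a \<otimes> b \<in> L" if ab: "a \<in> L" "b \<in> L" for a b
  proof -
    obtain w z where wz: "w \<in> carrier_vec n" "z \<in> carrier_vec n" "a = \<iota> w" "b = \<iota> z"
      using ab unfolding L_def by blast
    then have "a \<otimes> b = \<iota> (w + z)" using iota_add by simp
    then show ?thesis unfolding L_def using wz by auto
  qed
qed

lemma comm_group_L: "comm_group (P\<lparr>carrier := L\<rparr>)"
proof -
  interpret L: group "P\<lparr>carrier := L\<rparr>" by (rule subgroup.subgroup_is_group[OF subgroup_L is_group])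
  show ?thesis
    by (rule L.group_comm_groupI) (auto simp: L_def iota_commute)
qed

lemma iota_cancel:
  assumes "\<gamma> \<in> carrier P" "w \<in> carrier_vec n" "z \<in> carrier_vec n" "\<iota> w \<otimes> \<gamma> = \<iota> z \<otimes> \<gamma>"
  shows "w = z"
  using assms iota_inj iota_closed by (metis inj_onD right_cancel)

lemma rho_vec_closed: "\<gamma> \<in> carrier P \<Longrightarrow> z \<in> carrier_vec n \<Longrightarrow> \<rho> \<gamma> *\<^sub>v z \<in> carrier_vec n"
  by (rule mult_mat_vec_carrier[OF rho_carrier])

lemma fixes_imp_mem_L:
  assumes "\<gamma> \<in> carrier P" "\<And>z. z \<in> carrier_vec n \<Longrightarrow> \<rho> \<gamma> *\<^sub>v z = z"
  shows "\<gamma> \<in> L"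
proof -
  have "\<rho> \<gamma> = 1\<^sub>m n"
    by (rule mat_eq_if_mult_vec_eq[OF rho_carrier[OF assms(1)]]) (use assms(2) in auto)
  then show ?thesis using rho_kernel assms(1) unfolding L_def by blast
qed

lemma commute_iff:
  assumes "\<gamma> \<in> carrier P" "z \<in> carrier_vec n"
  shows "\<gamma> \<otimes> \<iota> z = \<iota> z \<otimes> \<gamma> \<longleftrightarrow> \<rho> \<gamma> *\<^sub>v z = z"
  using iota_cancel[OF assms(1) rho_vec_closed[OF assms] assms(2)] rho_conj[OF assms] by auto

text \<open>The quotient \<gamma>^-1 \<gamma>' centralises the lattice and hence belongs to it.
  Finiteness of the index follows from finiteness of the set of matrices.\<close>

lemma same_rho_coset:
  assumes g: "\<gamma> \<in> carrier P" "\<gamma>' \<in> carrier P" and eq: "\<rho> \<gamma> = \<rho> \<gamma>'"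
  shows "L #> \<gamma> = L #> \<gamma>'"
proof -
  let ?\<kappa> = "inv \<gamma> \<otimes> \<gamma>'"
  have k: "?\<kappa> \<in> carrier P" using g by simp
  have "?\<kappa> \<otimes> \<iota> z = \<iota> z \<otimes> ?\<kappa>" if z: "z \<in> carrier_vec n" for z
  proof -
    let ?w = "\<iota> (\<rho> \<gamma> *\<^sub>v z)"
    have w: "?w \<in> carrier P" "\<iota> z \<in> carrier P" using iota_closed rho_vec_closed g z by auto
    have "inv \<gamma> \<otimes> ?w = inv \<gamma> \<otimes> (?w \<otimes> \<gamma>) \<otimes> inv \<gamma>" using g w by (simp add: m_assoc)
    also have "\<dots> = inv \<gamma> \<otimes> (\<gamma> \<otimes> \<iota> z) \<otimes> inv \<gamma>" using rho_conj[OF g(1) z] by simp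
    also have "\<dots> = \<iota> z \<otimes> inv \<gamma>" using g w by (simp add: m_assoc[symmetric])
    finally have 1: "inv \<gamma> \<otimes> ?w = \<iota> z \<otimes> inv \<gamma>" .
    have "?\<kappa> \<otimes> \<iota> z = inv \<gamma> \<otimes> (\<gamma>' \<otimes> \<iota> z)" using g w by (simp add: m_assoc)
    also have "\<dots> = inv \<gamma> \<otimes> (?w \<otimes> \<gamma>')" using rho_conj[OF g(2) z] eq by simp
    also have "\<dots> = (inv \<gamma> \<otimes> ?w) \<otimes> \<gamma>'" using g w by (simp add: m_assoc)
    also have "\<dots> = \<iota> z \<otimes> ?\<kappa>" unfolding 1 using g w by (simp add: m_assoc)
    finally show ?thesis .
  qed
  then have "?\<kappa> \<in> L" using fixes_imp_mem_L[OF k] commute_iff[OF k] by blast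
  then obtain w where w: "w \<in> carrier_vec n" "?\<kappa> = \<iota> w" unfolding L_def by blast
  have "\<gamma>' = \<gamma> \<otimes> ?\<kappa>" using g by (simp add: m_assoc[symmetric])
  also have "\<dots> = \<iota> (\<rho> \<gamma> *\<^sub>v w) \<otimes> \<gamma>" using rho_conj[OF g(1) w(1)] w(2) by simp
  finally have "\<gamma>' \<in> L #> \<gamma>" unfolding r_coset_def L_def using rho_vec_closed[OF g(1) w(1)] by blast
  then show ?thesis using repr_independence g(1) subgroup_L by blast
qed

lemma finite_rcosets_L: "finite (rcosets L)"
proof -
  have "rcosets L = (\<lambda>\<gamma>. L #> \<gamma>) ` carrier P" unfolding RCOSETS_def by blast
  also have "\<dots> \<subseteq> (\<lambda>A. L #> (SOME \<gamma>. \<gamma> \<in> carrier P \<and> \<rho> \<gamma> = A)) ` \<rho> ` carrier P"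
  proof clarify
    fix \<gamma> assume \<gamma>: "\<gamma> \<in> carrier P"
    let ?\<kappa> = "SOME \<kappa>. \<kappa> \<in> carrier P \<and> \<rho> \<kappa> = \<rho> \<gamma>"
    have "?\<kappa> \<in> carrier P \<and> \<rho> ?\<kappa> = \<rho> \<gamma>" by (rule someI[of _ \<gamma>]) (use \<gamma> in simp)
    then have "L #> \<gamma> = L #> ?\<kappa>" using same_rho_coset \<gamma> by metis
    then show "L #> \<gamma> \<in> (\<lambda>A. L #> (SOME \<gamma>. \<gamma> \<in> carrier P \<and> \<rho> \<gamma> = A)) ` \<rho> ` carrier P"
      using \<gamma> by blast
  qed
  finally show ?thesis using rho_finite finite_subset by blast
qed

text \<open>An element of an abelian \<open>H\<close> fixes the multiples of lattice vectors that
  lie in \<open>H\<close>, hence the vectors themselves because Z is torsion-free. Taking k = 1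
  gives maximality of the lattice, other multiples give its uniqueness.\<close>

lemma commuting_imp_subset_L:
  assumes H: "subgroup H P" "comm_group (P\<lparr>carrier := H\<rparr>)"
    and pow: "\<And>z. z \<in> carrier_vec n \<Longrightarrow> \<exists>k::int. k \<noteq> 0 \<and> \<iota> (k \<cdot>\<^sub>v z) \<in> H"
  shows "H \<subseteq> L"
proof
  fix h assume h: "h \<in> H"
  have hP: "h \<in> carrier P" using h H(1) subgroup.subset by blast
  show "h \<in> L"
  proof (rule fixes_imp_mem_L[OF hP])
    fix z :: "int vec" assume z: "z \<in> carrier_vec n"
    obtain k :: int where k: "k \<noteq> 0" "\<iota> (k \<cdot>\<^sub>v z) \<in> H" using pow[OF z] by blast
    interpret H: comm_group "P\<lparr>carrier := H\<rparr>" by (rule H(2))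
    have "h \<otimes> \<iota> (k \<cdot>\<^sub>v z) = \<iota> (k \<cdot>\<^sub>v z) \<otimes> h" using H.m_comm[of h "\<iota> (k \<cdot>\<^sub>v z)"] h k by simp
    then have e: "\<rho> h *\<^sub>v (k \<cdot>\<^sub>v z) = k \<cdot>\<^sub>v z" using commute_iff[OF hP, of "k \<cdot>\<^sub>v z"] z by simp
    show "\<rho> h *\<^sub>v z = z"
    proof (rule eq_vecI)
      fix i assume i: "i < dim_vec z"
      then have "(\<rho> h *\<^sub>v (k \<cdot>\<^sub>v z)) $ i = k * (\<rho> h *\<^sub>v z) $ i"
        using z rho_carrier[OF hP] by (simp add: scalar_prod_def sum_distrib_left mult.left_commute)
      then show "(\<rho> h *\<^sub>v z) $ i = z $ i" using e k i z by simp
    qed (use z rho_carrier[OF hP] in auto)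
  qed
qed

lemma maximal_abelian_L: "maximal_abelian_subgroup L P"
  unfolding maximal_abelian_subgroup_def
proof (intro conjI allI impI subgroup_L comm_group_L)
  fix H assume H: "subgroup H P \<and> comm_group (P\<lparr>carrier := H\<rparr>) \<and> L \<subseteq> H"
  have "H \<subseteq> L"
  proof (rule commuting_imp_subset_L)
    fix z :: "int vec" assume "z \<in> carrier_vec n"
    then have "\<iota> (1 \<cdot>\<^sub>v z) \<in> H" using H unfolding L_def by auto
    then show "\<exists>k::int. k \<noteq> 0 \<and> \<iota> (k \<cdot>\<^sub>v z) \<in> H" by (intro exI[of _ 1]) simp
  qed (use H in auto)
  then show "H = L" using H by blast
qed

text \<open>Pigeonhole principle: two of the infinitely many multiples of \<open>z\<close> lie in
  the same coset of \<open>H\<close>.\<close>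

lemma finite_index_pow:
  assumes H: "subgroup H P" and fin: "finite (rcosets H)" and z: "z \<in> carrier_vec n"
  shows "\<exists>k::int. k \<noteq> 0 \<and> \<iota> (k \<cdot>\<^sub>v z) \<in> H"
proof -
  have kz: "k \<cdot>\<^sub>v z \<in> carrier_vec n" for k :: int using z by simp
  have "(\<lambda>k::int. H #> \<iota> (k \<cdot>\<^sub>v z)) ` UNIV \<subseteq> rcosets H"
    unfolding RCOSETS_def using iota_closed[OF kz] by blast
  then have "finite ((\<lambda>k::int. H #> \<iota> (k \<cdot>\<^sub>v z)) ` UNIV)" using fin finite_subset by blast
  then have "\<not> inj (\<lambda>k::int. H #> \<iota> (k \<cdot>\<^sub>v z))" using finite_imageD infinite_UNIV_int by blast
  then obtain j k :: int where jk: "j \<noteq> k" "H #> \<iota> (j \<cdot>\<^sub>v z) = H #> \<iota> (k \<cdot>\<^sub>v z)" unfolding inj_def by blast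
  have "\<iota> (j \<cdot>\<^sub>v z) \<in> H #> \<iota> (k \<cdot>\<^sub>v z)" using rcos_self[OF iota_closed[OF kz] H, of j] jk by simp
  then have "\<iota> (j \<cdot>\<^sub>v z) \<otimes> inv (\<iota> (k \<cdot>\<^sub>v z)) \<in> H"
    using subgroup.rcos_module_imp[OF H is_group iota_closed[OF kz]] by blast
  moreover have "\<iota> (j \<cdot>\<^sub>v z) \<otimes> inv (\<iota> (k \<cdot>\<^sub>v z)) = \<iota> (j \<cdot>\<^sub>v z + - (k \<cdot>\<^sub>v z))"
    using iota_uminus[OF kz] iota_add[OF kz, of "- (k \<cdot>\<^sub>v z)"] kz by simp
  moreover have "j \<cdot>\<^sub>v z + - (k \<cdot>\<^sub>v z) = (j - k) \<cdot>\<^sub>v z"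
    using z by (intro eq_vecI) (auto simp: algebra_simps)
  ultimately show ?thesis using jk(1) by (intro exI[of _ "j - k"]) auto
qed

text \<open>A competitor of finite index contains a nonzero multiple of every lattice vector, so it
  is contained in \<open>L\<close>; its own maximality then forces equality.\<close>

lemma translation_lattice_eq: "translation_lattice P = L"
  unfolding translation_lattice_def
proof (rule the_equality)
  show "maximal_abelian_subgroup L P \<and> finite (rcosets L)" using maximal_abelian_L finite_rcosets_L by blast
  fix H assume H: "maximal_abelian_subgroup H P \<and> finite (rcosets H)"
  then have H': "subgroup H P" "comm_group (P\<lparr>carrier := H\<rparr>)" unfolding maximal_abelian_subgroup_def by auto
  have "H \<subseteq> L"
    by (rule commuting_imp_subset_L[OF H' finite_index_pow[OF H'(1) conjunct2[OF H]]])
  moreover have "\<forall>K. subgroup K P \<and> comm_group (P\<lparr>carrier := K\<rparr>) \<and> H \<subseteq> K \<longrightarrow> K = H"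
    using H unfolding maximal_abelian_subgroup_def by simp
  ultimately show "H = L" using subgroup_L comm_group_L by metis
qed

text \<open>Elements of one coset differ by a left factor from the abelian group \<open>L\<close>,
  which does not change conjugation on the lattice.\<close>

lemma holonomy_rep_eq:
  assumes g: "\<gamma> \<in> carrier P"
  shows "holonomy_rep P n \<iota> (L #> \<gamma>) = \<rho> \<gamma>"
  unfolding holonomy_rep_def
proof (rule the_equality)
  have key: "\<iota> (\<rho> \<gamma> *\<^sub>v z) = \<gamma>' \<otimes> \<iota> z \<otimes> inv \<gamma>'" if g': "\<gamma>' \<in> L #> \<gamma>" and z: "z \<in> carrier_vec n" for \<gamma>' z
  proof -
    obtain w where w: "w \<in> carrier_vec n" "\<gamma>' = \<iota> w \<otimes> \<gamma>" using g' unfolding r_coset_def L_def by blast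
    have c: "\<iota> w \<in> carrier P" "\<iota> z \<in> carrier P" "\<iota> (\<rho> \<gamma> *\<^sub>v z) \<in> carrier P" "\<gamma>' \<in> carrier P"
      using iota_closed rho_vec_closed g z w by auto
    have "\<gamma>' \<otimes> \<iota> z = \<iota> w \<otimes> (\<gamma> \<otimes> \<iota> z)" using w c g by (simp add: m_assoc)
    also have "\<dots> = (\<iota> w \<otimes> \<iota> (\<rho> \<gamma> *\<^sub>v z)) \<otimes> \<gamma>" using rho_conj[OF g z] c g by (simp add: m_assoc)
    also have "\<dots> = \<iota> (\<rho> \<gamma> *\<^sub>v z) \<otimes> \<gamma>'"
      using iota_commute[OF w(1) rho_vec_closed[OF g z]] w c g by (simp add: m_assoc)
    finally show ?thesis using c by (simp add: m_assoc)
  qed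
  then show "\<rho> \<gamma> \<in> carrier_mat n n \<and>
     (\<forall>\<gamma>'\<in>L #> \<gamma>. \<forall>z\<in>carrier_vec n. \<iota> (\<rho> \<gamma> *\<^sub>v z) = \<gamma>' \<otimes> \<iota> z \<otimes> inv \<gamma>')"
    using rho_carrier[OF g] by blast
  fix B assume B: "B \<in> carrier_mat n n \<and>
     (\<forall>\<gamma>'\<in>L #> \<gamma>. \<forall>z\<in>carrier_vec n. \<iota> (B *\<^sub>v z) = \<gamma>' \<otimes> \<iota> z \<otimes> inv \<gamma>')"
  show "B = \<rho> \<gamma>"
  proof (rule mat_eq_if_mult_vec_eq)
    fix z :: "int vec" assume z: "z \<in> carrier_vec n"
    have "\<gamma> \<in> L #> \<gamma>" using rcos_self[OF g subgroup_L] .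
    then have "\<iota> (B *\<^sub>v z) = \<iota> (\<rho> \<gamma> *\<^sub>v z)" using B key z by metis
    then show "B *\<^sub>v z = \<rho> \<gamma> *\<^sub>v z"
      using iota_inj B z rho_vec_closed[OF g z] mult_mat_vec_carrier inj_onD by metis
  qed (use B rho_carrier[OF g] in auto)
qed

lemma iota_iso: "\<iota> \<in> iso (monoid_vec TYPE(int) n) (P\<lparr>carrier := translation_lattice P\<rparr>)"
  unfolding translation_lattice_eq iso_def hom_def bij_betw_def
  using iota_inj iota_add by (auto simp: monoid_vec_simps L_def)

text \<open>Submodules and module endomorphisms depend only on the set of representing matrices, so
  this image determines the type.\<close>

lemma holonomy_rep_image:
  "holonomy_rep P n \<iota> ` carrier (holonomy_group P) = \<rho> ` carrier P"
proof -
  have "carrier (holonomy_group P) = (\<lambda>\<gamma>. L #> \<gamma>) ` carrier P"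
    unfolding holonomy_group_def FactGroup_def RCOSETS_def translation_lattice_eq by auto
  then show ?thesis using holonomy_rep_eq by (simp add: image_image)
qed

end

text \<open>Lets the holonomy be computed with explicit isometries in the deck group and then moved
  to classes of loops.\<close>

lemma holonomy_data_transfer:
  assumes "holonomy_data G n \<iota> \<rho>" and P: "group P" and \<theta>: "\<theta> \<in> iso G P"
  shows "holonomy_data P n (\<theta> \<circ> \<iota>) (\<rho> \<circ> inv_into (carrier G) \<theta>)"
proof -
  interpret G: holonomy_data G n \<iota> \<rho> by (rule assms(1))
  interpret P: group P by (rule P)
  have hom: "\<theta> \<in> hom G P" and bij: "bij_betw \<theta> (carrier G) (carrier P)" using \<theta> unfolding iso_def by auto
  have inj: "inj_on \<theta> (carrier G)" and im: "\<theta> ` carrier G = carrier P"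
    using bij unfolding bij_betw_def by auto
  have inv: "inv_into (carrier G) \<theta> (\<theta> \<gamma>) = \<gamma>" if "\<gamma> \<in> carrier G" for \<gamma>
    using inj that by (rule inv_into_f_f)
  show ?thesis
  proof
    show "\<theta> \<circ> \<iota> \<in> hom (monoid_vec TYPE(int) n) P" by (rule hom_compose[OF G.iota_hom hom])
    have "\<iota> ` carrier_vec n \<subseteq> carrier G" using G.iota_closed by blast
    then show "inj_on (\<theta> \<circ> \<iota>) (carrier_vec n)"
      using comp_inj_on[OF G.iota_inj inj_on_subset[OF inj]] by blast
    have "(\<rho> \<circ> inv_into (carrier G) \<theta>) ` carrier P = \<rho> ` carrier G"
      unfolding im[symmetric] image_image by (rule image_cong) (simp_all add: inv)
    then show "finite ((\<rho> \<circ> inv_into (carrier G) \<theta>) ` carrier P)" using G.rho_finite by simp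
    fix p assume "p \<in> carrier P"
    then obtain \<gamma> where \<gamma>: "\<gamma> \<in> carrier G" "p = \<theta> \<gamma>" unfolding im[symmetric] by blast
    have r: "(\<rho> \<circ> inv_into (carrier G) \<theta>) p = \<rho> \<gamma>" unfolding \<gamma>(2) using inv[OF \<gamma>(1)] by simp
    show "(\<rho> \<circ> inv_into (carrier G) \<theta>) p \<in> carrier_mat n n" unfolding r by (rule G.rho_carrier[OF \<gamma>(1)])
    show "p \<in> (\<theta> \<circ> \<iota>) ` carrier_vec n" if "(\<rho> \<circ> inv_into (carrier G) \<theta>) p = 1\<^sub>m n"
      using G.rho_kernel[OF \<gamma>(1)] that \<gamma>(2) unfolding r by auto
    show "p \<otimes>\<^bsub>P\<^esub> (\<theta> \<circ> \<iota>) z = (\<theta> \<circ> \<iota>) ((\<rho> \<circ> inv_into (carrier G) \<theta>) p *\<^sub>v z) \<otimes>\<^bsub>P\<^esub> p"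
      if z: "z \<in> carrier_vec n" for z
      unfolding r \<gamma>(2) o_apply
      using hom_mult[OF hom \<gamma>(1) G.iota_closed[OF z]] G.rho_conj[OF \<gamma>(1) z]
        hom_mult[OF hom G.iota_closed[OF G.rho_vec_closed[OF \<gamma>(1) z]] \<gamma>(1)] inv[OF \<gamma>(1)] by simp
  qed
qed

section \<open>Holonomy of the quotient\<close>

text \<open>Together with \<open>translation_mem\<close> this makes the lattice of pure translations
  exactly Z^n in the given coordinates.\<close>

locale free_crystallographic_action = free_monomial_action +
  assumes translation_integral:
    "(\<lambda>x i. if i < n then x i + b i else x i) \<in> \<Gamma> \<Longrightarrow> i < n \<Longrightarrow> b i \<in> \<int>"
begin

text \<open>Column j is the image of the unit vector e_j minus the image of 0. For elements of
  \<Gamma> the entries are already integers; the floor only changes their type.\<close>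

definition linear_part :: "((nat \<Rightarrow> real) \<Rightarrow> nat \<Rightarrow> real) \<Rightarrow> int mat" where
  "linear_part \<gamma> = mat n n (\<lambda>(i, j). \<lfloor>\<gamma> (\<lambda>k. if k = j then 1 else 0) i - \<gamma> (\<lambda>_. 0) i\<rfloor>)"

definition translation :: "int vec \<Rightarrow> (nat \<Rightarrow> real) \<Rightarrow> nat \<Rightarrow> real" where
  "translation z x i = (if i < n then x i + real_of_int (z $ i) else x i)"

lemma linear_part_mult:
  assumes \<pi>: "bij_betw \<pi> {..<n} {..<n}" and \<epsilon>: "\<And>i. \<epsilon> i \<in> {1, -1 :: int}"
    and \<gamma>: "\<gamma> = (\<lambda>x i. if i < n then real_of_int (\<epsilon> i) * x (\<pi> i) + b i else x i)"
    and i: "i < n" and z: "z \<in> carrier_vec n"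
  shows "(linear_part \<gamma> *\<^sub>v z) $ i = \<epsilon> i * z $ \<pi> i"
proof -
  have pi: "\<pi> i < n" using bij_betwE[OF \<pi>] i by auto
  have "linear_part \<gamma> $$ (i, j) = (if j = \<pi> i then \<epsilon> i else 0)" if "j < n" for j
    using i that unfolding linear_part_def \<gamma> by simp
  then have "(linear_part \<gamma> *\<^sub>v z) $ i = (\<Sum>j<n. (if j = \<pi> i then \<epsilon> i else 0) * z $ j)"
    using i z by (simp add: linear_part_def scalar_prod_def atLeast0LessThan)
  also have "\<dots> = (\<Sum>j<n. if j = \<pi> i then \<epsilon> i * z $ j else 0)" by (intro sum.cong) auto
  also have "\<dots> = \<epsilon> i * z $ \<pi> i" using pi by (subst sum.delta) auto
  finally show ?thesis .
qed

lemma monomial_int: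
  assumes "\<gamma> \<in> \<Gamma>"
  obtains \<pi> \<epsilon> b where "bij_betw \<pi> {..<n} {..<n}" "\<And>i. \<epsilon> i \<in> {1, -1 :: int}"
    "\<gamma> = (\<lambda>x i. if i < n then real_of_int (\<epsilon> i) * x (\<pi> i) + b i else x i)"
proof -
  obtain \<pi> \<epsilon> b where \<pi>: "bij_betw \<pi> {..<n} {..<n}" and \<epsilon>: "\<forall>i. \<epsilon> i \<in> {1, -1 :: real}"
    and \<gamma>: "\<gamma> = (\<lambda>x i. if i < n then \<epsilon> i * x (\<pi> i) + b i else x i)"
    using monomial[OF assms] unfolding monomial_map_def by blast
  have e: "\<epsilon> i = real_of_int (if \<epsilon> i = 1 then 1 else -1)" for i using \<epsilon>[rule_format, of i] by auto
  have "\<gamma> = (\<lambda>x i. if i < n then real_of_int (if \<epsilon> i = 1 then 1 else -1) * x (\<pi> i) + b i else x i)"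
    unfolding \<gamma> by (subst e) (rule refl)
  then show ?thesis by (intro that[OF \<pi>, of "\<lambda>i. if \<epsilon> i = 1 then 1 else -1"]) auto
qed

lemma holonomy_data_deck_group: "holonomy_data deck_group n translation linear_part"
proof -
  interpret group deck_group by (rule group_deck_group)
  have tr: "translation z \<in> \<Gamma>" for z
    using translation_mem[of "\<lambda>i. z $ i"] unfolding translation_def[abs_def] by simp
  show ?thesis
  proof
    show "translation \<in> hom (monoid_vec TYPE(int) n) deck_group"
    proof (rule homI)
      fix w z assume "w \<in> carrier (monoid_vec TYPE(int) n)" "z \<in> carrier (monoid_vec TYPE(int) n)"
      then show "translation (w \<otimes>\<^bsub>monoid_vec TYPE(int) n\<^esub> z) = translation w \<otimes>\<^bsub>deck_group\<^esub> translation z"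
        by (auto simp: monoid_vec_simps deck_group_def translation_def fun_eq_iff)
    qed (simp add: deck_group_def tr)
    show "inj_on translation (carrier_vec n)"
    proof (rule inj_onI)
      fix w z :: "int vec" assume wz: "w \<in> carrier_vec n" "z \<in> carrier_vec n" "translation w = translation z"
      show "w = z"
      proof (rule eq_vecI)
        fix i assume i: "i < dim_vec z"
        have "translation w (\<lambda>_. 0) i = translation z (\<lambda>_. 0) i" using wz(3) by simp
        then show "w $ i = z $ i" using wz(1,2) i by (simp add: translation_def)
      qed (use wz in auto)
    qed
    show "linear_part \<gamma> \<in> carrier_mat n n" for \<gamma> by (simp add: linear_part_def)
    show "finite (linear_part ` carrier deck_group)"
    proof (rule finite_subset)
      let ?F = "({..<n} \<times> {..<n}) \<rightarrow>\<^sub>E {-1, 0, 1 :: int}"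
      show "finite (mat n n ` ?F)" by (intro finite_imageI finite_PiE) auto
      show "linear_part ` carrier deck_group \<subseteq> mat n n ` ?F"
      proof clarify
        fix \<gamma> assume "\<gamma> \<in> carrier deck_group"
        then have "\<gamma> \<in> \<Gamma>" by (simp add: deck_group_def)
        then obtain \<pi> \<epsilon> b where "bij_betw \<pi> {..<n} {..<n}" and \<epsilon>: "\<And>i. \<epsilon> i \<in> {1, -1 :: int}"
          and \<gamma>: "\<gamma> = (\<lambda>x i. if i < n then real_of_int (\<epsilon> i) * x (\<pi> i) + b i else x i)"
          using monomial_int by blast
        let ?f = "\<lambda>(i, j). if i < n \<and> j < n then (if j = \<pi> i then \<epsilon> i else 0) else undefined"
        have "linear_part \<gamma> = mat n n ?f"
          by (rule eq_matI) (auto simp: linear_part_def \<gamma>)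
        moreover have "?f \<in> ?F"
        proof (rule PiE_I)
          fix x assume "x \<in> {..<n} \<times> {..<n}"
          then show "?f x \<in> {-1, 0, 1}" using \<epsilon>[of "fst x"] by (cases x) auto
        next
          fix x assume "x \<notin> {..<n} \<times> {..<n}"
          then show "?f x = undefined" by (cases x) auto
        qed
        ultimately show "linear_part \<gamma> \<in> mat n n ` ?F" by blast
      qed
    qed
    fix \<gamma> assume "\<gamma> \<in> carrier deck_group"
    then have \<gamma>': "\<gamma> \<in> \<Gamma>" by (simp add: deck_group_def)
    obtain \<pi> \<epsilon> b where \<pi>: "bij_betw \<pi> {..<n} {..<n}" and \<epsilon>: "\<And>i. \<epsilon> i \<in> {1, -1 :: int}"
      and \<gamma>: "\<gamma> = (\<lambda>x i. if i < n then real_of_int (\<epsilon> i) * x (\<pi> i) + b i else x i)"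
      using monomial_int[OF \<gamma>'] by blast
    have pi: "\<pi> i < n" if "i < n" for i using bij_betwE[OF \<pi>] that by auto
    show "\<gamma> \<otimes>\<^bsub>deck_group\<^esub> translation z = translation (linear_part \<gamma> *\<^sub>v z) \<otimes>\<^bsub>deck_group\<^esub> \<gamma>"
      if z: "z \<in> carrier_vec n" for z
    proof -
      have "\<gamma> (translation z x) i = translation (linear_part \<gamma> *\<^sub>v z) (\<gamma> x) i" for x i
      proof (cases "i < n")
        case True
        then show ?thesis
          using linear_part_mult[OF \<pi> \<epsilon> \<gamma> True z] pi[OF True]
          by (simp add: translation_def) (simp add: \<gamma> translation_def algebra_simps)
      qed (simp add: \<gamma> translation_def)
      then show ?thesis by (auto simp: deck_group_def fun_eq_iff)
    qed
    show "\<gamma> \<in> translation ` carrier_vec n" if one: "linear_part \<gamma> = 1\<^sub>m n"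
    proof -
      have "\<pi> i = i \<and> \<epsilon> i = 1" if i: "i < n" for i
      proof -
        \<comment> \<open>Testing row i of the identity matrix on the unit vector e_(\<pi> i): the
          left side is \<plusminus>1, so the right side forces \<pi> i = i and then the sign
          +1.\<close>
        have "\<epsilon> i * unit_vec n (\<pi> i) $ \<pi> i = (unit_vec n (\<pi> i) :: int vec) $ i"
          using linear_part_mult[OF \<pi> \<epsilon> \<gamma> i, of "unit_vec n (\<pi> i)"] one by simp
        then show ?thesis using pi[OF i] i \<epsilon>[of i] by (auto split: if_splits simp: unit_vec_def)
      qed
      then have \<gamma>_eq: "\<gamma> = (\<lambda>x i. if i < n then x i + b i else x i)" unfolding \<gamma> by (auto simp: fun_eq_iff)
      then have "b i \<in> \<int>" if "i < n" for i using translation_integral[of b i] \<gamma>' that by simp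
      then have "\<gamma> = translation (vec n (\<lambda>i. \<lfloor>b i\<rfloor>))"
        unfolding \<gamma>_eq by (auto simp: translation_def fun_eq_iff)
      then show ?thesis by (intro image_eqI) auto
    qed
  qed
qed

lemma holonomy_fundamental_group:
  assumes "x0 \<in> E"
  obtains \<iota> where "\<iota> \<in> iso (monoid_vec TYPE(int) n)
      ((fundamental_group M (orbit x0))\<lparr>carrier := translation_lattice (fundamental_group M (orbit x0))\<rparr>)"
    and "holonomy_rep (fundamental_group M (orbit x0)) n \<iota> ` carrier (holonomy_group (fundamental_group M (orbit x0)))
      = linear_part ` \<Gamma>"
proof -
  let ?P = "fundamental_group M (orbit x0)"
  let ?\<rho> = "linear_part \<circ> inv_into (carrier deck_group) (deck_class x0)"
  note iso = deck_class_iso[OF assms]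
  interpret P: holonomy_data ?P n "deck_class x0 \<circ> translation" ?\<rho>
    by (rule holonomy_data_transfer[OF holonomy_data_deck_group iso(2,1)])
  have "bij_betw (deck_class x0) (carrier deck_group) (carrier ?P)" using iso(1) unfolding iso_def by blast
  then have "inv_into (carrier deck_group) (deck_class x0) ` carrier ?P = \<Gamma>"
    using bij_betw_imp_surj_on[OF bij_betw_inv_into] by (fastforce simp: deck_group_def)
  then have "?\<rho> ` carrier ?P = linear_part ` \<Gamma>" unfolding image_comp[symmetric] by simp
  then show ?thesis using that[OF P.iota_iso] P.holonomy_rep_image by simp
qed

end

section \<open>A crystallographic group of dimension 48\<close>

text \<open>
  The group of order 64 is \<open>F\<^sub>2\<^sup>4 \<times> F\<^sub>2\<^sup>2\<close> with the bilinear cocycle \<open>(beta1, beta2)\<close>, vectors of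
  \<open>F\<^sub>2\<^sup>4\<close> being written as the bits of a number below 16. The coordinate \<open>16 c + v\<close> is the entry at
  \<open>v \<in> F\<^sub>2\<^sup>4\<close> of block \<open>c\<close>, one block for each circle of the Hantzsche--Wendt 3-torus. The two forms were
  found by a search: their quadratic forms and the sum of these have Arf invariant 1 and no common
  nontrivial zero.
\<close>

definition beta1 :: "nat \<Rightarrow> nat \<Rightarrow> bool" where
  "beta1 u v \<longleftrightarrow> ((bit u 0 \<and> bit v 0) \<noteq> ((bit u 0 \<and> bit v 1) \<noteq> ((bit u 1 \<and> bit v 1) \<noteq> (bit u 2 \<and> bit v 3))))"

definition beta2 :: "nat \<Rightarrow> nat \<Rightarrow> bool" where
  "beta2 u v \<longleftrightarrow> ((bit u 0 \<and> bit v 1) \<noteq> ((bit u 0 \<and> bit v 2) \<noteq> ((bit u 1 \<and> bit v 3) \<noteq>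
     ((bit u 2 \<and> bit v 2) \<noteq> (bit u 3 \<and> bit v 3)))))"

lemma beta_xor_left:
  "beta1 (u XOR u') v \<longleftrightarrow> beta1 u v \<noteq> beta1 u' v" "beta2 (u XOR u') v \<longleftrightarrow> beta2 u v \<noteq> beta2 u' v"
  by (auto simp: beta1_def beta2_def bit_xor_iff)

lemma beta_xor_right:
  "beta1 u (v XOR v') \<longleftrightarrow> beta1 u v \<noteq> beta1 u v'" "beta2 u (v XOR v') \<longleftrightarrow> beta2 u v \<noteq> beta2 u v'"
  by (auto simp: beta1_def beta2_def bit_xor_iff)

lemma beta_zero: "\<not> beta1 0 v" "\<not> beta2 0 v" "\<not> beta1 u 0" "\<not> beta2 u 0"
  by (auto simp: beta1_def beta2_def)

lemma below_16_cases:
  assumes "w < (16::nat)"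
  obtains "w = 0" | "w = 1" | "w = 2" | "w = 3" | "w = 4" | "w = 5" | "w = 6" | "w = 7" | "w = 8" | "w = 9"
    | "w = 10" | "w = 11" | "w = 12" | "w = 13" | "w = 14" | "w = 15"
proof -
  have "w = 0 \<or> w = 1 \<or> w = 2 \<or> w = 3 \<or> w = 4 \<or> w = 5 \<or> w = 6 \<or> w = 7 \<or> w = 8 \<or> w = 9
      \<or> w = 10 \<or> w = 11 \<or> w = 12 \<or> w = 13 \<or> w = 14 \<or> w = 15"
    using assms by presburger
  then show ?thesis using that by argo
qed

text \<open>The square of any group element over \<open>w\<close> is the central element
  \<open>(beta1 w w, beta2 w w)\<close>; so all involutions are central.\<close>

lemma beta_anisotropic:
  assumes "w < 16" "w \<noteq> 0"
  shows "beta1 w w \<or> beta2 w w"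
  using assms(1) by (cases rule: below_16_cases) (use assms(2) in \<open>simp_all add: beta1_def beta2_def bit_iff_odd\<close>)

text \<open>
  A central element \<open>(p, q)\<close> acts on the three circles by \<open>x \<mapsto> \<plusminus>x + 0\<close> or \<open>x \<mapsto> \<plusminus>x + 1/2\<close>: its
  sign on circle \<open>c\<close> is negative iff \<open>sign_bit\<close>, and it shifts by \<open>1/2\<close> iff \<open>shift_bit\<close>.
\<close>

definition sign_bit :: "bool \<times> bool \<Rightarrow> nat \<Rightarrow> bool" where
  "sign_bit s c = (if c = 0 then snd s else if c = 1 then fst s else fst s \<noteq> snd s)"

definition shift_bit :: "bool \<times> bool \<Rightarrow> nat \<Rightarrow> bool" where
  "shift_bit s c = (if c = 0 then fst s else snd s)"

text \<open>The central element through which the group element over \<open>w\<close> acts at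
  coordinate \<open>i\<close>. The forms read only bits 0 to 3, so \<open>i\<close> enters as its
  residue modulo 16 and the block number does not interfere.\<close>

definition twist :: "nat \<Rightarrow> bool \<times> bool \<Rightarrow> nat \<Rightarrow> bool \<times> bool" where
  "twist w s i = (fst s \<noteq> beta1 w i, snd s \<noteq> beta2 w i)"

abbreviation sgn_bit :: "nat \<Rightarrow> bool \<times> bool \<Rightarrow> nat \<Rightarrow> 'a :: ring_1" where
  "sgn_bit w s i \<equiv> (if sign_bit (twist w s i) (i div 16) then - 1 else 1)"

text \<open>The coinduced action: \<open>w\<close> translates F_2^4 inside each block, the twist
  acts on the circle of the block, and \<open>m\<close> selects the lift from the torus to
  R^48.\<close>

definition act :: "nat \<Rightarrow> bool \<times> bool \<Rightarrow> (nat \<Rightarrow> int) \<Rightarrow> (nat \<Rightarrow> real) \<Rightarrow> nat \<Rightarrow> real" where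
  "act w s m x i =
     (if i < 48 then sgn_bit w s i * x (i XOR w) +
        ((if shift_bit (twist w s i) (i div 16) then 1/2 else 0) + of_int (m i)) else x i)"

definition cryst_group :: "((nat \<Rightarrow> real) \<Rightarrow> nat \<Rightarrow> real) set" where
  "cryst_group = {act w s m | w s m. w < 16}"

section \<open>The group law\<close>

lemma xor_block:
  assumes "w < (16::nat)"
  shows "(i XOR w) div 16 = i div 16" "(i XOR w) < 48 \<longleftrightarrow> i < 48"
proof -
  have "drop_bit 4 w = 0" using assms by (simp add: drop_bit_eq_div)
  then have "drop_bit 4 (i XOR w) = drop_bit 4 i" unfolding drop_bit_xor by simp
  then show 1: "(i XOR w) div 16 = i div 16" by (simp add: drop_bit_eq_div)
  have "j < 48 \<longleftrightarrow> j div 16 < 3" for j :: nat by (simp add: div_less_iff_less_mult)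
  then show "(i XOR w) < 48 \<longleftrightarrow> i < 48" using 1 by simp
qed

lemma xor_less_16:
  assumes "u < (16::nat)" "v < 16"
  shows "u XOR v < 16"
proof -
  have "drop_bit 4 u = 0" "drop_bit 4 v = 0" using assms by (simp_all add: drop_bit_eq_div)
  then have "drop_bit 4 (u XOR v) = 0" unfolding drop_bit_xor by simp
  then show ?thesis by (simp add: drop_bit_eq_div div_eq_0_iff)
qed

lemma xor_involution: "(i XOR w) XOR w = (i::nat)"
  by (simp add: xor.assoc)

text \<open>Central component of a product. The arguments of the cocycle are reversed because
  composition evaluates the second twist at \<open>i XOR w\<close>, which by bilinearity contributes
  the form at (w', w).\<close>

definition twist_sum :: "nat \<Rightarrow> bool \<times> bool \<Rightarrow> nat \<Rightarrow> bool \<times> bool \<Rightarrow> bool \<times> bool" where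
  "twist_sum w s w' s' = ((fst s \<noteq> fst s') \<noteq> beta1 w' w, (snd s \<noteq> snd s') \<noteq> beta2 w' w)"

lemma twist_comp:
  "twist (w XOR w') (twist_sum w s w' s') i =
     (fst (twist w s i) \<noteq> fst (twist w' s' (i XOR w)), snd (twist w s i) \<noteq> snd (twist w' s' (i XOR w)))"
  unfolding twist_def twist_sum_def by (auto simp: beta_xor_left beta_xor_right)

lemma sign_bit_add: "sign_bit (fst z \<noteq> fst z', snd z \<noteq> snd z') c \<longleftrightarrow> sign_bit z c \<noteq> sign_bit z' c"
  unfolding sign_bit_def by auto

lemma shift_bit_add: "shift_bit (fst z \<noteq> fst z', snd z \<noteq> snd z') c \<longleftrightarrow> shift_bit z c \<noteq> shift_bit z' c"
  unfolding shift_bit_def by auto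

lemma sgn_bit_comp:
  assumes "w < 16"
  shows "sgn_bit w s i * sgn_bit w' s' (i XOR w) = (sgn_bit (w XOR w') (twist_sum w s w' s') i :: 'a :: ring_1)"
  unfolding twist_comp sign_bit_add xor_block(1)[OF assms] by auto

lemma act_comp:
  assumes "w < 16"
  shows "\<exists>m''. act w s m \<circ> act w' s' m' = act (w XOR w') (twist_sum w s w' s') m''"
proof -
  \<comment> \<open>The last summand is the carry: the half shifts t/2 and \<plusminus>t'/2 add up
    to (t xor t')/2 plus this integer.\<close>
  define m'' where "m'' i = (let e = sign_bit (twist w s i) (i div 16); t = shift_bit (twist w s i) (i div 16);
      t' = shift_bit (twist w' s' (i XOR w)) (i div 16) in
      (if e then - 1 else 1) * m' (i XOR w) + m i +
      (if t \<and> t' then (if e then 0 else 1) else if t' then (if e then - 1 else 0) else 0))" for i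
  have "(act w s m \<circ> act w' s' m') x i = act (w XOR w') (twist_sum w s w' s') m'' x i" for x i
  proof (cases "i < 48")
    case True
    then show ?thesis
      unfolding o_apply act_def twist_comp sign_bit_add shift_bit_add xor_block[OF assms] m''_def Let_def
      by (auto simp: xor.assoc algebra_simps)
  next
    case False
    then show ?thesis by (simp add: act_def)
  qed
  then show ?thesis by (auto simp: fun_eq_iff)
qed

lemma act_zero: "act 0 (False, False) m = (\<lambda>x i. if i < 48 then x i + of_int (m i) else x i)"
  by (auto simp: act_def fun_eq_iff twist_def beta_zero sign_bit_def shift_bit_def)

lemma act_mem: "w < 16 \<Longrightarrow> act w s m \<in> cryst_group"
  unfolding cryst_group_def by blast

lemma cryst_group_comp: "\<gamma> \<in> cryst_group \<Longrightarrow> \<gamma>' \<in> cryst_group \<Longrightarrow> \<gamma> \<circ> \<gamma>' \<in> cryst_group"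
  unfolding cryst_group_def using act_comp xor_less_16 by blast

lemma cryst_group_id: "id \<in> cryst_group"
proof -
  have "id = act 0 (False, False) (\<lambda>_. 0)" unfolding act_zero by (auto simp: fun_eq_iff)
  then show ?thesis by (rule ssubst) (rule act_mem, simp)
qed

lemma cryst_group_right_inverse:
  assumes "\<gamma> \<in> cryst_group"
  shows "\<exists>\<kappa>\<in>cryst_group. \<gamma> \<circ> \<kappa> = id"
proof -
  obtain w s m where w: "w < 16" "\<gamma> = act w s m" using assms unfolding cryst_group_def by blast
  \<comment> \<open>Chosen so that the central part of the product cancels; what remains is an
    integral translation, undone by its negative.\<close>
  let ?s' = "(fst s \<noteq> beta1 w w, snd s \<noteq> beta2 w w)"
  obtain m'' where "\<gamma> \<circ> act w ?s' (\<lambda>_. 0) = act (w XOR w) (twist_sum w s w ?s') m''"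
    using act_comp[OF w(1)] w(2) by blast
  moreover have "twist_sum w s w ?s' = (False, False)" unfolding twist_sum_def by auto
  ultimately have c: "\<gamma> \<circ> act w ?s' (\<lambda>_. 0) = act 0 (False, False) m''" by simp
  have "act 0 (False, False) m'' \<circ> act 0 (False, False) (\<lambda>i. - m'' i) = id"
    unfolding act_zero by (auto simp: fun_eq_iff)
  then have "\<gamma> \<circ> (act w ?s' (\<lambda>_. 0) \<circ> act 0 (False, False) (\<lambda>i. - m'' i)) = id"
    using c by (simp add: o_assoc)
  moreover have "act w ?s' (\<lambda>_. 0) \<circ> act 0 (False, False) (\<lambda>i. - m'' i) \<in> cryst_group"
    using w(1) by (intro cryst_group_comp act_mem) auto
  ultimately show ?thesis by blast
qed

lemma cryst_group_inverse:
  assumes "\<gamma> \<in> cryst_group"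
  shows "\<exists>\<kappa>\<in>cryst_group. \<kappa> \<circ> \<gamma> = id \<and> \<gamma> \<circ> \<kappa> = id"
proof -
  obtain \<kappa> where \<kappa>: "\<kappa> \<in> cryst_group" "\<gamma> \<circ> \<kappa> = id" using cryst_group_right_inverse[OF assms] by blast
  obtain \<mu> where \<mu>: "\<kappa> \<circ> \<mu> = id" using cryst_group_right_inverse[OF \<kappa>(1)] by blast
  have "\<mu> = (\<gamma> \<circ> \<kappa>) \<circ> \<mu>" unfolding \<kappa>(2) by simp
  also have "\<dots> = \<gamma>" unfolding comp_assoc \<mu> by simp
  finally show ?thesis using \<kappa> \<mu> by blast
qed

section \<open>Monomiality, uniform displacement and the translation lattice\<close>

lemma monomial_act:
  assumes "w < 16"
  shows "monomial_map 48 (act w s m)"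
  unfolding monomial_map_def
proof (intro exI conjI)
  show "bij_betw (\<lambda>i. i XOR w) {..<48} {..<48}"
    by (rule bij_betw_byWitness[where f' = "\<lambda>i. i XOR w"]) (auto simp: xor_block[OF assms] xor_involution)
  show "\<forall>i. sgn_bit w s i \<in> {1, - 1 :: real}" by simp
  show "act w s m = (\<lambda>x i. if i < 48 then sgn_bit w s i * x (i XOR w) +
      ((if shift_bit (twist w s i) (i div 16) then 1/2 else 0) + of_int (m i)) else x i)"
    by (simp add: act_def fun_eq_iff)
qed

text \<open>Each nontrivial central element has positive sign on exactly one circle and shifts that
  circle by 1/2, so its displacement there is 1/2 plus an integer, whatever \<open>x\<close>
  is.\<close>

lemma act_zero_displacement:
  assumes "s \<noteq> (False, False)"
  shows "\<exists>i<48. \<bar>act 0 s m x i - x i\<bar> \<ge> 1/2"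
proof -
  obtain c where c: "c < 3" "\<not> sign_bit s c" "shift_bit s c"
  proof (cases s)
    case (Pair p q)
    then show ?thesis using assms that[of 0] that[of 1] that[of 2]
      by (cases p; cases q) (auto simp: sign_bit_def shift_bit_def)
  qed
  have "twist 0 s i = s" for i by (simp add: twist_def beta_zero)
  then have "act 0 s m x (16 * c) - x (16 * c) = 1/2 + of_int (m (16 * c))"
    using c by (simp add: act_def)
  moreover have "\<bar>1/2 + of_int k\<bar> \<ge> (1/2 :: real)" for k :: int
  proof (cases "k \<ge> 0")
    case False
    then have "real_of_int k \<le> - 1" by linarith
    then show ?thesis by linarith
  qed simp
  ultimately show ?thesis using c(1) by (intro exI[of _ "16 * c"]) auto
qed

text \<open>Origin of the constant 1/4: if w is nonzero, the square of \<gamma> is a nontrivial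
  central element up to translation and moves some coordinate by at least 1/2, so one of the two
  steps moves it by at least 1/4.\<close>

lemma cryst_group_displacement:
  assumes "\<gamma> \<in> cryst_group" "\<gamma> \<noteq> id"
  shows "\<exists>i<48. \<bar>\<gamma> x i - x i\<bar> \<ge> 1/4"
proof -
  obtain w s m where w: "w < 16" "\<gamma> = act w s m" using assms unfolding cryst_group_def by blast
  consider "w \<noteq> 0" | "w = 0" "s \<noteq> (False, False)" | "w = 0" "s = (False, False)" by blast
  then show ?thesis
  proof cases
    case 1
    obtain m'' where m: "\<gamma> \<circ> \<gamma> = act (w XOR w) (twist_sum w s w s) m''" using act_comp[OF w(1)] w(2) by blast
    have "twist_sum w s w s \<noteq> (False, False)"
      using beta_anisotropic[OF w(1) 1] unfolding twist_sum_def by auto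
    from act_zero_displacement[OF this, of m'' x]
    obtain i where i: "i < 48" "\<bar>(\<gamma> \<circ> \<gamma>) x i - x i\<bar> \<ge> 1/2" unfolding m by auto
    have iw: "i XOR w < 48" using xor_block(2)[OF w(1)] i(1) by simp
    \<comment> \<open>The second step at coordinate i is, up to sign, the first step at coordinate
      \<open>i XOR w\<close>, so both cases bound the displacement of \<open>x\<close>
      itself.\<close>
    have e: "(\<gamma> \<circ> \<gamma>) x i - \<gamma> x i = sgn_bit w s i * (\<gamma> x (i XOR w) - x (i XOR w))"
      using i(1) unfolding o_apply w(2) act_def[of w s m _ i] by (simp add: algebra_simps)
    then have "\<bar>(\<gamma> \<circ> \<gamma>) x i - \<gamma> x i\<bar> = \<bar>\<gamma> x (i XOR w) - x (i XOR w)\<bar>"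
      unfolding e by (simp add: abs_minus_commute)
    then have "\<bar>\<gamma> x (i XOR w) - x (i XOR w)\<bar> \<ge> 1/4 \<or> \<bar>\<gamma> x i - x i\<bar> \<ge> 1/4" using i(2) by linarith
    then show ?thesis using i(1) iw by blast
  next
    case 2
    then show ?thesis using order_trans[of "1/4" "1/2 :: real"] act_zero_displacement[OF 2(2), of m x] unfolding w(2) 2(1) by (elim exE) auto
  next
    case 3
    then have g: "\<gamma> = (\<lambda>x i. if i < 48 then x i + of_int (m i) else x i)" using w(2) act_zero by simp
    have "\<exists>i<48. m i \<noteq> 0"
    proof (rule ccontr)
      assume "\<not> (\<exists>i<48. m i \<noteq> 0)"
      then have "\<gamma> = id" unfolding g by (auto simp: fun_eq_iff)
      then show False using assms(2) by simp
    qed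
    then obtain i where i: "i < 48" "m i \<noteq> 0" by blast
    have "\<bar>\<gamma> x i - x i\<bar> = \<bar>real_of_int (m i)\<bar>" using i g by simp
    moreover have "1 \<le> \<bar>real_of_int (m i)\<bar>" using i(2) by (simp flip: of_int_abs)
    ultimately show ?thesis using i(1) by (intro exI[of _ i]) simp
  qed
qed

text \<open>The linear action of the finite group is faithful: the indicator of coordinate 0 detects
  a nonzero w, the constant vector 1 detects signs, and the signs on circles 0 and 1 determine
  \<open>s\<close>. Trivial \<open>s\<close> means no half shift.\<close>

lemma cryst_group_translation:
  assumes "(\<lambda>x i. if i < 48 then x i + b i else x i) \<in> cryst_group" "i < 48"
  shows "b i \<in> \<int>"
proof -
  obtain w s m where w: "w < 16" "(\<lambda>x i. if i < 48 then x i + b i else x i) = act w s m"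
    using assms unfolding cryst_group_def by blast
  have e: "x j + b j = sgn_bit w s j * x (j XOR w) +
     ((if shift_bit (twist w s j) (j div 16) then 1/2 else 0) + of_int (m j))" if "j < 48" for x :: "nat \<Rightarrow> real" and j
    using fun_cong[OF fun_cong[OF w(2), of x], of j] that by (simp add: act_def)
  have lin: "x j = sgn_bit w s j * x (j XOR w)" if "j < 48" for x :: "nat \<Rightarrow> real" and j
    using e[OF that, of x] e[OF that, of "\<lambda>_. 0"] by simp
  have "0 XOR w = 0"
  proof (rule ccontr)
    assume "0 XOR w \<noteq> 0"
    then show False using lin[of 0 "\<lambda>k. if k = 0 then 1 else 0"] by simp
  qed
  then have w0: "w = 0" by simp
  have "\<not> sign_bit s c" if "c < 3" for c
    using lin[of "16 * c" "\<lambda>_. 1"] that by (auto simp: w0 twist_def beta_zero split: if_splits)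
  from this[of 0] this[of 1] have "s = (False, False)" by (cases s) (auto simp: sign_bit_def)
  then show ?thesis
    using e[OF assms(2), of "\<lambda>_. 0"] by (simp add: w0 twist_def beta_zero shift_bit_def)
qed

interpretation cryst: free_crystallographic_action 48 cryst_group "1/4"
proof
  show "id \<in> cryst_group" by (rule cryst_group_id)
  show "monomial_map 48 \<gamma>" if "\<gamma> \<in> cryst_group" for \<gamma>
    using that monomial_act unfolding cryst_group_def by blast
  show "(\<lambda>x i. if i < 48 then x i + real_of_int (m i) else x i) \<in> cryst_group" for m
    unfolding act_zero[symmetric] by (rule act_mem) simp
qed (use cryst_group_comp cryst_group_inverse cryst_group_displacement cryst_group_translation in auto)

lemma linear_part_act:
  assumes "w < 16" "i < 48" "z \<in> carrier_vec 48"
  shows "(cryst.linear_part (act w s m) *\<^sub>v z) $ i = sgn_bit w s i * z $ (i XOR w)"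
proof (rule cryst.linear_part_mult)
  show "bij_betw (\<lambda>i. i XOR w) {..<48} {..<48}"
    by (rule bij_betw_byWitness[where f' = "\<lambda>i. i XOR w"]) (auto simp: xor_block[OF assms(1)] xor_involution)
  show "act w s m = (\<lambda>x i. if i < 48 then real_of_int (sgn_bit w s i) * x (i XOR w) +
      ((if shift_bit (twist w s i) (i div 16) then 1/2 else 0) + of_int (m i)) else x i)"
    by (auto simp: act_def fun_eq_iff)
qed (use assms in auto)

section \<open>Recognising quaternionic type\<close>

fun quat_conj :: "quaternion \<Rightarrow> quaternion" where
  "quat_conj (a, b, c, d) = (a, - b, - c, - d)"

lemma quat_conj_conj: "quat_conj (quat_conj p) = p"
  by (cases p) simp

lemma quat_conj_add: "quat_conj (p + q) = quat_conj p + quat_conj q"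
  by (cases p, cases q) simp

lemma quat_conj_scale: "quat_conj (r *\<^sub>R p) = r *\<^sub>R quat_conj p"
  by (cases p) simp

lemma quat_conj_mult: "quat_conj (quat_mult p q) = quat_mult (quat_conj q) (quat_conj p)"
  by (cases p, cases q) (simp add: algebra_simps)

lemma quat_mult_assoc: "quat_mult (quat_mult p q) r = quat_mult p (quat_mult q r)"
  by (cases p, cases q, cases r) (simp add: algebra_simps)

lemma quat_mult_add_left: "quat_mult (p + q) r = quat_mult p r + quat_mult q r"
  by (cases p, cases q, cases r) (simp add: algebra_simps)

lemma quat_mult_add_right: "quat_mult p (q + r) = quat_mult p q + quat_mult p r"
  by (cases p, cases q, cases r) (simp add: algebra_simps)

lemma quat_mult_scale_left: "quat_mult (s *\<^sub>R p) q = s *\<^sub>R quat_mult p q"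
  by (cases p, cases q) (simp add: algebra_simps)

lemma quat_mult_scale_right: "quat_mult p (s *\<^sub>R q) = s *\<^sub>R quat_mult p q"
  by (cases p, cases q) (simp add: algebra_simps)

lemma quat_mult_one: "quat_mult p (1, 0, 0, 0) = p" "quat_mult (1, 0, 0, 0) p = p"
  by (cases p, simp)+

lemma quat_mult_zero: "quat_mult p 0 = 0" "quat_mult 0 p = 0"
  by (cases p, simp add: zero_prod_def)+

abbreviation "quat_i \<equiv> (0, 1, 0, 0) :: quaternion"
abbreviation "quat_j \<equiv> (0, 0, 1, 0) :: quaternion"

text \<open>The commutant of H \<otimes> M_2(R) on H^2. Commuting with diag(1, -1) keeps F (1, 0) in
  the first factor, left H-linearity makes \<open>F\<close> a right multiplication there, and the
  swap copies it to the second factor.\<close>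

lemma right_multiplication_of_commuting:
  fixes F :: "quaternion \<times> quaternion \<Rightarrow> quaternion \<times> quaternion"
  assumes add: "\<And>p q. F (p + q) = F p + F q" and scale: "\<And>r p. F (r *\<^sub>R p) = r *\<^sub>R F p"
    and I: "\<And>h h'. F (quat_mult quat_i h, quat_mult quat_i h') = map_prod (quat_mult quat_i) (quat_mult quat_i) (F (h, h'))"
    and J: "\<And>h h'. F (quat_mult quat_j h, quat_mult quat_j h') = map_prod (quat_mult quat_j) (quat_mult quat_j) (F (h, h'))"
    and A: "\<And>h h'. F (h, - h') = map_prod id uminus (F (h, h'))"
    and C: "\<And>h h'. F (h', h) = prod.swap (F (h, h'))"
  obtains q where "\<And>h h'. F (h, h') = (quat_mult h q, quat_mult h' q)"
proof -
  define one :: quaternion where "one = (1, 0, 0, 0)"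
  obtain q q' where q: "F (one, 0) = (q, q')" by (rule prod.exhaust)
  have "F (one, 0) = map_prod id uminus (F (one, 0))" using A[of one 0] by simp
  then have "q' = - q'" using q by simp
  then have q'0: "q' = 0" by (cases q') (simp add: zero_prod_def)
  have 1: "F (one, 0) = (q, 0)" using q q'0 by simp
  have i: "F (quat_i, 0) = (quat_mult quat_i q, 0)"
    using I[of one 0] 1 by (simp add: quat_mult_zero one_def zero_prod_def)
  have j: "F (quat_j, 0) = (quat_mult quat_j q, 0)"
    using J[of one 0] 1 by (simp add: quat_mult_zero one_def zero_prod_def)
  \<comment> \<open>The third imaginary unit is the product i j, so its image follows from
    \<open>I\<close> and \<open>J\<close>.\<close>
  have k: "F (quat_mult quat_i quat_j, 0) = (quat_mult quat_i (quat_mult quat_j q), 0)"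
    using I[of quat_j 0] j unfolding quat_mult_zero by (simp add: quat_mult_zero del: quat_mult.simps)
  have main: "F (h, 0) = (quat_mult h q, 0)" for h
  proof -
    obtain a b c d where h: "h = (a, b, c, d)" by (cases h)
    have "(h, 0) = a *\<^sub>R (one, 0) + (b *\<^sub>R (quat_i, 0) + (c *\<^sub>R (quat_j, 0) + d *\<^sub>R (quat_mult quat_i quat_j, 0 :: quaternion)))"
      unfolding h one_def by (simp add: zero_prod_def)
    then have "F (h, 0) = a *\<^sub>R (q, 0) + (b *\<^sub>R (quat_mult quat_i q, 0) + (c *\<^sub>R (quat_mult quat_j q, 0)
        + d *\<^sub>R (quat_mult quat_i (quat_mult quat_j q), 0)))"
      unfolding add scale 1 i j k by (simp only: add scale 1 i j k)
    also have "\<dots> = (quat_mult h q, 0)"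
      unfolding h by (cases q) (simp add: zero_prod_def algebra_simps)
    finally show ?thesis .
  qed
  have "F (h, h') = (quat_mult h q, quat_mult h' q)" for h h'
  proof -
    have "F (h, h') = F (h, 0) + F (0, h')" using add[of "(h, 0)" "(0, h')"] by simp
    also have "F (0, h') = prod.swap (F (h', 0))" by (rule C)
    finally show ?thesis unfolding main by simp
  qed
  then show ?thesis by (rule that)
qed

definition right_mult :: "quaternion \<Rightarrow> quaternion \<times> quaternion \<Rightarrow> quaternion \<times> quaternion" where
  "right_mult q = map_prod (\<lambda>h. quat_mult h q) (\<lambda>h. quat_mult h q)"

text \<open>Conjugation turns right multiplication, which reverses products, into a homomorphism.\<close>

lemma quaternionic_type_of_coordinates:
  fixes \<psi> :: "quaternion \<times> quaternion \<Rightarrow> real vec"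
  assumes bij: "bij_betw \<psi> UNIV V"
    and add: "\<And>p q. \<psi> (p + q) = \<psi> p + \<psi> q" and scale: "\<And>r p. \<psi> (r *\<^sub>R p) = r \<cdot>\<^sub>v \<psi> p"
    and I: "\<And>h h'. I (\<psi> (h, h')) = \<psi> (quat_mult quat_i h, quat_mult quat_i h')"
    and J: "\<And>h h'. J (\<psi> (h, h')) = \<psi> (quat_mult quat_j h, quat_mult quat_j h')"
    and A: "\<And>h h'. A (\<psi> (h, h')) = \<psi> (h, - h')"
    and C: "\<And>h h'. C (\<psi> (h, h')) = \<psi> (h', h)"
    and gens: "\<And>f. f \<in> V \<rightarrow> V \<Longrightarrow> (\<And>x y. x \<in> V \<Longrightarrow> y \<in> V \<Longrightarrow> f (x + y) = f x + f y) \<Longrightarrow>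
        (\<And>c x. x \<in> V \<Longrightarrow> f (c \<cdot>\<^sub>v x) = c \<cdot>\<^sub>v f x) \<Longrightarrow>
        (\<forall>a\<in>carrier G. \<forall>x\<in>V. f (\<rho> a *\<^sub>v x) = \<rho> a *\<^sub>v f x) \<longleftrightarrow>
        (\<forall>x\<in>V. f (I x) = I (f x) \<and> f (J x) = J (f x) \<and> f (A x) = A (f x) \<and> f (C x) = C (f x))"
  shows "quaternionic_type G \<rho> V"
proof -
  define k where "k = inv_into UNIV \<psi>"
  have inj: "inj \<psi>" and im: "\<psi> ` UNIV = V" using bij unfolding bij_betw_def by auto
  have k\<psi>: "k (\<psi> p) = p" for p unfolding k_def using inj by simp
  have \<psi>k: "\<psi> (k x) = x" if "x \<in> V" for x using that im k\<psi> by auto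
  have \<psi>V: "\<psi> p \<in> V" for p using im by blast
  define \<Phi> where "\<Phi> p = (\<lambda>x\<in>V. \<psi> (right_mult (quat_conj p) (k x)))" for p
  have \<Phi>\<psi>: "\<Phi> p (\<psi> u) = \<psi> (right_mult (quat_conj p) u)" for p u
    unfolding \<Phi>_def using \<psi>V k\<psi> by simp
  have rm_add: "right_mult q (u + v) = right_mult q u + right_mult q v" for q u v
    by (cases u rule: prod.exhaust, cases v rule: prod.exhaust) (simp add: right_mult_def quat_mult_add_left)
  have rm_scale: "right_mult q (r *\<^sub>R u) = r *\<^sub>R right_mult q u" for q r u
    by (cases u rule: prod.exhaust) (simp add: right_mult_def quat_mult_scale_left)
  have allV: "(\<forall>x\<in>V. R x) \<longleftrightarrow> (\<forall>u. R (\<psi> u))" for R unfolding im[symmetric] by blast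
  have \<Phi>_end: "\<Phi> p \<in> rep_endomorphisms G \<rho> V" for p
  proof -
    have PiE: "\<Phi> p \<in> V \<rightarrow>\<^sub>E V" unfolding \<Phi>_def using \<psi>V by simp
    then have fnV: "\<Phi> p \<in> V \<rightarrow> V" by blast
    have a: "\<Phi> p (x + y) = \<Phi> p x + \<Phi> p y" if xy: "x \<in> V" "y \<in> V" for x y
    proof -
      obtain u v where "x = \<psi> u" "y = \<psi> v" using xy im by blast
      then show ?thesis by (simp add: add[symmetric] \<Phi>\<psi> rm_add)
    qed
    have s: "\<Phi> p (c \<cdot>\<^sub>v x) = c \<cdot>\<^sub>v \<Phi> p x" if x: "x \<in> V" for c x
    proof -
      obtain u where "x = \<psi> u" using x im by blast
      then show ?thesis by (simp add: scale[symmetric] \<Phi>\<psi> rm_scale)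
    qed
    have neg: "quat_mult (- h) q = - quat_mult h q" for h q
      using quat_mult_scale_left[of "-1" h q] by simp
    have "\<forall>x\<in>V. \<Phi> p (I x) = I (\<Phi> p x) \<and> \<Phi> p (J x) = J (\<Phi> p x) \<and> \<Phi> p (A x) = A (\<Phi> p x) \<and> \<Phi> p (C x) = C (\<Phi> p x)"
      unfolding allV by (simp add: split_paired_All I J A C \<Phi>\<psi> right_mult_def quat_mult_assoc neg del: quat_mult.simps)
    then have "\<forall>a\<in>carrier G. \<forall>x\<in>V. \<Phi> p (\<rho> a *\<^sub>v x) = \<rho> a *\<^sub>v \<Phi> p x"
      using gens[OF fnV a s] by blast
    then show ?thesis unfolding rep_endomorphisms_def using PiE a s by blast
  qed
  have \<Phi>_surj: "\<exists>p. f = \<Phi> p" if f: "f \<in> rep_endomorphisms G \<rho> V" for f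
  proof -
    have PiE: "f \<in> V \<rightarrow>\<^sub>E V" and a: "\<And>x y. x \<in> V \<Longrightarrow> y \<in> V \<Longrightarrow> f (x + y) = f x + f y"
      and s: "\<And>c x. x \<in> V \<Longrightarrow> f (c \<cdot>\<^sub>v x) = c \<cdot>\<^sub>v f x"
      and e: "\<forall>a\<in>carrier G. \<forall>x\<in>V. f (\<rho> a *\<^sub>v x) = \<rho> a *\<^sub>v f x"
      using f unfolding rep_endomorphisms_def by auto
    have fV: "f x \<in> V" if "x \<in> V" for x using PiE that by blast
    then have "f \<in> V \<rightarrow> V" by blast
    from gens[OF this a s] e
    have c: "\<And>x. x \<in> V \<Longrightarrow> f (I x) = I (f x)" "\<And>x. x \<in> V \<Longrightarrow> f (J x) = J (f x)"
      "\<And>x. x \<in> V \<Longrightarrow> f (A x) = A (f x)" "\<And>x. x \<in> V \<Longrightarrow> f (C x) = C (f x)" by blast+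
    define F where "F u = k (f (\<psi> u))" for u
    have \<psi>F: "\<psi> (F u) = f (\<psi> u)" for u unfolding F_def using \<psi>k fV \<psi>V by blast
    have Feq: "F u = v" if "f (\<psi> u) = \<psi> v" for u v unfolding F_def that by (rule k\<psi>)
    have "F (p + q) = F p + F q" for p q
      by (rule Feq) (simp add: add a \<psi>V \<psi>F)
    moreover have "F (r *\<^sub>R p) = r *\<^sub>R F p" for r p
      by (rule Feq) (simp add: scale s \<psi>V \<psi>F)
    moreover have "F (quat_mult quat_i h, quat_mult quat_i h') = map_prod (quat_mult quat_i) (quat_mult quat_i) (F (h, h'))" for h h'
      by (rule Feq) (metis I c(1) \<psi>V \<psi>F map_prod_simp surj_pair)
    moreover have "F (quat_mult quat_j h, quat_mult quat_j h') = map_prod (quat_mult quat_j) (quat_mult quat_j) (F (h, h'))" for h h'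
      by (rule Feq) (metis J c(2) \<psi>V \<psi>F map_prod_simp surj_pair)
    moreover have "F (h, - h') = map_prod id uminus (F (h, h'))" for h h'
      by (rule Feq) (metis A c(3) \<psi>V \<psi>F map_prod_simp id_apply surj_pair)
    moreover have "F (h', h) = prod.swap (F (h, h'))" for h h'
      by (rule Feq) (metis C c(4) \<psi>V \<psi>F swap_simp surj_pair)
    ultimately obtain q where q: "\<And>h h'. F (h, h') = (quat_mult h q, quat_mult h' q)"
      by (rule right_multiplication_of_commuting) blast
    have "f (\<psi> u) = \<Phi> (quat_conj q) (\<psi> u)" for u
      unfolding \<psi>F[symmetric] \<Phi>\<psi> quat_conj_conj by (cases u rule: prod.exhaust) (simp add: q right_mult_def)
    then have "f x = \<Phi> (quat_conj q) x" if "x \<in> V" for x using that im by blast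
    moreover have "f x = \<Phi> (quat_conj q) x" if "x \<notin> V" for x
      using that PiE_arb[OF PiE that] by (simp add: \<Phi>_def)
    ultimately have "f = \<Phi> (quat_conj q)" by (intro HOL.ext) metis
    then show ?thesis by blast
  qed
  have \<Phi>_inj: "inj \<Phi>"
  proof (rule injI)
    fix p q assume "\<Phi> p = \<Phi> q"
    then have "\<psi> (right_mult (quat_conj p) ((1, 0, 0, 0), 0)) = \<psi> (right_mult (quat_conj q) ((1, 0, 0, 0), 0))"
      unfolding \<Phi>\<psi>[symmetric] by simp
    then have "quat_conj p = quat_conj q"
      using injD[OF inj] unfolding right_mult_def by (fastforce simp: quat_mult_one simp del: quat_mult.simps)
    then show "p = q" using quat_conj_conj by metis
  qed
  have V_ext: "u = (\<lambda>x\<in>V. v x)" if "u \<in> extensional V" "\<And>h h'. u (\<psi> (h, h')) = v (\<psi> (h, h'))" for u v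
  proof (rule HOL.ext)
    fix x show "u x = (\<lambda>x\<in>V. v x) x"
    proof (cases "x \<in> V")
      case True
      then obtain w where "x = \<psi> w" using im by blast
      then show ?thesis using True that(2) by (cases w rule: prod.exhaust) simp
    next
      case False
      then show ?thesis using extensional_arb[OF that(1)] by simp
    qed
  qed
  have \<Phi>e: "\<Phi> p \<in> extensional V" for p unfolding \<Phi>_def by simp
  have A1: "bij_betw \<Phi> UNIV (rep_endomorphisms G \<rho> V)"
    unfolding bij_betw_def using \<Phi>_inj \<Phi>_end \<Phi>_surj by blast
  have A2: "\<Phi> (p + q) = (\<lambda>x\<in>V. \<Phi> p x + \<Phi> q x)" for p q
    by (rule V_ext[OF \<Phi>e]) (simp_all add: \<Phi>\<psi> add[symmetric] right_mult_def quat_conj_add quat_mult_add_right)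
  have A3: "\<Phi> (r *\<^sub>R p) = (\<lambda>x\<in>V. r \<cdot>\<^sub>v \<Phi> p x)" for r p
    by (rule V_ext[OF \<Phi>e]) (simp_all add: \<Phi>\<psi> scale[symmetric] right_mult_def quat_conj_scale quat_mult_scale_right)
  have A4: "\<Phi> (quat_mult p q) = compose V (\<Phi> p) (\<Phi> q)" for p q
    unfolding compose_def
    by (rule V_ext[OF \<Phi>e]) (simp_all add: \<Phi>\<psi> right_mult_def quat_conj_mult quat_mult_assoc)
  have A5: "\<Phi> (1, 0, 0, 0) = (\<lambda>x\<in>V. x)"
    by (rule V_ext[OF \<Phi>e]) (simp_all add: \<Phi>\<psi> right_mult_def quat_mult_one)
  show ?thesis
    unfolding quaternionic_type_def using A1 A2 A3 A4 A5 by blast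
qed

text \<open>
  For a nonzero vector \<open>x\<close> fixed by \<open>A\<close>, the map \<open>(h, h') \<mapsto> h x + C (h' x)\<close> is an isomorphism from
  two copies of the quaternions onto \<open>V\<close>, with \<open>i\<close> and \<open>j\<close> acting on \<open>V\<close> as \<open>I\<close> and \<open>J\<close>.
\<close>

lemma quaternionic_type_of_relations:
  fixes I J A C :: "real vec \<Rightarrow> real vec"
  assumes irr: "irreducible_rep_submodule G n \<rho> V"
    and closed: "\<And>T x. T \<in> {I, J, A, C} \<Longrightarrow> x \<in> V \<Longrightarrow> T x \<in> V"
    and lin_add: "\<And>T x y. T \<in> {I, J, A, C} \<Longrightarrow> x \<in> V \<Longrightarrow> y \<in> V \<Longrightarrow> T (x + y) = T x + T y"
    and lin_scale: "\<And>T x c. T \<in> {I, J, A, C} \<Longrightarrow> x \<in> V \<Longrightarrow> T (c \<cdot>\<^sub>v x) = c \<cdot>\<^sub>v T x"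
    and II: "\<And>x. x \<in> V \<Longrightarrow> I (I x) = (- 1) \<cdot>\<^sub>v x" and JJ: "\<And>x. x \<in> V \<Longrightarrow> J (J x) = (- 1) \<cdot>\<^sub>v x"
    and JI: "\<And>x. x \<in> V \<Longrightarrow> J (I x) = (- 1) \<cdot>\<^sub>v I (J x)"
    and AA: "\<And>x. x \<in> V \<Longrightarrow> A (A x) = x" and CC: "\<And>x. x \<in> V \<Longrightarrow> C (C x) = x"
    and AC: "\<And>x. x \<in> V \<Longrightarrow> A (C x) = (- 1) \<cdot>\<^sub>v C (A x)"
    and AI: "\<And>x. x \<in> V \<Longrightarrow> A (I x) = I (A x)" and AJ: "\<And>x. x \<in> V \<Longrightarrow> A (J x) = J (A x)"
    and CI: "\<And>x. x \<in> V \<Longrightarrow> C (I x) = I (C x)" and CJ: "\<And>x. x \<in> V \<Longrightarrow> C (J x) = J (C x)"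
    and sub: "\<And>W. W \<subseteq> V \<Longrightarrow> 0\<^sub>v n \<in> W \<Longrightarrow> (\<And>x y. x \<in> W \<Longrightarrow> y \<in> W \<Longrightarrow> x + y \<in> W) \<Longrightarrow>
        (\<And>c x. x \<in> W \<Longrightarrow> c \<cdot>\<^sub>v x \<in> W) \<Longrightarrow> (\<And>T x. T \<in> {I, J, A, C} \<Longrightarrow> x \<in> W \<Longrightarrow> T x \<in> W) \<Longrightarrow>
        rep_submodule G n \<rho> W"
    and gens: "\<And>f. f \<in> V \<rightarrow> V \<Longrightarrow> (\<And>x y. x \<in> V \<Longrightarrow> y \<in> V \<Longrightarrow> f (x + y) = f x + f y) \<Longrightarrow>
        (\<And>c x. x \<in> V \<Longrightarrow> f (c \<cdot>\<^sub>v x) = c \<cdot>\<^sub>v f x) \<Longrightarrow>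
        (\<forall>a\<in>carrier G. \<forall>x\<in>V. f (\<rho> a *\<^sub>v x) = \<rho> a *\<^sub>v f x) \<longleftrightarrow>
        (\<forall>x\<in>V. f (I x) = I (f x) \<and> f (J x) = J (f x) \<and> f (A x) = A (f x) \<and> f (C x) = C (f x))"
  shows "quaternionic_type G \<rho> V"
proof -
  have V: "V \<subseteq> carrier_vec n" "0\<^sub>v n \<in> V" "\<And>x y. x \<in> V \<Longrightarrow> y \<in> V \<Longrightarrow> x + y \<in> V"
    "\<And>c x. x \<in> V \<Longrightarrow> c \<cdot>\<^sub>v x \<in> V" "V \<noteq> {0\<^sub>v n}"
    and min: "\<And>W. rep_submodule G n \<rho> W \<Longrightarrow> W \<subseteq> V \<Longrightarrow> W = {0\<^sub>v n} \<or> W = V"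
    using irr unfolding irreducible_rep_submodule_def rep_submodule_def by auto
  have dimV: "dim_vec x = n" if "x \<in> V" for x using that V(1) by auto
  have car: "x \<in> carrier_vec n" if "x \<in> V" for x using that V(1) by auto
  have veqI: "x = y" if "x \<in> V" "y \<in> V" "\<And>t. t < n \<Longrightarrow> x $ t = y $ t" for x y
    using that dimV by (intro eq_vecI) auto
  have smz: "0 \<cdot>\<^sub>v y = 0\<^sub>v n" if "y \<in> V" for y
    by (rule eq_vecI) (use dimV[OF that] in auto)
  note cl = closed[of I, simplified] closed[of J, simplified] closed[of A, simplified] closed[of C, simplified]
  note la = lin_add[of I, simplified] lin_add[of J, simplified] lin_add[of A, simplified] lin_add[of C, simplified]
  note ls = lin_scale[of I, simplified] lin_scale[of J, simplified] lin_scale[of A, simplified] lin_scale[of C, simplified]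
  \<comment> \<open>The eigenvalue 1 of \<open>A\<close> does occur: either x0 + A x0 is nonzero, or
    A x0 = -x0 and then \<open>C\<close>, which anticommutes with \<open>A\<close>, carries x0 to
    such an eigenvector.\<close>
  obtain x where x: "x \<in> V" "x \<noteq> 0\<^sub>v n" "A x = x"
  proof -
    obtain x0 where x0: "x0 \<in> V" "x0 \<noteq> 0\<^sub>v n" using V(2,5) by blast
    show thesis
    proof (cases "x0 + A x0 = 0\<^sub>v n")
      case False
      have "A (x0 + A x0) = A x0 + x0" using x0 la cl AA by simp
      also have "\<dots> = x0 + A x0" using comm_add_vec[OF car car] cl x0 by blast
      finally show thesis using that[of "x0 + A x0"] False x0 cl V(3) by blast
    next
      case True
      have Ax0: "A x0 = (- 1) \<cdot>\<^sub>v x0"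
      proof (rule veqI)
        fix t assume t: "t < n"
        have "(x0 + A x0) $ t = 0" using True t by simp
        then show "A x0 $ t = ((- 1) \<cdot>\<^sub>v x0) $ t" using t dimV x0 cl by simp
      qed (use x0 cl V(4) in auto)
      have "A (C x0) = C x0"
      proof (rule veqI)
        fix t assume t: "t < n"
        show "A (C x0) $ t = C x0 $ t" unfolding AC[OF x0(1)] Ax0 ls(4)[OF x0(1)] using t dimV x0 cl by simp
      qed (use x0 cl in auto)
      moreover have "C x0 \<noteq> 0\<^sub>v n"
      proof
        assume 0: "C x0 = 0\<^sub>v n"
        have "x0 = C (C x0)" using CC[OF x0(1)] by simp
        also have "\<dots> = C (0 \<cdot>\<^sub>v x0)" unfolding 0 smz[OF x0(1)] ..
        also have "\<dots> = 0\<^sub>v n" unfolding ls(4)[OF x0(1)] by (rule smz[OF cl(4)[OF x0(1)]])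
        finally show False using x0 by simp
      qed
      ultimately show thesis using that[of "C x0"] x0 cl by blast
    qed
  qed
  define Q where "Q h = (case h of (a, b, c, d) \<Rightarrow> a \<cdot>\<^sub>v x + (b \<cdot>\<^sub>v I x + (c \<cdot>\<^sub>v J x + d \<cdot>\<^sub>v I (J x))))" for h :: quaternion
  have QV: "Q h \<in> V" for h unfolding Q_def using x cl V by (cases h) auto
  have Qt: "Q (a, b, c, d) $ t = a * x $ t + (b * I x $ t + (c * J x $ t + d * I (J x) $ t))" if "t < n" for a b c d t
    unfolding Q_def using that dimV[OF x(1)] dimV[OF cl(1)[OF x(1)]] dimV[OF cl(2)[OF x(1)]]
      dimV[OF cl(1)[OF cl(2)[OF x(1)]]] by simp
  have TQ: "T (Q (a, b, c, d)) $ t = a * T x $ t + (b * T (I x) $ t + (c * T (J x) $ t + d * T (I (J x)) $ t))"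
    if T: "T \<in> {I, J, A, C}" and t: "t < n" for T a b c d t
  proof -
    note cT = closed[OF T]
    have "T (Q (a, b, c, d)) = a \<cdot>\<^sub>v T x + (b \<cdot>\<^sub>v T (I x) + (c \<cdot>\<^sub>v T (J x) + d \<cdot>\<^sub>v T (I (J x))))"
      unfolding Q_def by (simp add: lin_add[OF T] lin_scale[OF T] V(3,4) cl x(1))
    then show ?thesis
      using t dimV[OF cT[OF x(1)]] dimV[OF cT[OF cl(1)[OF x(1)]]] dimV[OF cT[OF cl(2)[OF x(1)]]]
        dimV[OF cT[OF cl(1)[OF cl(2)[OF x(1)]]]] by simp
  qed
  have dims: "dim_vec x = n" "dim_vec (I x) = n" "dim_vec (J x) = n" "dim_vec (I (J x)) = n"
    using dimV x cl by auto
  have JIJ: "J (I (J x)) = I x"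
    by (rule veqI) (simp_all add: JI JJ ls cl x(1) dims V(4))
  have IQ: "I (Q h) = Q (quat_mult quat_i h)" for h
  proof (rule veqI)
    fix t assume "t < n"
    then show "I (Q h) $ t = Q (quat_mult quat_i h) $ t"
      by (cases h) (simp add: TQ Qt II cl x(1) dims)
  qed (use QV cl in auto)
  have JQ: "J (Q h) = Q (quat_mult quat_j h)" for h
  proof (rule veqI)
    fix t assume "t < n"
    then show "J (Q h) $ t = Q (quat_mult quat_j h) $ t"
      by (cases h) (simp add: TQ Qt JI JJ JIJ cl x(1) dims)
  qed (use QV cl in auto)
  have AQ: "A (Q h) = Q h" for h
  proof (rule veqI)
    fix t assume "t < n"
    then show "A (Q h) $ t = Q h $ t"
      by (cases h) (simp add: TQ Qt AI AJ x cl)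
  qed (use QV cl in auto)
  have Q_add: "Q (h + k) = Q h + Q k" for h k
  proof (rule veqI)
    fix t assume "t < n"
    then show "Q (h + k) $ t = (Q h + Q k) $ t"
      by (cases h, cases k) (simp add: Qt dimV[OF QV] algebra_simps)
  qed (use QV V in auto)
  have Q_scale: "Q (r *\<^sub>R h) = r \<cdot>\<^sub>v Q h" for h r
  proof (rule veqI)
    fix t assume "t < n"
    then show "Q (r *\<^sub>R h) $ t = (r \<cdot>\<^sub>v Q h) $ t"
      by (cases h) (simp add: Qt dimV[OF QV] algebra_simps)
  qed (use QV V in auto)
  have Q_zero: "h = 0" if Q0: "\<And>t. t < n \<Longrightarrow> Q h $ t = 0" for h
  proof -
    obtain a b c d where h: "h = (a, b, c, d)" by (cases h)
    \<comment> \<open>Writing the zero vector as \<open>0 \<cdot>\<^sub>v x\<close> makes the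
      homogeneity of the operators applicable.\<close>
    have Qh: "Q h = 0 \<cdot>\<^sub>v x" by (rule veqI) (use QV V(4) x(1) Q0 dims in auto)
    have T0: "T (0 \<cdot>\<^sub>v x) $ t = 0" if "T \<in> {I, J}" "t < n" for T t
      using that lin_scale[of T x 0] x(1) dims by auto
    obtain t where t: "t < n" "x $ t \<noteq> 0"
      using x(2) dims(1) by (metis eq_vecI index_zero_vec)
    have 1: "Q h $ t = 0" using Q0 t by blast
    have 2: "Q (quat_mult quat_i h) $ t = 0" unfolding IQ[symmetric] Qh using T0 t by blast
    have 3: "Q (quat_mult quat_j h) $ t = 0" unfolding JQ[symmetric] Qh using T0 t by blast
    have "J (Q h) = 0 \<cdot>\<^sub>v x" unfolding Qh by (rule veqI) (use V(4) x(1) cl T0 dims in auto)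
    then have 4: "Q (quat_mult quat_i (quat_mult quat_j h)) $ t = 0"
      unfolding IQ[symmetric] JQ[symmetric] using T0 t by simp
    \<comment> \<open>The norm identity: the conjugate of h applied to h x is the norm of h times x,
      read at a coordinate where x does not vanish.\<close>
    have "(a * a + b * b + c * c + d * d) * x $ t =
        a * Q h $ t - b * Q (quat_mult quat_i h) $ t - c * Q (quat_mult quat_j h) $ t
        - d * Q (quat_mult quat_i (quat_mult quat_j h)) $ t"
      unfolding h using t(1) by (simp add: Qt algebra_simps)
    then have "a * a + b * b + c * c + d * d = 0" using 1 2 3 4 t(2) by simp
    moreover have "a * a \<ge> 0" "b * b \<ge> 0" "c * c \<ge> 0" "d * d \<ge> 0" by auto
    ultimately have "a * a = 0" "b * b = 0" "c * c = 0" "d * d = 0" by linarith+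
    then show ?thesis unfolding h by (simp add: zero_prod_def)
  qed
  define \<psi> where "\<psi> u = Q (fst u) + C (Q (snd u))" for u :: "quaternion \<times> quaternion"
  have \<psi>V: "\<psi> u \<in> V" for u unfolding \<psi>_def by (intro V(3) cl(4) QV)
  have CQV: "C (Q h) \<in> V" for h by (rule cl(4)[OF QV])
  have \<psi>_add: "\<psi> (u + v) = \<psi> u + \<psi> v" for u v
  proof (rule veqI)
    fix t assume "t < n"
    then show "\<psi> (u + v) $ t = (\<psi> u + \<psi> v) $ t"
      by (simp add: \<psi>_def Q_add la QV dimV[OF QV] dimV[OF CQV])
  qed (use \<psi>V V in auto)
  have \<psi>_scale: "\<psi> (r *\<^sub>R u) = r \<cdot>\<^sub>v \<psi> u" for r u
  proof (rule veqI)
    fix t assume "t < n"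
    then show "\<psi> (r *\<^sub>R u) $ t = (r \<cdot>\<^sub>v \<psi> u) $ t"
      by (simp add: \<psi>_def Q_scale ls QV dimV[OF QV] dimV[OF CQV] algebra_simps)
  qed (use \<psi>V V in auto)
  have I\<psi>: "I (\<psi> (h, h')) = \<psi> (quat_mult quat_i h, quat_mult quat_i h')" for h h'
    by (simp add: \<psi>_def la QV CQV IQ[symmetric] CI[symmetric] del: quat_mult.simps)
  have J\<psi>: "J (\<psi> (h, h')) = \<psi> (quat_mult quat_j h, quat_mult quat_j h')" for h h'
    by (simp add: \<psi>_def la QV CQV JQ[symmetric] CJ[symmetric] del: quat_mult.simps)
  have Q_uminus: "Q (- h) = (- 1) \<cdot>\<^sub>v Q h" for h using Q_scale[of "- 1" h] by simp
  have A\<psi>: "A (\<psi> (h, h')) = \<psi> (h, - h')" for h h'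
    by (simp add: \<psi>_def la QV CQV AQ AC Q_uminus ls)
  have C\<psi>: "C (\<psi> (h, h')) = \<psi> (h', h)" for h h'
    using comm_add_vec[OF car[OF CQV, of h] car[OF QV, of h']] by (simp add: \<psi>_def la QV CQV CC)
  \<comment> \<open>\<open>A\<close> is 1 on the first summand and -1 on the second, so vanishing of
    the sum makes each summand vanish.\<close>
  have inj: "inj \<psi>"
  proof (rule injI)
    fix u v assume "\<psi> u = \<psi> v"
    then have "\<psi> (u - v) $ t = 0" if "t < n" for t
      using \<psi>_add[of "u - v" v] that dimV[OF \<psi>V]
      by (metis add_cancel_left_left diff_add_cancel index_add_vec(1))
    moreover obtain h h' where w: "u - v = (h, h')" by (rule prod.exhaust)
    ultimately have 0: "\<psi> (h, h') $ t = 0" if "t < n" for t using that by simp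
    then have z: "\<psi> (h, h') = 0 \<cdot>\<^sub>v x" by (intro veqI) (use \<psi>V V x dims in auto)
    have "A (\<psi> (h, h')) $ t = 0" if "t < n" for t
      unfolding z using ls(3)[OF x(1), of 0] x(3) that dims by simp
    then have 1: "\<psi> (h, - h') $ t = 0" if "t < n" for t unfolding A\<psi> using that by blast
    have e: "\<psi> (h, h') $ t = Q h $ t + C (Q h') $ t" "\<psi> (h, - h') $ t = Q h $ t - C (Q h') $ t" if "t < n" for t
      using that by (simp_all add: \<psi>_def Q_uminus ls QV dimV[OF QV] dimV[OF CQV])
    have "Q h $ t = 0" if "t < n" for t using 0[OF that] 1[OF that] e[OF that] by linarith
    then have "h = 0" by (rule Q_zero)
    have "C (Q h') $ t = 0" if "t < n" for t using 0[OF that] 1[OF that] e[OF that] by linarith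
    then have "C (Q h') = 0 \<cdot>\<^sub>v x" by (intro veqI) (use CQV V x dims in auto)
    then have "Q h' = 0 \<cdot>\<^sub>v C x" using CC[OF QV, of h'] ls(4)[OF x(1), of 0] by simp
    then have "Q h' $ t = 0" if "t < n" for t using that dimV[OF cl(4)[OF x(1)]] by simp
    then have "h' = 0" by (rule Q_zero)
    then have "u - v = 0" using w \<open>h = 0\<close> by (simp add: zero_prod_def)
    then show "u = v" by simp
  qed
  have "range \<psi> = V"
  proof -
    have sub\<psi>: "rep_submodule G n \<rho> (range \<psi>)"
    proof (rule sub)
      show "range \<psi> \<subseteq> V" using \<psi>V by blast
      have "\<psi> 0 = 0 \<cdot>\<^sub>v \<psi> 0" using \<psi>_scale[of 0 0] by simp
      then have "\<psi> 0 = 0\<^sub>v n" unfolding smz[OF \<psi>V] .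
      then show "0\<^sub>v n \<in> range \<psi>" by (metis rangeI)
      show "p + q \<in> range \<psi>" if pq: "p \<in> range \<psi>" "q \<in> range \<psi>" for p q
      proof -
        obtain u v where "p = \<psi> u" "q = \<psi> v" using pq by blast
        then have "p + q = \<psi> (u + v)" by (simp add: \<psi>_add)
        then show ?thesis by blast
      qed
      show "c \<cdot>\<^sub>v p \<in> range \<psi>" if p: "p \<in> range \<psi>" for c p
      proof -
        obtain u where "p = \<psi> u" using p by blast
        then have "c \<cdot>\<^sub>v p = \<psi> (c *\<^sub>R u)" by (simp add: \<psi>_scale)
        then show ?thesis by blast
      qed
      show "T p \<in> range \<psi>" if T: "T \<in> {I, J, A, C}" and p: "p \<in> range \<psi>" for T p
      proof -
        obtain h h' where "p = \<psi> (h, h')" using p by (metis imageE prod.exhaust)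
        then show ?thesis using T I\<psi>[of h h'] J\<psi>[of h h'] A\<psi>[of h h'] C\<psi>[of h h'] by (elim insertE emptyE) (metis rangeI)+
      qed
    qed
    have "\<psi> ((1, 0, 0, 0), 0) \<noteq> \<psi> 0" using injD[OF inj, of "((1, 0, 0, 0), 0)" 0] by (auto simp: zero_prod_def)
    then have "range \<psi> \<noteq> {0\<^sub>v n}" by (metis rangeI singletonD)
    then show ?thesis using min[OF sub\<psi>] \<psi>V by blast
  qed
  then have bij: "bij_betw \<psi> UNIV V" using inj unfolding bij_betw_def by blast
  show ?thesis
    by (rule quaternionic_type_of_coordinates[OF bij \<psi>_add \<psi>_scale I\<psi> J\<psi> A\<psi> C\<psi> gens])
qed

section \<open>The holonomy representation on the blocks\<close>

definition signed_perm :: "nat \<Rightarrow> bool \<times> bool \<Rightarrow> real vec \<Rightarrow> real vec" where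
  "signed_perm w s x = vec 48 (\<lambda>i. sgn_bit w s i * x $ (i XOR w))"

text \<open>The isotypic part of the representation for the character by which the centre acts on
  circle \<open>c\<close>.\<close>

definition block :: "nat \<Rightarrow> real vec set" where
  "block c = {x \<in> carrier_vec 48. \<forall>i<48. i div 16 \<noteq> c \<longrightarrow> x $ i = 0}"

text \<open>The cocycle composed with that character: \<open>beta2\<close>, \<open>beta1\<close> and
  their sum for c = 0, 1, 2. Its diagonal gives the signs of squares, its asymmetry those of
  commutators.\<close>

definition block_form :: "nat \<Rightarrow> nat \<Rightarrow> nat \<Rightarrow> bool" where
  "block_form c u v = sign_bit (beta1 u v, beta2 u v) c"

abbreviation "perm_op w \<equiv> signed_perm w (False, False)"

lemma signed_perm_carrier [simp]: "signed_perm w s x \<in> carrier_vec 48" "dim_vec (signed_perm w s x) = 48"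
  unfolding signed_perm_def by simp_all

lemma signed_perm_index [simp]: "i < 48 \<Longrightarrow> signed_perm w s x $ i = sgn_bit w s i * x $ (i XOR w)"
  unfolding signed_perm_def by simp

lemma linear_part_act_real:
  assumes w: "w < 16" and x: "x \<in> carrier_vec 48"
  shows "map_mat real_of_int (cryst.linear_part (act w s m)) *\<^sub>v x = signed_perm w s x"
proof (rule eq_vecI)
  let ?A = "cryst.linear_part (act w s m)"
  have A: "?A \<in> carrier_mat 48 48" by (simp add: cryst.linear_part_def)
  fix i assume "i < dim_vec (signed_perm w s x)"
  then have i: "i < 48" by simp
  have iw: "i XOR w < 48" using xor_block(2)[OF w] i by simp
  have entry: "?A $$ (i, j) = (if j = i XOR w then sgn_bit w s i else 0)" if j: "j < 48" for j
  proof -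
    have "?A $$ (i, j) = (?A *\<^sub>v unit_vec 48 j) $ i"
      using A i j by (simp add: scalar_prod_right_unit)
    also have "\<dots> = sgn_bit w s i * unit_vec 48 j $ (i XOR w)"
      by (rule linear_part_act[OF w i]) simp
    finally show ?thesis using iw j by (simp add: unit_vec_def eq_commute)
  qed
  have "(map_mat real_of_int ?A *\<^sub>v x) $ i = (\<Sum>j<48. real_of_int (?A $$ (i, j)) * x $ j)"
    using A i x by (simp add: scalar_prod_def atLeast0LessThan)
  also have "\<dots> = (\<Sum>j<48. if j = i XOR w then sgn_bit w s i * x $ j else 0)"
    by (intro sum.cong) (auto simp: entry)
  also have "\<dots> = sgn_bit w s i * x $ (i XOR w)" using iw by (subst sum.delta) auto
  finally show "(map_mat real_of_int ?A *\<^sub>v x) $ i = signed_perm w s x $ i" using i by simp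
qed (simp add: cryst.linear_part_def)

lemma signed_perm_add:
  "w < 16 \<Longrightarrow> x \<in> carrier_vec 48 \<Longrightarrow> y \<in> carrier_vec 48 \<Longrightarrow>
     signed_perm w s (x + y) = signed_perm w s x + signed_perm w s y"
  by (intro eq_vecI) (simp_all add: xor_block algebra_simps)

lemma signed_perm_scale:
  "w < 16 \<Longrightarrow> x \<in> carrier_vec 48 \<Longrightarrow> signed_perm w s (c \<cdot>\<^sub>v x) = c \<cdot>\<^sub>v signed_perm w s x"
  by (intro eq_vecI) (simp_all add: xor_block algebra_simps)

lemma signed_perm_comp:
  assumes "w < 16"
  shows "signed_perm w s (signed_perm w' s' x) = signed_perm (w XOR w') (twist_sum w s w' s') x"
proof (rule eq_vecI)
  fix i assume "i < dim_vec (signed_perm (w XOR w') (twist_sum w s w' s') x)"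
  then have i: "i < 48" by simp
  then have iw: "i XOR w < 48" using xor_block(2)[OF assms] by simp
  have "signed_perm w s (signed_perm w' s' x) $ i =
      (sgn_bit w s i * sgn_bit w' s' (i XOR w)) * x $ ((i XOR w) XOR w')"
    unfolding signed_perm_index[OF i] signed_perm_index[OF iw] by (simp only: mult.assoc)
  also have "\<dots> = signed_perm (w XOR w') (twist_sum w s w' s') x $ i"
    unfolding sgn_bit_comp[OF assms] signed_perm_index[OF i] xor.assoc ..
  finally show "signed_perm w s (signed_perm w' s' x) $ i = signed_perm (w XOR w') (twist_sum w s w' s') x $ i" .
qed simp

text \<open>On one block the centre acts by signs, so submodules and commutants are determined by
  the operators \<open>perm_op w\<close> alone.\<close>

lemma signed_perm_block:
  assumes w: "w < 16" and x: "x \<in> block c"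
  shows "signed_perm w s x = (if sign_bit s c then - 1 else 1) \<cdot>\<^sub>v perm_op w x"
proof (rule eq_vecI)
  fix i assume "i < dim_vec ((if sign_bit s c then - 1 else 1) \<cdot>\<^sub>v perm_op w x)"
  then have i: "i < 48" by simp
  have t: "twist w s i = (fst s \<noteq> fst (twist w (False, False) i), snd s \<noteq> snd (twist w (False, False) i))"
    unfolding twist_def by simp
  show "signed_perm w s x $ i = ((if sign_bit s c then - 1 else 1) \<cdot>\<^sub>v perm_op w x) $ i"
  proof (cases "i div 16 = c")
    case True
    then show ?thesis using i unfolding signed_perm_index[OF i] t sign_bit_add by simp
  next
    case False
    then have "x $ (i XOR w) = 0" using x i xor_block[OF w, of i] unfolding block_def by simp
    then show ?thesis using i by simp
  qed
qed simp

lemma perm_op_comp: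
  assumes "w < 16" "w' < 16" "x \<in> block c"
  shows "perm_op w (perm_op w' x) = (if block_form c w' w then - 1 else 1) \<cdot>\<^sub>v perm_op (w XOR w') x"
proof -
  have "twist_sum w (False, False) w' (False, False) = (beta1 w' w, beta2 w' w)"
    by (simp add: twist_sum_def)
  then show ?thesis
    unfolding signed_perm_comp[OF assms(1)] block_form_def
    using signed_perm_block[OF xor_less_16[OF assms(1,2)] assms(3)] by metis
qed

lemma perm_op_xor:
  assumes "w < 16" "w' < 16" "x \<in> block c"
  shows "perm_op (w XOR w') x = (if block_form c w' w then - 1 else 1) \<cdot>\<^sub>v perm_op w (perm_op w' x)"
  unfolding perm_op_comp[OF assms] by (cases "block_form c w' w") (simp_all add: smult_smult_assoc)

lemma perm_op_zero: "x \<in> carrier_vec 48 \<Longrightarrow> perm_op 0 x = x"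
  by (intro eq_vecI) (auto simp: twist_def beta_zero sign_bit_def)

lemma perm_op_square:
  assumes "w < 16" "x \<in> block c"
  shows "perm_op w (perm_op w x) = (if block_form c w w then - 1 else 1) \<cdot>\<^sub>v x"
  using perm_op_comp[OF assms(1,1,2)] perm_op_zero assms(2) by (simp add: block_def)

lemma perm_op_commute:
  assumes "w < 16" "w' < 16" "x \<in> block c"
  shows "perm_op w (perm_op w' x) =
    (if block_form c w w' = block_form c w' w then 1 else - 1) \<cdot>\<^sub>v perm_op w' (perm_op w x)"
  unfolding perm_op_comp[OF assms] perm_op_comp[OF assms(2,1,3)]
  unfolding xor.commute[of w' w]
  by (cases "block_form c w w'"; cases "block_form c w' w") (simp_all add: smult_smult_assoc)

lemma signed_perm_mem_block:
  assumes "w < 16" "x \<in> block c"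
  shows "signed_perm w s x \<in> block c"
  unfolding block_def
proof (intro CollectI conjI allI impI)
  fix i assume i: "i < 48" "i div 16 \<noteq> c"
  have "x $ (i XOR w) = 0" using assms(2) i xor_block[OF assms(1), of i] unfolding block_def by simp
  then show "signed_perm w s x $ i = 0" using i(1) by simp
qed simp

section \<open>Irreducible submodules of the holonomy representation\<close>

definition holonomy_matrices :: "real mat set" where
  "holonomy_matrices = map_mat real_of_int ` cryst.linear_part ` cryst_group"

lemma holonomy_matrix_action:
  assumes "\<rho> ` carrier G = holonomy_matrices"
  shows "a \<in> carrier G \<Longrightarrow> \<exists>w<16. \<exists>s. \<forall>x\<in>carrier_vec 48. \<rho> a *\<^sub>v x = signed_perm w s x"
    and "w < 16 \<Longrightarrow> \<exists>a\<in>carrier G. \<forall>x\<in>carrier_vec 48. \<rho> a *\<^sub>v x = signed_perm w s x"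
proof -
  show "\<exists>w<16. \<exists>s. \<forall>x\<in>carrier_vec 48. \<rho> a *\<^sub>v x = signed_perm w s x" if "a \<in> carrier G"
  proof -
    have "\<rho> a \<in> holonomy_matrices" using that assms by blast
    then obtain w s m where "w < 16" "\<rho> a = map_mat real_of_int (cryst.linear_part (act w s m))"
      unfolding holonomy_matrices_def cryst_group_def by blast
    then show ?thesis using linear_part_act_real by metis
  qed
  show "\<exists>a\<in>carrier G. \<forall>x\<in>carrier_vec 48. \<rho> a *\<^sub>v x = signed_perm w s x" if w: "w < 16"
  proof -
    have "map_mat real_of_int (cryst.linear_part (act w s (\<lambda>_. 0))) \<in> \<rho> ` carrier G"
      unfolding assms holonomy_matrices_def using act_mem[OF w] by blast
    then obtain a where "a \<in> carrier G" "map_mat real_of_int (cryst.linear_part (act w s (\<lambda>_. 0))) = \<rho> a"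
      by blast
    then show ?thesis using linear_part_act_real[OF w] by metis
  qed
qed

text \<open>The vectors i and j generate a quaternion group and r and g a dihedral group commuting
  with it: this is the central product Q_8 \<circ> D_8 in coordinates. Here r plays the part of
  diag(1, -1) and g that of the swap. \<open>generate\<close> says, as an induction principle, that
  the four vectors span F_2^4.\<close>

lemma quaternionic_type_block:
  assumes \<rho>: "\<rho> ` carrier G = holonomy_matrices"
    and irr: "irreducible_rep_submodule G 48 \<rho> V" and Vc: "V \<subseteq> block c"
    and less: "i < 16" "j < 16" "r < 16" "g < 16"
    and squares: "block_form c i i" "block_form c j j" "\<not> block_form c r r" "\<not> block_form c g g"
    and anticommute: "block_form c i j \<noteq> block_form c j i" "block_form c r g \<noteq> block_form c g r"
    and commute: "block_form c i r = block_form c r i" "block_form c j r = block_form c r j"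
      "block_form c i g = block_form c g i" "block_form c j g = block_form c g j"
    and generate: "\<And>P w. P i \<Longrightarrow> P j \<Longrightarrow> P r \<Longrightarrow> P g \<Longrightarrow>
        (\<And>u v. u < 16 \<Longrightarrow> v < 16 \<Longrightarrow> P u \<Longrightarrow> P v \<Longrightarrow> P (u XOR v)) \<Longrightarrow> w < 16 \<Longrightarrow> P w"
  shows "quaternionic_type G \<rho> V"
proof -
  have sub: "rep_submodule G 48 \<rho> V" using irr unfolding irreducible_rep_submodule_def by blast
  have Vcar: "V \<subseteq> carrier_vec 48" and Vadd: "\<And>x y. x \<in> V \<Longrightarrow> y \<in> V \<Longrightarrow> x + y \<in> V"
    and Vscale: "\<And>k x. x \<in> V \<Longrightarrow> k \<cdot>\<^sub>v x \<in> V" and V\<rho>: "\<And>a x. a \<in> carrier G \<Longrightarrow> x \<in> V \<Longrightarrow> \<rho> a *\<^sub>v x \<in> V"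
    using sub unfolding rep_submodule_def by auto
  note xb = subsetD[OF Vc] and xc = subsetD[OF Vcar]
  let ?ops = "{perm_op i, perm_op j, perm_op r, perm_op g}"
  have op: "\<exists>w<16. T = perm_op w" if "T \<in> ?ops" for T using that less by blast
  have closed: "perm_op w x \<in> V" if "w < 16" "x \<in> V" for w x
    using holonomy_matrix_action(2)[OF \<rho> that(1), of "(False, False)"] V\<rho> that(2) xc by metis
  show ?thesis
  proof (rule quaternionic_type_of_relations[OF irr, of "perm_op i" "perm_op j" "perm_op r" "perm_op g"])
    show "T x \<in> V" if "T \<in> ?ops" "x \<in> V" for T x using op[OF that(1)] closed that(2) by blast
    show "T (x + y) = T x + T y" if "T \<in> ?ops" "x \<in> V" "y \<in> V" for T x y
      using op[OF that(1)] signed_perm_add xc that by blast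
    show "T (k \<cdot>\<^sub>v x) = k \<cdot>\<^sub>v T x" if "T \<in> ?ops" "x \<in> V" for T x k
      using op[OF that(1)] signed_perm_scale xc that by blast
    show "perm_op i (perm_op i x) = - 1 \<cdot>\<^sub>v x" if "x \<in> V" for x
      unfolding perm_op_square[OF less(1) xb[OF that]] using squares(1) by (simp add: one_smult_vec)
    show "perm_op j (perm_op j x) = - 1 \<cdot>\<^sub>v x" if "x \<in> V" for x
      unfolding perm_op_square[OF less(2) xb[OF that]] using squares(2) by (simp add: one_smult_vec)
    show "perm_op r (perm_op r x) = x" if "x \<in> V" for x
      unfolding perm_op_square[OF less(3) xb[OF that]] using squares(3) by (simp add: one_smult_vec)
    show "perm_op g (perm_op g x) = x" if "x \<in> V" for x
      unfolding perm_op_square[OF less(4) xb[OF that]] using squares(4) by (simp add: one_smult_vec)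
    show "perm_op j (perm_op i x) = - 1 \<cdot>\<^sub>v perm_op i (perm_op j x)" if "x \<in> V" for x
      unfolding perm_op_commute[OF less(2) less(1) xb[OF that]] using anticommute(1) by (simp add: one_smult_vec)
    show "perm_op r (perm_op g x) = - 1 \<cdot>\<^sub>v perm_op g (perm_op r x)" if "x \<in> V" for x
      unfolding perm_op_commute[OF less(3) less(4) xb[OF that]] using anticommute(2) by (simp add: one_smult_vec)
    show "perm_op r (perm_op i x) = perm_op i (perm_op r x)" if "x \<in> V" for x
      unfolding perm_op_commute[OF less(3) less(1) xb[OF that]] using commute(1) by (simp add: one_smult_vec)
    show "perm_op r (perm_op j x) = perm_op j (perm_op r x)" if "x \<in> V" for x
      unfolding perm_op_commute[OF less(3) less(2) xb[OF that]] using commute(2) by (simp add: one_smult_vec)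
    show "perm_op g (perm_op i x) = perm_op i (perm_op g x)" if "x \<in> V" for x
      unfolding perm_op_commute[OF less(4) less(1) xb[OF that]] using commute(3) by (simp add: one_smult_vec)
    show "perm_op g (perm_op j x) = perm_op j (perm_op g x)" if "x \<in> V" for x
      unfolding perm_op_commute[OF less(4) less(2) xb[OF that]] using commute(4) by (simp add: one_smult_vec)
    show "rep_submodule G 48 \<rho> W"
      if W: "W \<subseteq> V" "0\<^sub>v 48 \<in> W" "\<And>x y. x \<in> W \<Longrightarrow> y \<in> W \<Longrightarrow> x + y \<in> W"
        "\<And>k x. x \<in> W \<Longrightarrow> k \<cdot>\<^sub>v x \<in> W" "\<And>T x. T \<in> ?ops \<Longrightarrow> x \<in> W \<Longrightarrow> T x \<in> W" for W
    proof -
      \<comment> \<open>Up to sign the operators compose by XOR, so stability under the four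
        generators spreads to every w.\<close>
      have perm: "\<forall>x\<in>W. perm_op w x \<in> W" if "w < 16" for w
      proof (rule generate[of "\<lambda>w. \<forall>x\<in>W. perm_op w x \<in> W", OF _ _ _ _ _ that])
        fix u v assume uv: "u < 16" "v < 16" "\<forall>x\<in>W. perm_op u x \<in> W" "\<forall>x\<in>W. perm_op v x \<in> W"
        show "\<forall>x\<in>W. perm_op (u XOR v) x \<in> W"
        proof
          fix x assume x: "x \<in> W"
          have "x \<in> block c" by (rule subsetD[OF Vc subsetD[OF W(1) x]])
          then have "perm_op (u XOR v) x = (if block_form c v u then - 1 else 1) \<cdot>\<^sub>v perm_op u (perm_op v x)"
            by (rule perm_op_xor[OF uv(1,2)])
          then show "perm_op (u XOR v) x \<in> W" using W(4) uv(3,4) x by simp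
        qed
      qed (use W(5) in auto)
      have "\<rho> a *\<^sub>v x \<in> W" if a: "a \<in> carrier G" and x: "x \<in> W" for a x
      proof -
        obtain w s where w: "w < 16" "\<forall>x\<in>carrier_vec 48. \<rho> a *\<^sub>v x = signed_perm w s x"
          using holonomy_matrix_action(1)[OF \<rho> a] by blast
        have "x \<in> block c" "x \<in> carrier_vec 48"
          using subsetD[OF Vc subsetD[OF W(1) x]] subsetD[OF Vcar subsetD[OF W(1) x]] by simp_all
        then have "\<rho> a *\<^sub>v x = (if sign_bit s c then - 1 else 1) \<cdot>\<^sub>v perm_op w x"
          using w(2) signed_perm_block[OF w(1), of x c s] by simp
        then show ?thesis using W(4) perm[OF w(1)] x by simp
      qed
      then show ?thesis unfolding rep_submodule_def using W(1-4) Vcar by blast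
    qed
    show "(\<forall>a\<in>carrier G. \<forall>x\<in>V. f (\<rho> a *\<^sub>v x) = \<rho> a *\<^sub>v f x) \<longleftrightarrow>
        (\<forall>x\<in>V. f (perm_op i x) = perm_op i (f x) \<and> f (perm_op j x) = perm_op j (f x) \<and>
           f (perm_op r x) = perm_op r (f x) \<and> f (perm_op g x) = perm_op g (f x))"
      if f: "f \<in> V \<rightarrow> V" and fadd: "\<And>x y. x \<in> V \<Longrightarrow> y \<in> V \<Longrightarrow> f (x + y) = f x + f y"
        and fscale: "\<And>k x. x \<in> V \<Longrightarrow> f (k \<cdot>\<^sub>v x) = k \<cdot>\<^sub>v f x" for f
    proof
      have fV: "f x \<in> V" if "x \<in> V" for x using f that by blast
      {
        assume e: "\<forall>a\<in>carrier G. \<forall>x\<in>V. f (\<rho> a *\<^sub>v x) = \<rho> a *\<^sub>v f x"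
        have "f (perm_op w x) = perm_op w (f x)" if w: "w < 16" and x: "x \<in> V" for w x
        proof -
          obtain a where a: "a \<in> carrier G" "\<forall>x\<in>carrier_vec 48. \<rho> a *\<^sub>v x = perm_op w x"
            using holonomy_matrix_action(2)[OF \<rho> w] by blast
          then show ?thesis using e x xc[OF x] xc[OF fV[OF x]] by metis
        qed
        then show "\<forall>x\<in>V. f (perm_op i x) = perm_op i (f x) \<and> f (perm_op j x) = perm_op j (f x) \<and>
           f (perm_op r x) = perm_op r (f x) \<and> f (perm_op g x) = perm_op g (f x)" using less by blast
      }
      assume e: "\<forall>x\<in>V. f (perm_op i x) = perm_op i (f x) \<and> f (perm_op j x) = perm_op j (f x) \<and>
           f (perm_op r x) = perm_op r (f x) \<and> f (perm_op g x) = perm_op g (f x)"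
      have perm: "\<forall>x\<in>V. f (perm_op w x) = perm_op w (f x)" if "w < 16" for w
      proof (rule generate[of "\<lambda>w. \<forall>x\<in>V. f (perm_op w x) = perm_op w (f x)", OF _ _ _ _ _ that])
        fix u v assume uv: "u < 16" "v < 16" "\<forall>x\<in>V. f (perm_op u x) = perm_op u (f x)"
          "\<forall>x\<in>V. f (perm_op v x) = perm_op v (f x)"
        show "\<forall>x\<in>V. f (perm_op (u XOR v) x) = perm_op (u XOR v) (f x)"
        proof
          fix x assume x: "x \<in> V"
          let ?e = "if block_form c v u then - 1 else 1 :: real"
          have p: "perm_op (u XOR v) y = ?e \<cdot>\<^sub>v perm_op u (perm_op v y)" if "y \<in> V" for y
            by (rule perm_op_xor[OF uv(1,2) xb[OF that]])
          show "f (perm_op (u XOR v) x) = perm_op (u XOR v) (f x)"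
            unfolding p[OF x] p[OF fV[OF x]] using fscale closed uv x by simp
        qed
      qed (use e in auto)
      show "\<forall>a\<in>carrier G. \<forall>x\<in>V. f (\<rho> a *\<^sub>v x) = \<rho> a *\<^sub>v f x"
      proof (intro ballI)
        fix a x assume a: "a \<in> carrier G" and x: "x \<in> V"
        obtain w s where w: "w < 16" "\<forall>x\<in>carrier_vec 48. \<rho> a *\<^sub>v x = signed_perm w s x"
          using holonomy_matrix_action(1)[OF \<rho> a] by blast
        have "\<rho> a *\<^sub>v y = (if sign_bit s c then - 1 else 1) \<cdot>\<^sub>v perm_op w y" if "y \<in> V" for y
          using w(2) signed_perm_block[OF w(1) xb[OF that], of s] xc[OF that] by simp
        then show "f (\<rho> a *\<^sub>v x) = \<rho> a *\<^sub>v f x"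
          using x fV[OF x] fscale[OF closed[OF w(1) x]] perm[OF w(1)] by simp
      qed
    qed
  qed
qed

text \<open>The three characters of the centre are distinct, so central elements project
  \<open>V\<close> to the blocks; a nonzero projection gives a nonzero submodule inside a
  block.\<close>

lemma irreducible_subset_block:
  assumes \<rho>: "\<rho> ` carrier G = holonomy_matrices" and irr: "irreducible_rep_submodule G 48 \<rho> V"
  shows "\<exists>c<3. V \<subseteq> block c"
proof -
  have sub: "rep_submodule G 48 \<rho> V" and min: "\<And>W. rep_submodule G 48 \<rho> W \<Longrightarrow> W \<subseteq> V \<Longrightarrow> W = {0\<^sub>v 48} \<or> W = V"
    and ne: "V \<noteq> {0\<^sub>v 48}" using irr unfolding irreducible_rep_submodule_def by auto
  have V: "V \<subseteq> carrier_vec 48" "0\<^sub>v 48 \<in> V" "\<And>x y. x \<in> V \<Longrightarrow> y \<in> V \<Longrightarrow> x + y \<in> V"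
    "\<And>k x. x \<in> V \<Longrightarrow> k \<cdot>\<^sub>v x \<in> V" "\<And>a x. a \<in> carrier G \<Longrightarrow> x \<in> V \<Longrightarrow> \<rho> a *\<^sub>v x \<in> V"
    using sub unfolding rep_submodule_def by auto
  obtain y where y: "y \<in> V" "y \<noteq> 0\<^sub>v 48" using ne V(2) by blast
  then have yc: "y \<in> carrier_vec 48" using V(1) by blast
  obtain k where k: "k < 48" "y $ k \<noteq> 0" using y(2) yc by (metis carrier_vecD eq_vecI index_zero_vec)
  define c where "c = k div 16"
  have c3: "c < 3" using k(1) unfolding c_def by simp
  \<comment> \<open>The central element that acts as 1 on block c and as -1 on the other two; adding
    its action to \<open>y\<close> yields twice the projection of \<open>y\<close> to block
    c.\<close>
  define s where "s = (c \<noteq> 1, c \<noteq> 0)"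
  have s: "sign_bit s c' \<longleftrightarrow> c' \<noteq> c" if "c' < 3" for c'
    using that c3 unfolding s_def sign_bit_def by auto
  have t0: "twist 0 s i = s" for i by (simp add: twist_def beta_zero)
  let ?x = "signed_perm 0 s y + y"
  have xi: "?x $ i = (if i div 16 = c then 2 * y $ i else 0)" if "i < 48" for i
    using that yc s[of "i div 16"] by (simp add: t0)
  have xb: "?x \<in> block c" unfolding block_def using yc xi by simp
  have "?x \<in> V" using holonomy_matrix_action(2)[OF \<rho>, of 0 s] V(3,5) y(1) yc by fastforce
  moreover have "?x \<noteq> 0\<^sub>v 48" using xi[OF k(1)] k unfolding c_def by auto
  ultimately have W: "V \<inter> block c \<noteq> {0\<^sub>v 48}" using xb by blast
  have "rep_submodule G 48 \<rho> (V \<inter> block c)"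
    unfolding rep_submodule_def
  proof (intro conjI ballI allI)
    fix a x assume a: "a \<in> carrier G" and x: "x \<in> V \<inter> block c"
    obtain w s where w: "w < 16" "\<forall>x\<in>carrier_vec 48. \<rho> a *\<^sub>v x = signed_perm w s x"
      using holonomy_matrix_action(1)[OF \<rho> a] by blast
    then have "\<rho> a *\<^sub>v x = signed_perm w s x" using x V(1) by blast
    then show "\<rho> a *\<^sub>v x \<in> V \<inter> block c" using V(5)[OF a, of x] x signed_perm_mem_block[OF w(1)] by simp
  next
    show "x + y \<in> V \<inter> block c" if "x \<in> V \<inter> block c" "y \<in> V \<inter> block c" for x y
      using that V(3) unfolding block_def by auto
    show "k \<cdot>\<^sub>v x \<in> V \<inter> block c" if "x \<in> V \<inter> block c" for k x
      using that V(4) unfolding block_def by auto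
  qed (use V(1,2) in \<open>auto simp: block_def\<close>)
  then have "V \<inter> block c = V" using min W by blast
  then show ?thesis using c3 by blast
qed

lemma lessThan_16: "{..<16::nat} = {0, 1, 2, 3, 4, 5, 6, 7, 8, 9, 10, 11, 12, 13, 14, 15}"
  by (auto elim: below_16_cases)

text \<open>\<open>span\<close> lists the sums of all subsets of the four vectors, so at concrete
  values the basis property becomes an inclusion of explicit sets.\<close>

lemma generate_16:
  fixes P :: "nat \<Rightarrow> bool"
  assumes "P i" "P j" "P r" "P g" and less: "i < 16" "j < 16" "r < 16" "g < 16"
    and xor: "\<And>u v. u < 16 \<Longrightarrow> v < 16 \<Longrightarrow> P u \<Longrightarrow> P v \<Longrightarrow> P (u XOR v)"
    and span: "{..<16} \<subseteq> {0, i, j, i XOR j, r, i XOR r, j XOR r, (i XOR j) XOR r,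
        g, i XOR g, j XOR g, (i XOR j) XOR g, r XOR g, i XOR (r XOR g), j XOR (r XOR g), (i XOR j) XOR (r XOR g)}"
    and w: "w < 16"
  shows "P w"
proof -
  have 0: "P 0" using xor[OF less(1,1) assms(1,1)] by simp
  have ij: "P (i XOR j)" and rg: "P (r XOR g)" using xor less assms(1-4) by auto
  note l = xor_less_16[OF less(1,2)] xor_less_16[OF less(3,4)]
  show ?thesis using subsetD[OF span, of w] w 0 ij rg xor less l assms(1-4) by auto
qed

text \<open>In each block the four numbers split the quadratic form into an anisotropic plane,
  spanned by the first two, and an orthogonal hyperbolic plane: the normal form for Arf invariant 1
  in rank 4.\<close>

lemma quaternionic_type_irreducible:
  assumes \<rho>: "\<rho> ` carrier G = holonomy_matrices" and irr: "irreducible_rep_submodule G 48 \<rho> V"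
  shows "quaternionic_type G \<rho> V"
proof -
  note defs = block_form_def sign_bit_def beta1_def beta2_def bit_iff_odd
  obtain c where c: "c < 3" "V \<subseteq> block c" using irreducible_subset_block[OF \<rho> irr] by blast
  consider "c = 0" | "c = 1" | "c = 2" using c(1) by linarith
  then show ?thesis
  proof cases
    case 1
    show ?thesis
    proof (rule quaternionic_type_block[OF \<rho> irr c(2), of 3 4 10 12])
      show "P w" if "P 3" "P 4" "P 10" "P 12" "\<And>u v. u < 16 \<Longrightarrow> v < 16 \<Longrightarrow> P u \<Longrightarrow> P v \<Longrightarrow> P (u XOR v)" "w < 16"
        for P :: "nat \<Rightarrow> bool" and w using generate_16[of P 3 4 10 12 w] that by (simp add: lessThan_16)
    qed (simp_all add: 1 defs)
  next
    case 2
    show ?thesis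
    \<comment> \<open>The form \<open>beta1\<close> is already in this normal form, so the standard
      basis serves.\<close>
    proof (rule quaternionic_type_block[OF \<rho> irr c(2), of 1 2 4 8])
      show "P w" if "P 1" "P 2" "P 4" "P 8" "\<And>u v. u < 16 \<Longrightarrow> v < 16 \<Longrightarrow> P u \<Longrightarrow> P v \<Longrightarrow> P (u XOR v)" "w < 16"
        for P :: "nat \<Rightarrow> bool" and w using generate_16[of P 1 2 4 8 w] that by (simp add: lessThan_16)
    qed (simp_all add: 2 defs)
  next
    case 3
    show ?thesis
    proof (rule quaternionic_type_block[OF \<rho> irr c(2), of 1 4 9 11])
      show "P w" if "P 1" "P 4" "P 9" "P 11" "\<And>u v. u < 16 \<Longrightarrow> v < 16 \<Longrightarrow> P u \<Longrightarrow> P v \<Longrightarrow> P (u XOR v)" "w < 16"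
        for P :: "nat \<Rightarrow> bool" and w using generate_16[of P 1 4 9 11 w] that by (simp add: lessThan_16)
    qed (simp_all add: 3 defs)
  qed
qed

theorem theorem3p1:
  "\<exists>(n :: nat) (M :: (nat \<Rightarrow> real) set topology) A g.
     flat_manifold n M A g \<and>
     (\<forall>p\<in>topspace M. holonomy_of_quaternionic_type n (fundamental_group M p))"
proof (intro exI conjI ballI)
  show "flat_manifold 48 cryst.M cryst.atlas cryst.flat_metric" by (rule cryst.flat_manifold_M) simp
  fix p assume "p \<in> topspace cryst.M"
  then obtain x0 where x0: "x0 \<in> cryst.E" "p = cryst.orbit x0" unfolding cryst.topspace_M by blast
  obtain \<iota> where \<iota>: "\<iota> \<in> iso (monoid_vec TYPE(int) 48)
      ((fundamental_group cryst.M p)\<lparr>carrier := translation_lattice (fundamental_group cryst.M p)\<rparr>)"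
    and rep: "holonomy_rep (fundamental_group cryst.M p) 48 \<iota> ` carrier (holonomy_group (fundamental_group cryst.M p))
      = cryst.linear_part ` cryst_group"
    using cryst.holonomy_fundamental_group[OF x0(1)] unfolding x0(2) by blast
  have "(\<lambda>a. map_mat real_of_int (holonomy_rep (fundamental_group cryst.M p) 48 \<iota> a)) `
      carrier (holonomy_group (fundamental_group cryst.M p)) = holonomy_matrices"
    unfolding holonomy_matrices_def rep[symmetric] by (simp add: image_image)
  then show "holonomy_of_quaternionic_type 48 (fundamental_group cryst.M p)"
    unfolding holonomy_of_quaternionic_type_def Let_def
    using \<iota> quaternionic_type_irreducible by blast
qed

end
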